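(* In the setting described in the context (in particular assuming that for all $f,g\in C_0(E)\cap D(\mathcal{E})$ one has $fg\in C_0(E)\cap D(\mathcal{E})$ and $(f(y)-f(x))g(y)$ is integrable w.r.t. $J$), let $u,v\in C_0(E)\cap D(\mathcal{E})$ and let $\chi\in C_0(E)\cap D(\mathcal{E})$ equal $1$ on a neighbourhood of $\mathrm{supp}[u]\cup\mathrm{supp}[v]$. Then $$\mathcal{E}^c(u,v)=\frac12\int_E\chi\,d\mu^c_{\langle u,v\rangle}+\langle L(u,v),\chi\rangle.$$
   Context: $E$ is a locally compact separable metric space with metric $\rho$, $m$ a positive Radon measure on $E$ with $\mathrm{supp}[m]=E$, $(\cdot,\cdot)$ the inner product of $L^2(E;m)$, $d$ the diagonal of $E\times E$, and $(\mathcal{E},D(\mathcal{E}))$ a regular semi-Dirichlet form on $L^2(E;m)$ with resolvent $(G_\beta)$ and co-resolvent $(\hat G_\beta)$. Standing assumption: for $f,g\in C_0(E)\cap D(\mathcal{E})$, $fg\in C_0(E)\cap D(\mathcal{E})$ and $(f(y)-f(x))g(y)$ is $J$-integrable. $J$ (positive Radon on $E\times E\setminus d$) and $K$ (positive Radon on $E$) are the jumping and killing measures: the unique measures with $\mathcal{E}(u,v)=\int_{E\times E\setminus d}2(u(y)-u(x))v(y)J(dxdy)+\int_E uv\,dK$ whenever $v\in C_0(E)\cap D(\mathcal{E})$ and $u\in C_0(E)\cap D(\mathcal{E})$ is constant on a neighbourhood of $\mathrm{supp}[v]$. $\hat\sigma_\beta$ is the positive Radon measure on $E\times E$ with $(\beta\hat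 G_\beta u,v)=\int u(x)v(y)\hat\sigma_\beta(dxdy)$. Fix relatively compact open $\Omega_l\uparrow E$, $\varsigma_l\downarrow0$ with $\{(x,y)\in\Omega_l^2:\rho(x,y)\ge\varsigma_l\}$ a $J$-continuity set, and $\Lambda_l:=\{(x,y)\in\Omega_l^2:\rho(x,y)<\varsigma_l\}$. For $u,v\in C_0(E)\cap D(\mathcal{E})$: the diffusion part is $\mathcal{E}^c(u,v):=\mathcal{E}(u,v)-\int_{E\times E\setminus d}2(u(y)-u(x))v(y)J(dxdy)-\int_E uv\,dK$; $\hat{\mathcal{E}}^c(u,v):=\lim_l\lim_{\beta\to\infty}\beta\int_{\Lambda_l}(u(y)-u(x))v(y)\hat\sigma_\beta(dxdy)$ (the limit exists); $\mu^c_{\langle u,v\rangle}$ is the unique signed Radon measure on $E$ with $\int_E f\,d\mu^c_{\langle u,v\rangle}=\mathcal{E}^c(u,vf)+\mathcal{E}^c(v,uf)-\mathcal{E}^c(uv,f)$ for all $f\in C_0(E)\cap D(\mathcal{E})$ (it exists); and $L(u,v)$ is the linear functional on $C_0(E)\cap D(\mathcal{E})$ given by $\langle L(u,v),f\rangle:=\frac12(\mathcal{E}^c(u,vf)-\hat{\mathcal{E}}^c(u,vf))$. *)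

theory Defs
  imports "HOL-Analysis.Analysis" "HOL-Probability.Probability"
begin

text \<open>Setting: E is the whole type 'a (a locally compact separable metric space,
  metric = dist). C_0(E) denotes continuous functions with compact support
  (Fukushima-Oshima-Takeda convention). L^2(E;m) is modelled by real functions,
  with the form required to be insensitive to m-a.e. modification.\<close>

definition fsupp :: "('a::topological_space \<Rightarrow> real) \<Rightarrow> 'a set" where
  "fsupp f = closure {x. f x \<noteq> 0}"

definition C0 :: "('a::topological_space \<Rightarrow> real) set" where
  "C0 = {f. continuous_on UNIV f \<and> compact (fsupp f)}"

definition ip :: "'a measure \<Rightarrow> ('a \<Rightarrow> real) \<Rightarrow> ('a \<Rightarrow> real) \<Rightarrow> real" where
  "ip m f g = (\<integral>x. f x * g x \<partial>m)"

definition L2 :: "'a measure \<Rightarrow> ('a \<Rightarrow> real) set" where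
  "L2 m = {f. f \<in> borel_measurable m \<and> integrable m (\<lambda>x. (f x)\<^sup>2)}"

definition radon :: "'a::topological_space measure \<Rightarrow> bool" where
  "radon \<mu> \<longleftrightarrow> sets \<mu> = sets borel \<and> (\<forall>C. compact C \<longrightarrow> emeasure \<mu> C < \<infinity>)"

definition full_support :: "'a::topological_space measure \<Rightarrow> bool" where
  "full_support m \<longleftrightarrow> (\<forall>U. open U \<and> U \<noteq> {} \<longrightarrow> emeasure m U > 0)"

definition E1 :: "'a measure \<Rightarrow> (('a \<Rightarrow> real) \<Rightarrow> ('a \<Rightarrow> real) \<Rightarrow> real)
    \<Rightarrow> ('a \<Rightarrow> real) \<Rightarrow> ('a \<Rightarrow> real) \<Rightarrow> real" where
  "E1 m \<E> f g = \<E> f g + ip m f g"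

definition coercive_closed_form :: "'a measure \<Rightarrow> (('a \<Rightarrow> real) \<Rightarrow> ('a \<Rightarrow> real) \<Rightarrow> real)
    \<Rightarrow> ('a \<Rightarrow> real) set \<Rightarrow> bool" where
  "coercive_closed_form m \<E> D \<longleftrightarrow>
     D \<subseteq> L2 m \<and>
     (\<forall>f g. f \<in> D \<and> g \<in> L2 m \<and> (AE x in m. f x = g x) \<longrightarrow> g \<in> D) \<and>
     (\<forall>f f' g. f \<in> D \<and> f' \<in> D \<and> g \<in> D \<and> (AE x in m. f x = f' x)
        \<longrightarrow> \<E> f g = \<E> f' g \<and> \<E> g f = \<E> g f') \<and>
     (\<forall>f g. f \<in> D \<and> g \<in> D \<longrightarrow> (\<lambda>x. f x + g x) \<in> D) \<and>
     (\<forall>c f. f \<in> D \<longrightarrow> (\<lambda>x. c * f x) \<in> D) \<and>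
     (\<forall>f g h. f \<in> D \<and> g \<in> D \<and> h \<in> D \<longrightarrow>
        \<E> (\<lambda>x. f x + g x) h = \<E> f h + \<E> g h \<and> \<E> h (\<lambda>x. f x + g x) = \<E> h f + \<E> h g) \<and>
     (\<forall>c f h. f \<in> D \<and> h \<in> D \<longrightarrow>
        \<E> (\<lambda>x. c * f x) h = c * \<E> f h \<and> \<E> h (\<lambda>x. c * f x) = c * \<E> h f) \<and>
     (\<forall>f \<in> L2 m. \<forall>\<epsilon>>0. \<exists>g \<in> D. ip m (\<lambda>x. f x - g x) (\<lambda>x. f x - g x) < \<epsilon>) \<and>
     (\<forall>f \<in> D. \<E> f f \<ge> 0) \<and>
     (\<exists>K. \<forall>f \<in> D. \<forall>g \<in> D. \<bar>E1 m \<E> f g\<bar> \<le> K * sqrt (E1 m \<E> f f) * sqrt (E1 m \<E> g g)) \<and>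
     (\<forall>s. (\<forall>n. s n \<in> D) \<and>
          (\<forall>\<epsilon>>0. \<exists>N. \<forall>n\<ge>N. \<forall>k\<ge>N. E1 m \<E> (\<lambda>x. s n x - s k x) (\<lambda>x. s n x - s k x) < \<epsilon>)
        \<longrightarrow> (\<exists>f \<in> D. (\<lambda>n. E1 m \<E> (\<lambda>x. s n x - f x) (\<lambda>x. s n x - f x)) \<longlonglongrightarrow> 0))"

definition semi_dirichlet :: "'a measure \<Rightarrow> (('a \<Rightarrow> real) \<Rightarrow> ('a \<Rightarrow> real) \<Rightarrow> real)
    \<Rightarrow> ('a \<Rightarrow> real) set \<Rightarrow> bool" where
  "semi_dirichlet m \<E> D \<longleftrightarrow> coercive_closed_form m \<E> D \<and>
     (\<forall>f \<in> D. (\<lambda>x. min (max (f x) 0) 1) \<in> D \<and>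
        \<E> (\<lambda>x. min (max (f x) 0) 1) (\<lambda>x. f x - min (max (f x) 0) 1) \<ge> 0)"

definition regular_semi_dirichlet :: "'a::topological_space measure \<Rightarrow> (('a \<Rightarrow> real) \<Rightarrow> ('a \<Rightarrow> real) \<Rightarrow> real)
    \<Rightarrow> ('a \<Rightarrow> real) set \<Rightarrow> bool" where
  "regular_semi_dirichlet m \<E> D \<longleftrightarrow> semi_dirichlet m \<E> D \<and>
     (\<forall>f \<in> D. \<forall>\<epsilon>>0. \<exists>g \<in> C0 \<inter> D. E1 m \<E> (\<lambda>x. f x - g x) (\<lambda>x. f x - g x) < \<epsilon>) \<and>
     (\<forall>f \<in> C0. \<forall>\<epsilon>>0. \<exists>g \<in> C0 \<inter> D. \<forall>x. \<bar>f x - g x\<bar> < \<epsilon>)"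

definition Ghat :: "'a measure \<Rightarrow> (('a \<Rightarrow> real) \<Rightarrow> ('a \<Rightarrow> real) \<Rightarrow> real)
    \<Rightarrow> ('a \<Rightarrow> real) set \<Rightarrow> real \<Rightarrow> ('a \<Rightarrow> real) \<Rightarrow> ('a \<Rightarrow> real)" where
  "Ghat m \<E> D \<beta> f = (SOME g. g \<in> D \<and> (\<forall>w \<in> D. \<E> w g + \<beta> * ip m w g = ip m f w))"

definition sigma_hat :: "'a::topological_space measure \<Rightarrow> (('a \<Rightarrow> real) \<Rightarrow> ('a \<Rightarrow> real) \<Rightarrow> real)
    \<Rightarrow> ('a \<Rightarrow> real) set \<Rightarrow> real \<Rightarrow> ('a \<times> 'a) measure" where
  "sigma_hat m \<E> D \<beta> = (THE \<sigma>. radon \<sigma> \<and>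
     (\<forall>u \<in> C0. \<forall>v \<in> C0. ip m (\<lambda>x. \<beta> * Ghat m \<E> D \<beta> u x) v = (\<integral>p. u (fst p) * v (snd p) \<partial>\<sigma>)))"

definition diag :: "('a \<times> 'a) set" where
  "diag = {p. fst p = snd p}"

text \<open>Characterisation of the jumping measure J (a positive Radon measure on
  E x E minus the diagonal, modelled as a Borel measure on E x E not charging the
  diagonal) and the killing measure K.\<close>
definition JK_char :: "'a::topological_space measure \<Rightarrow> (('a \<Rightarrow> real) \<Rightarrow> ('a \<Rightarrow> real) \<Rightarrow> real)
    \<Rightarrow> ('a \<Rightarrow> real) set \<Rightarrow> ('a \<times> 'a) measure \<Rightarrow> 'a measure \<Rightarrow> bool" where
  "JK_char m \<E> D J K \<longleftrightarrow>
     sets J = sets borel \<and> emeasure J diag = 0 \<and>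
     (\<forall>C. compact C \<and> C \<inter> diag = {} \<longrightarrow> emeasure J C < \<infinity>) \<and>
     radon K \<and>
     (\<forall>u v. u \<in> C0 \<inter> D \<and> v \<in> C0 \<inter> D \<and>
        (\<exists>U c. open U \<and> fsupp v \<subseteq> U \<and> (\<forall>x \<in> U. u x = c)) \<longrightarrow>
        \<E> u v = (\<integral>p. 2 * (u (snd p) - u (fst p)) * v (snd p) \<partial>J) + (\<integral>x. u x * v x \<partial>K))"

definition jumpK :: "'a::topological_space measure \<Rightarrow> (('a \<Rightarrow> real) \<Rightarrow> ('a \<Rightarrow> real) \<Rightarrow> real)
    \<Rightarrow> ('a \<Rightarrow> real) set \<Rightarrow> ('a \<times> 'a) measure \<times> 'a measure" where
  "jumpK m \<E> D = (THE p. JK_char m \<E> D (fst p) (snd p))"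

definition Jm where "Jm m \<E> D = fst (jumpK m \<E> D)"
definition Km where "Km m \<E> D = snd (jumpK m \<E> D)"

definition standing_assumption :: "'a::topological_space measure \<Rightarrow> (('a \<Rightarrow> real) \<Rightarrow> ('a \<Rightarrow> real) \<Rightarrow> real)
    \<Rightarrow> ('a \<Rightarrow> real) set \<Rightarrow> bool" where
  "standing_assumption m \<E> D \<longleftrightarrow>
     (\<forall>f \<in> C0 \<inter> D. \<forall>g \<in> C0 \<inter> D. (\<lambda>x. f x * g x) \<in> C0 \<inter> D \<and>
        integrable (Jm m \<E> D) (\<lambda>p. (f (snd p) - f (fst p)) * g (snd p)))"

definition Ec where
  "Ec m \<E> D u v = \<E> u v - (\<integral>p. 2 * (u (snd p) - u (fst p)) * v (snd p) \<partial>Jm m \<E> D)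
                   - (\<integral>x. u x * v x \<partial>Km m \<E> D)"

definition Lambda :: "(nat \<Rightarrow> 'a::metric_space set) \<Rightarrow> (nat \<Rightarrow> real) \<Rightarrow> nat \<Rightarrow> ('a \<times> 'a) set" where
  "Lambda \<Omega> \<zeta> l = {p. fst p \<in> \<Omega> l \<and> snd p \<in> \<Omega> l \<and> dist (fst p) (snd p) < \<zeta> l}"

definition exhaustion_ok :: "'a::metric_space measure \<Rightarrow> (('a \<Rightarrow> real) \<Rightarrow> ('a \<Rightarrow> real) \<Rightarrow> real)
    \<Rightarrow> ('a \<Rightarrow> real) set \<Rightarrow> (nat \<Rightarrow> 'a set) \<Rightarrow> (nat \<Rightarrow> real) \<Rightarrow> bool" where
  "exhaustion_ok m \<E> D \<Omega> \<zeta> \<longleftrightarrow>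
     (\<forall>l. open (\<Omega> l) \<and> compact (closure (\<Omega> l)) \<and> \<Omega> l \<subseteq> \<Omega> (Suc l)) \<and>
     (\<Union>l. \<Omega> l) = UNIV \<and>
     (\<forall>l. 0 < \<zeta> l \<and> \<zeta> (Suc l) \<le> \<zeta> l) \<and> \<zeta> \<longlonglongrightarrow> 0 \<and>
     (\<forall>l. emeasure (Jm m \<E> D)
        (frontier {p. fst p \<in> \<Omega> l \<and> snd p \<in> \<Omega> l \<and> dist (fst p) (snd p) \<ge> \<zeta> l}) = 0)"

definition Ehat_c where
  "Ehat_c m \<E> D \<Omega> \<zeta> u v = lim (\<lambda>l. Lim at_top (\<lambda>\<beta>::real. \<beta> *
      (\<integral>p. indicator (Lambda \<Omega> \<zeta> l) p * ((u (snd p) - u (fst p)) * v (snd p)) \<partial>sigma_hat m \<E> D \<beta>)))"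

text \<open>Signed Radon measure, represented as a pair of positive Radon measures
  (mu1, mu2), meaning mu1 - mu2; its integral against f.\<close>
definition sint :: "'a measure \<times> 'a measure \<Rightarrow> ('a \<Rightarrow> real) \<Rightarrow> real" where
  "sint \<mu> f = (\<integral>x. f x \<partial>fst \<mu>) - (\<integral>x. f x \<partial>snd \<mu>)"

definition mu_c where
  "mu_c m \<E> D u v = (SOME \<mu>. radon (fst \<mu>) \<and> radon (snd \<mu>) \<and>
     (\<forall>f \<in> C0 \<inter> D. sint \<mu> f = Ec m \<E> D u (\<lambda>x. v x * f x) + Ec m \<E> D v (\<lambda>x. u x * f x)
                                 - Ec m \<E> D (\<lambda>x. u x * v x) f))"

definition Lfun where
  "Lfun m \<E> D \<Omega> \<zeta> u v f = 1/2 * (Ec m \<E> D u (\<lambda>x. v x * f x) - Ehat_c m \<E> D \<Omega> \<zeta> u (\<lambda>x. v x * f x))"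

end

theory Submission
  imports Defs
begin

text \<open>Write \<open>u, v, f\<close> for functions of \<open>C\<^sub>0(E) \<inter> D(\<E>)\<close>. Since \<open>\<chi> = 1\<close> near the supports of \<open>u\<close> and \<open>v\<close>, we have
  \<open>u\<chi> = u\<close> and \<open>v\<chi> = v\<close>, and the claim reduces to the single identity
  \<open>\<E>\<^sup>c-hat(u, v) = \<E>\<^sup>c(v, u) - \<E>\<^sup>c(uv, \<chi>)\<close>, provided that all the objects exist.
  For the identity, \<open>\<beta> \<integral>(\<chi>(x)u(y) - u(x)) v(y) d\<sigma>-hat\<^sub>\<beta>\<close> tends to \<open>\<E>(v, u) - \<E>(uv, \<chi>)\<close>, because
  \<open>\<beta>((f, g) - (\<beta>G-hat\<^sub>\<beta> f, g))\<close> tends to \<open>\<E>(g, f)\<close>; the part of the integral outside \<open>\<Lambda>\<^sub>l\<close> is controlled by the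
  vague convergence, off the diagonal, of \<open>\<beta>\<sigma>-hat\<^sub>\<beta>/2\<close> to the reflected jumping measure.

  The existence of \<open>\<sigma>-hat\<^sub>\<beta>\<close>, \<open>J\<close>, \<open>K\<close> and \<open>\<mu>\<^sup>c\<close> comes from one principle: a positive linear functional on a
  sufficiently dense space of test functions is a measure. Positivity is the sub-Markov property of the resolvent
  for \<open>\<sigma>-hat\<^sub>\<beta>\<close>, then passes to the limit for \<open>J\<close>; for \<open>K\<close> it follows from the unit contraction, and
  for \<open>\<mu>\<^sup>c\<^sub>\<langle>\<^sub>w\<^sub>,\<^sub>w\<^sub>\<rangle>\<close> from the nonnegativity of \<open>(w(x) - w(y))\<^sup>2\<close>.\<close>

section \<open>Continuous functions with compact support\<close>

text \<open>The obstacle is that \<open>sigma_hat\<close>, \<open>jumpK\<close>, \<open>mu_c\<close>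
  and \<open>Ehat_c\<close> are given by \<open>THE\<close>, \<open>SOME\<close>, \<open>Lim\<close>
  and \<open>lim\<close>: nothing can be said about them before existence is proved and, for those
  given by \<open>THE\<close>, uniqueness as well. This, rather than the identity, is the bulk of
  the work. Constants need not lie in D(\<E>), so a cutoff replaces the function 1 throughout:
  \<chi> in the identity, \<kappa> in the construction of K. In the identity it turns u(x)v(x) into
  the compactly supported function u(x)v(x)\<chi>(y), and it is invisible near the diagonal, where y
  stays in the set on which \<chi> = 1. The factor 2 in front of J is that of \<beta>\<sigma>
  \<rightarrow> 2J. The limit in l is dominated convergence: the integrand is a difference of two
  functions of the form (f(y) - f(x))g(y), which the standing assumption makes J-integrable. Its
  J-integral is exactly what turns \<E>(v,u) - \<E>(uv,\<chi>) into the same expression for \<E>^c;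
  the killing integrals cancel because uv\<chi> = uv.\<close>

definition Cc :: "'b::topological_space set \<Rightarrow> ('b \<Rightarrow> real) set" where
  "Cc W = {f. continuous_on UNIV f \<and> compact (fsupp f) \<and> fsupp f \<subseteq> W}"

lemma C0_eq_Cc: "C0 = Cc UNIV"
  by (auto simp: C0_def Cc_def)

lemma not_in_fsupp: "x \<notin> fsupp f \<Longrightarrow> f x = 0"
  using closure_subset[of "{x. f x \<noteq> 0}"] by (auto simp: fsupp_def)

lemma in_fsupp: "f x \<noteq> 0 \<Longrightarrow> x \<in> fsupp f"
  using not_in_fsupp by blast

lemma closed_fsupp [simp]: "closed (fsupp f)"
  by (simp add: fsupp_def)

lemma fsupp_subset: "closed C \<Longrightarrow> (\<And>x. x \<notin> C \<Longrightarrow> f x = 0) \<Longrightarrow> fsupp f \<subseteq> C"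
  unfolding fsupp_def by (rule closure_minimal) auto

lemma fsupp_mono: "(\<And>x. g x = 0 \<Longrightarrow> f x = 0) \<Longrightarrow> fsupp f \<subseteq> fsupp g"
  by (rule fsupp_subset) (auto dest: not_in_fsupp)

lemma fsupp_disjoint_open:
  assumes "open U" "\<And>x. x \<in> U \<Longrightarrow> f x = 0"
  shows "fsupp f \<inter> U = {}"
  using fsupp_subset[of "- U" f] assms by auto

lemma CcI:
  fixes f :: "'b::t2_space \<Rightarrow> real"
  assumes "continuous_on UNIV f" "compact C" "C \<subseteq> W" "\<And>x. x \<notin> C \<Longrightarrow> f x = 0"
  shows "f \<in> Cc W"
proof -
  have "fsupp f \<subseteq> C" using assms compact_imp_closed by (intro fsupp_subset) auto
  moreover from this have "compact (fsupp f)"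
    using compact_Int_closed[OF assms(2) closed_fsupp, of f] by (simp add: Int_absorb1)
  ultimately show ?thesis using assms by (auto simp: Cc_def)
qed

lemma Cc_cont: "f \<in> Cc W \<Longrightarrow> continuous_on UNIV f"
  and Cc_compact: "f \<in> Cc W \<Longrightarrow> compact (fsupp f)"
  and Cc_subset: "f \<in> Cc W \<Longrightarrow> fsupp f \<subseteq> W"
  by (auto simp: Cc_def)

lemma Cc_mono: "f \<in> Cc W \<Longrightarrow> W \<subseteq> W' \<Longrightarrow> f \<in> Cc W'"
  by (auto simp: Cc_def)

lemma Cc_of_two:
  fixes f :: "'b::t2_space \<Rightarrow> real"
  assumes "f \<in> Cc W" "g \<in> Cc W" "continuous_on UNIV h" "\<And>x. f x = 0 \<Longrightarrow> g x = 0 \<Longrightarrow> h x = 0"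
  shows "h \<in> Cc W"
  using assms by (intro CcI[of h "fsupp f \<union> fsupp g"]) (auto simp: Cc_def dest: not_in_fsupp)

lemma Cc_of_one:
  fixes f :: "'b::t2_space \<Rightarrow> real"
  assumes "f \<in> Cc W" "continuous_on UNIV h" "\<And>x. f x = 0 \<Longrightarrow> h x = 0"
  shows "h \<in> Cc W"
  using Cc_of_two[OF assms(1,1,2)] assms(3) by blast

context
  fixes f g :: "'b::t2_space \<Rightarrow> real" and W
  assumes f: "f \<in> Cc W" and g: "g \<in> Cc W"
begin
lemma Cc_add: "(\<lambda>x. f x + g x) \<in> Cc W"
  by (rule Cc_of_two[OF f g]) (auto intro!: continuous_intros Cc_cont[OF f] Cc_cont[OF g])
lemma Cc_diff: "(\<lambda>x. f x - g x) \<in> Cc W"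
  by (rule Cc_of_two[OF f g]) (auto intro!: continuous_intros Cc_cont[OF f] Cc_cont[OF g])
lemma Cc_max: "(\<lambda>x. max (f x) (g x)) \<in> Cc W"
  by (rule Cc_of_two[OF f g]) (auto intro!: continuous_intros Cc_cont[OF f] Cc_cont[OF g])
lemma Cc_min: "(\<lambda>x. min (f x) (g x)) \<in> Cc W"
  by (rule Cc_of_two[OF f g]) (auto intro!: continuous_intros Cc_cont[OF f] Cc_cont[OF g])
end

lemma Cc_zero: "(\<lambda>x::'b::t2_space. 0) \<in> Cc W"
  by (rule CcI[of _ "{}"]) auto

lemma Cc_mult: 
  fixes f :: "'b::t2_space \<Rightarrow> real"
  assumes "f \<in> Cc W" "continuous_on UNIV g" shows "(\<lambda>x. f x * g x) \<in> Cc W"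
  by (rule Cc_of_one[OF assms(1)]) (auto intro!: continuous_intros Cc_cont[OF assms(1)] assms(2))

lemma Cc_scale: 
  fixes f :: "'b::t2_space \<Rightarrow> real"
  assumes "f \<in> Cc W" shows "(\<lambda>x. c * f x) \<in> Cc W"
  by (rule Cc_of_one[OF assms]) (auto intro!: continuous_intros Cc_cont[OF assms])

lemma Cc_sum:
  fixes f :: "'i \<Rightarrow> 'b::t2_space \<Rightarrow> real"
  shows "(\<And>i. i \<in> A \<Longrightarrow> f i \<in> Cc W) \<Longrightarrow> (\<lambda>x. \<Sum>i\<in>A. f i x) \<in> Cc W"
  by (induction A rule: infinite_finite_induct) (auto intro: Cc_zero Cc_add)

lemma Cc_bounded:
  fixes f :: "'b::t2_space \<Rightarrow> real"
  assumes "f \<in> Cc W" obtains B where "0 < B" "\<And>x. \<bar>f x\<bar> \<le> B"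
proof -
  have "compact (f ` fsupp f)"
    using assms by (intro compact_continuous_image) (auto simp: Cc_def intro: continuous_on_subset)
  then obtain B where B: "0 < B" "\<And>y. y \<in> f ` fsupp f \<Longrightarrow> norm y \<le> B"
    using compact_imp_bounded bounded_pos by metis
  have "\<bar>f x\<bar> \<le> B" for x
    using B(1) B(2)[of "f x"] not_in_fsupp[of x f] by (cases "x \<in> fsupp f") auto
  with B(1) show thesis by (rule that)
qed

section \<open>Cutoff functions, Dini's theorem and exhaustions by relatively compact open
  sets\<close>

lemma locally_compact_small_cball:
  fixes x :: "'b::metric_space"
  assumes lc: "locally_compact_space (euclidean :: 'b topology)" and "open U" "x \<in> U"
  obtains e where "0 < e" "compact (cball x e)" "cball x e \<subseteq> U"
proof -
  obtain V K where V: "open V" "compact K" "x \<in> V" "V \<subseteq> K"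
    using lc unfolding locally_compact_space_def by simp metis
  then have "open (V \<inter> U)" "x \<in> V \<inter> U" using assms by auto
  then obtain e where e: "0 < e" "cball x e \<subseteq> V \<inter> U" using open_contains_cball by blast
  have "compact (cball x e)"
    using compact_Int_closed[OF V(2) closed_cball, of x e] e V by (simp add: Int_absorb1 subset_iff)
  with e show thesis using that by auto
qed

text \<open>Compactness with prescribed bumps: it is applied to tent functions in
  \<open>Cc_cutoff\<close> and to tensor products in \<open>tensor_span_dense\<close>. The strict
  bound 1/2 defines the open sets of the cover.\<close>

lemma finite_bump_sum:
  fixes W :: "'b::metric_space set" 
  assumes "compact K" "\<And>p. p \<in> K \<Longrightarrow> b p \<in> Cc W \<and> (\<forall>x. 0 \<le> b p x) \<and> 1/2 < (b p p :: real)"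
  obtains T where "finite T" "T \<subseteq> K" "\<And>x. x \<in> K \<Longrightarrow> 1/2 < (\<Sum>p\<in>T. b p x)"
proof -
  have "open {x. 1/2 < b p x}" if "p \<in> K" for p
    using assms(2)[OF that] Cc_cont open_Collect_less[of "\<lambda>_. 1/2" "b p"] by auto
  moreover have "K \<subseteq> (\<Union>p\<in>K. {x. 1/2 < b p x})" using assms(2) by auto
  ultimately obtain T where T: "T \<subseteq> K" "finite T" "K \<subseteq> (\<Union>p\<in>T. {x. 1/2 < b p x})"
    using compactE_image[OF assms(1), of K "\<lambda>p. {x. 1/2 < b p x}"] by metis
  have "1/2 < (\<Sum>p\<in>T. b p x)" if x: "x \<in> K" for x
  proof -
    obtain p where p: "p \<in> T" "1/2 < b p x" using T(3) x by blast
    have "b p x \<le> (\<Sum>p\<in>T. b p x)" by (rule member_le_sum) (use T p assms in auto)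
    with p show ?thesis by linarith
  qed
  with T show thesis using that by blast
qed

lemma Cc_cutoff:
  fixes K :: "'b::metric_space set"
  assumes lc: "locally_compact_space (euclidean :: 'b topology)" and "compact K" "open U" "K \<subseteq> U"
  obtains c V where "c \<in> Cc U" "\<And>x. 0 \<le> c x" "\<And>x. c x \<le> 1" "open V" "K \<subseteq> V" "\<And>x. x \<in> V \<Longrightarrow> c x = 1"
proof -
  have "\<exists>e>0. compact (cball p e) \<and> cball p e \<subseteq> U" if "p \<in> K" for p
    using locally_compact_small_cball[OF lc \<open>open U\<close>, of p] that assms by blast
  then obtain e where e: "\<And>p. p \<in> K \<Longrightarrow> e p > 0 \<and> compact (cball p (e p)) \<and> cball p (e p) \<subseteq> U" by metis
  define b where "b p x = max 0 (1 - dist p x / e p)" for p x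
  have b: "b p \<in> Cc U \<and> (\<forall>x. 0 \<le> b p x) \<and> 1/2 < b p p" if "p \<in> K" for p
  proof -
    have "b p \<in> Cc U" unfolding b_def
      by (rule CcI[of _ "cball p (e p)"]) (use e[OF that] in \<open>auto intro!: continuous_intros simp: field_simps\<close>)
    then show ?thesis using e[OF that] by (auto simp: b_def)
  qed
  obtain T where T: "finite T" "T \<subseteq> K" "\<And>x. x \<in> K \<Longrightarrow> 1/2 < (\<Sum>p\<in>T. b p x)"
    using finite_bump_sum[OF assms(2) b] by blast
  define s where "s x = (\<Sum>p\<in>T. b p x)" for x
  have s: "s \<in> Cc U" unfolding s_def using T b by (intro Cc_sum) auto
  have s0: "0 \<le> s x" for x unfolding s_def using T b by (intro sum_nonneg) auto
  \<comment> \<open>Doubling before truncating at 1 makes \<open>c\<close> equal to 1 on the whole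
    open set where \<open>s\<close> exceeds 1/2, which is a neighbourhood of K.\<close>
  define c where "c x = min 1 (2 * s x)" for x
  have "c \<in> Cc U" unfolding c_def
    by (rule Cc_of_one[OF s]) (auto intro!: continuous_intros Cc_cont[OF s])
  moreover have "open {x. 1/2 < s x}" using open_Collect_less[of "\<lambda>_. 1/2" s] Cc_cont[OF s] by auto
  moreover have "K \<subseteq> {x. 1/2 < s x}" using T s_def by auto
  ultimately show thesis using s0 by (intro that[of c "{x. 1/2 < s x}"]) (auto simp: c_def)
qed

text \<open>Monotone convergence to 0 gives \<open>0 \<le> f n \<le> f 0\<close>, so everything
  happens on the compact support of \<open>f 0\<close>, which the open sets
  \<open>{x. f n x < e}\<close> cover.\<close>

lemma Dini_Cc:
  fixes f :: "nat \<Rightarrow> 'b::t2_space \<Rightarrow> real"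
  assumes f: "\<And>n. f n \<in> Cc W" and dec: "\<And>n x. f (Suc n) x \<le> f n x"
    and lim: "\<And>x. (\<lambda>n. f n x) \<longlonglongrightarrow> 0" and "0 < e"
  obtains N where "\<And>n x. n \<ge> N \<Longrightarrow> \<bar>f n x\<bar> \<le> e"
proof -
  have mono: "f n x \<le> f k x" if "k \<le> n" for n k x
    using that by (induction rule: dec_induct) (auto intro: order_trans[OF dec])
  have nonneg: "0 \<le> f n x" for n x
    using LIMSEQ_le_const2[OF lim[of x]] mono[of n _ x] by blast
  have "open {x. f n x < e}" for n
    using Cc_cont[OF f[of n]] open_Collect_less[of "f n" "\<lambda>_. e"] by auto
  moreover have "fsupp (f 0) \<subseteq> (\<Union>n\<in>UNIV. {x. f n x < e})"
  proof
    fix x show "x \<in> (\<Union>n\<in>UNIV. {x. f n x < e})"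
      using order_tendstoD(2)[OF lim[of x] \<open>0 < e\<close>] by (auto simp: eventually_sequentially)
  qed
  ultimately obtain T where T: "finite T" "fsupp (f 0) \<subseteq> (\<Union>n\<in>T. {x. f n x < e})"
    using compactE_image[OF Cc_compact[OF f[of 0]], of UNIV "\<lambda>n. {x. f n x < e}"] by metis
  have "\<bar>f n x\<bar> \<le> e" if "n \<ge> Max (insert 0 T)" for n x
  proof (cases "x \<in> fsupp (f 0)")
    case True
    then obtain k where k: "k \<in> T" "f k x < e" using T by auto
    then have "k \<le> n" using T that by (auto intro: order_trans[OF Max_ge])
    then show ?thesis using mono[of k n x] k nonneg[of n x] by auto
  next
    case False
    then show ?thesis using mono[of 0 n x] nonneg[of n x] not_in_fsupp[of x "f 0"] \<open>0 < e\<close> by auto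
  qed
  then show thesis by (rule that)
qed

lemma open_exhaustion:
  fixes W :: "'b::{metric_space, second_countable_topology} set"
  assumes lc: "locally_compact_space (euclidean :: 'b topology)" and "open W"
  obtains V :: "nat \<Rightarrow> 'b set" where "\<And>n. open (V n)" "\<And>n. compact (closure (V n))"
    "\<And>n. closure (V n) \<subseteq> W" "\<And>n. V n \<subseteq> V (Suc n)" "(\<Union>n. V n) = W"
proof -
  define F where "F = {B::'b set. open B \<and> compact (closure B) \<and> closure B \<subseteq> W}"
  have "\<Union>F = W"
  proof
    show "\<Union>F \<subseteq> W" using closure_subset by (auto simp: F_def)
    show "W \<subseteq> \<Union>F"
    proof
      fix x assume "x \<in> W"
      then obtain e where e: "0 < e" "compact (cball x e)" "cball x e \<subseteq> W"
        using locally_compact_small_cball[OF lc \<open>open W\<close>] by blast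
      have sub: "closure (ball x e) \<subseteq> cball x e" by (rule closure_minimal) auto
      have "ball x e \<in> F" unfolding F_def
        using e sub compact_Int_closed[OF e(2) closed_closure, of "ball x e"] by (auto simp: Int_absorb1)
      then show "x \<in> \<Union>F" using e by (intro UnionI[of "ball x e"]) auto
    qed
  qed
  moreover obtain F' where F': "F' \<subseteq> F" "countable F'" "\<Union>F' = \<Union>F"
    using Lindelof[of F] by (auto simp: F_def)
  \<comment> \<open>The empty set is added because W, hence \<open>F'\<close>, may be empty, while
    an enumeration by the naturals needs a nonempty family.\<close>
  ultimately have "countable (insert {} F')" "insert {} F' \<noteq> {}" "\<Union>(insert {} F') = W" by auto
  then obtain g :: "nat \<Rightarrow> 'b set" where g: "range g = insert {} F'" "(\<Union>n. g n) = W"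
    using uncountable_def by metis
  have gF: "open (g n) \<and> compact (closure (g n)) \<and> closure (g n) \<subseteq> W" for n
    using g(1) F'(1) by (metis (no_types, lifting) F_def UnionI closure_empty compact_empty empty_subsetI
      insertE mem_Collect_eq open_empty rangeI subset_iff)
  define V where "V n = (\<Union>k\<le>n. g k)" for n
  have cl: "closure (V n) = (\<Union>k\<le>n. closure (g k))" for n
    unfolding V_def by (induction n) (auto simp: atMost_Suc closure_Un)
  show thesis
  proof (rule that[of V])
    show "compact (closure (V n))" for n unfolding cl using gF by (intro compact_UN) auto
    show "closure (V n) \<subseteq> W" for n unfolding cl using gF by auto
    show "open (V n)" for n unfolding V_def using gF by auto
    show "V n \<subseteq> V (Suc n)" for n unfolding V_def by (auto intro: le_SucI)
    show "(\<Union>n. V n) = W" using g(2) by (auto simp: V_def)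
  qed
qed

lemma locally_compact_space_prod_euclidean:
  assumes "locally_compact_space (euclidean :: 'a::metric_space topology)"
  shows "locally_compact_space (euclidean :: ('a \<times> 'a) topology)"
  using assms locally_compact_space_prod_topology[of "euclidean :: 'a topology" "euclidean :: 'a topology"]
  by simp

section \<open>The Riesz representation theorem\<close>

text \<open>A Radon measure on the open set W is kept as a Borel measure of the whole space that
  does not charge the complement, as J is in \<open>JK_char\<close>. The instances are
  \<open>UNIV\<close> for \<sigma>-hat, K and the energy measures, and the complement of the
  diagonal for J.\<close>

definition radon_on :: "'b::topological_space set \<Rightarrow> 'b measure \<Rightarrow> bool" where
  "radon_on W \<nu> \<longleftrightarrow> sets \<nu> = sets borel \<and> emeasure \<nu> (- W) = 0 \<and>
     (\<forall>C. compact C \<and> C \<subseteq> W \<longrightarrow> emeasure \<nu> C < \<infinity>)"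

lemma radon_on_UNIV: "radon_on UNIV \<nu> \<longleftrightarrow> radon \<nu>"
  by (auto simp: radon_on_def radon_def)

lemma radon_on_space: "radon_on W \<nu> \<Longrightarrow> space \<nu> = UNIV"
  unfolding radon_on_def by (metis sets_eq_imp_space_eq space_borel)

lemma Cc_measurable: "sets \<nu> = sets borel \<Longrightarrow> f \<in> Cc W \<Longrightarrow> f \<in> borel_measurable \<nu>"
  using borel_measurable_continuous_onI[OF Cc_cont, of f W] measurable_cong_sets by blast

lemma Cc_integrable:
  fixes f :: "'b::t2_space \<Rightarrow> real"
  assumes \<nu>: "radon_on W \<nu>" and f: "f \<in> Cc W"
  shows "integrable \<nu> f"
proof -
  obtain B where B: "\<And>x. \<bar>f x\<bar> \<le> B" using Cc_bounded[OF f] by metis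
  show ?thesis
  proof (rule integrableI_bounded_set[where A = "fsupp f" and B = B])
    show "f \<in> borel_measurable \<nu>" using \<nu> f by (auto simp: radon_on_def intro: Cc_measurable)
    show "emeasure \<nu> (fsupp f) < \<infinity>" "fsupp f \<in> sets \<nu>"
      using \<nu> f by (auto simp: radon_on_def Cc_def)
  qed (use B not_in_fsupp in auto)
qed

text \<open>Integrate \<open>indicator {h = 1} \<le> h \<le> indicator {h > 0}\<close>. It bounds
  the integral of each layer in the layer-cake argument of
  \<open>integral_rep_nonneg\<close>.\<close>

lemma Cc_measure_sandwich:
  fixes h :: "'b::t2_space \<Rightarrow> real"
  assumes \<nu>: "radon_on W \<nu>" and h: "h \<in> Cc W" and h01: "\<And>x. 0 \<le> h x" "\<And>x. h x \<le> 1"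
  shows "measure \<nu> {x. h x = 1} \<le> (\<integral>x. h x \<partial>\<nu>)" "(\<integral>x. h x \<partial>\<nu>) \<le> measure \<nu> {x. 0 < h x}"
    "emeasure \<nu> {x. 0 < h x} < \<infinity>" "emeasure \<nu> {x. h x = 1} < \<infinity>" 
    "{x. 0 < h x} \<in> sets \<nu>" "{x. h x = 1} \<in> sets \<nu>"
proof -
  have sp: "space \<nu> = UNIV" using radon_on_space[OF \<nu>] .
  have [measurable]: "h \<in> borel_measurable \<nu>" using \<nu> h by (auto simp: radon_on_def intro: Cc_measurable)
  show s: "{x. 0 < h x} \<in> sets \<nu>" "{x. h x = 1} \<in> sets \<nu>"
    using measurable_sets[of h \<nu> borel "{0<..}"] measurable_sets[of h \<nu> borel "{1}"] sp
    by (auto simp: vimage_def)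
  have fin: "emeasure \<nu> (fsupp h) < \<infinity>" and fs: "fsupp h \<in> sets \<nu>"
    using \<nu> h by (auto simp: radon_on_def Cc_def)
  have sub: "{x. 0 < h x} \<subseteq> fsupp h" "{x. h x = 1} \<subseteq> fsupp h" using not_in_fsupp[of _ h] by fastforce+
  show f1: "emeasure \<nu> {x. 0 < h x} < \<infinity>" and f2: "emeasure \<nu> {x. h x = 1} < \<infinity>"
    using fin emeasure_mono[OF sub(1) fs] emeasure_mono[OF sub(2) fs] by (auto intro: le_less_trans)
  have "(\<integral>x. indicator {x. h x = 1} x \<partial>\<nu>) \<le> (\<integral>x. h x \<partial>\<nu>)"
    by (rule integral_mono[OF integrable_real_indicator[OF s(2) f2] Cc_integrable[OF \<nu> h]]) (use h01 in \<open>auto simp: indicator_def\<close>)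
  then show "measure \<nu> {x. h x = 1} \<le> (\<integral>x. h x \<partial>\<nu>)" using s sp by simp
  have "(\<integral>x. h x \<partial>\<nu>) \<le> (\<integral>x. indicator {x. 0 < h x} x \<partial>\<nu>)"
    by (rule integral_mono[OF Cc_integrable[OF \<nu> h] integrable_real_indicator[OF s(1) f1]])
       (use h01 in \<open>auto simp: indicator_def not_less\<close>)
  then show "(\<integral>x. h x \<partial>\<nu>) \<le> measure \<nu> {x. 0 < h x}" using s sp by simp
qed

locale positive_functional =
  fixes W :: "'b::{metric_space, second_countable_topology} set" and I :: "('b \<Rightarrow> real) \<Rightarrow> real"
  assumes lc: "locally_compact_space (euclidean :: 'b topology)" and openW: "open W"
    and I_add: "f \<in> Cc W \<Longrightarrow> g \<in> Cc W \<Longrightarrow> I (\<lambda>x. f x + g x) = I f + I g"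
    and I_scale: "f \<in> Cc W \<Longrightarrow> I (\<lambda>x. c * f x) = c * I f"
    and I_pos: "f \<in> Cc W \<Longrightarrow> (\<And>x. 0 \<le> f x) \<Longrightarrow> 0 \<le> I f"
begin

lemma I_diff: "f \<in> Cc W \<Longrightarrow> g \<in> Cc W \<Longrightarrow> I (\<lambda>x. f x - g x) = I f - I g"
  using I_add[of f "\<lambda>x. -1 * g x"] I_scale[of g "-1"] Cc_scale[of g W "-1"] by simp

lemma I_mono: "f \<in> Cc W \<Longrightarrow> g \<in> Cc W \<Longrightarrow> (\<And>x. f x \<le> g x) \<Longrightarrow> I f \<le> I g"
  using I_pos[of "\<lambda>x. g x - f x"] I_diff[of g f] Cc_diff[of g W f] by simp

lemma I_zero: "I (\<lambda>x. 0) = 0"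
  using I_scale[OF Cc_zero, of 0] by simp

lemma I_sum: "(\<And>i. i \<in> A \<Longrightarrow> f i \<in> Cc W) \<Longrightarrow> I (\<lambda>x. \<Sum>i\<in>A. f i x) = (\<Sum>i\<in>A. I (f i))"
  by (induction A rule: infinite_finite_induct) (auto simp: I_zero I_add Cc_sum)

text \<open>Daniell's continuity condition, a consequence of positivity: by Dini the convergence is
  uniform, and one cutoff \<open>s\<close> of the support of \<open>h 0\<close> gives
  \<open>h n \<le> d * s\<close>, hence \<open>I (h n) \<le> d * I s\<close>.\<close>

lemma I_continuous:
  assumes h: "\<And>n. h n \<in> Cc W" and dec: "\<And>n x. h (Suc n) x \<le> h n x" and lim: "\<And>x. (\<lambda>n. h n x) \<longlonglongrightarrow> 0"
  shows "(\<lambda>n. I (h n)) \<longlonglongrightarrow> 0"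
proof -
  have mono: "h n x \<le> h 0 x" for n x by (induction n) (auto intro: order_trans[OF dec])
  have nonneg: "0 \<le> h n x" for n x
    using LIMSEQ_le_const2[OF lim[of x]] lift_Suc_antimono_le[of "\<lambda>n. h n x", OF dec] by blast
  obtain s V where s: "s \<in> Cc W" "\<And>x. 0 \<le> s x" "fsupp (h 0) \<subseteq> V" "\<And>x. x \<in> V \<Longrightarrow> s x = 1"
    using Cc_cutoff[OF lc Cc_compact[OF h[of 0]] openW Cc_subset[OF h[of 0]]] by metis
  have Is: "0 \<le> I s" by (rule I_pos) (use s in auto)
  show ?thesis
  proof (rule LIMSEQ_I)
    fix e :: real assume e: "0 < e"
    \<comment> \<open>The summand 1 covers the case \<open>I s = 0\<close>.\<close>
    define d where "d = e / (I s + 1)"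
    have "0 < d" using e Is by (simp add: d_def)
    then obtain N where N: "\<And>n x. n \<ge> N \<Longrightarrow> \<bar>h n x\<bar> \<le> d" using Dini_Cc[OF h dec lim] by blast
    have "norm (I (h n) - 0) < e" if "n \<ge> N" for n
    proof -
      have "h n x \<le> d * s x" for x
      proof (cases "x \<in> fsupp (h 0)")
        case True then show ?thesis using N[OF that, of x] s by (auto simp: subset_iff)
      next
        case False then show ?thesis using not_in_fsupp[OF False] mono[of n x] s(2)[of x] \<open>0 < d\<close>
          by (auto intro: order_trans[of _ 0])
      qed
      then have "I (h n) \<le> d * I s" using I_mono[OF h Cc_scale[OF s(1)], of n d] I_scale[OF s(1)] by simp
      also have "d * I s < e" using e Is by (simp add: d_def field_simps)
      finally show ?thesis using I_pos[OF h nonneg] by simp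
    qed
    then show "\<exists>no. \<forall>n\<ge>no. norm (I (h n) - 0) < e" by blast
  qed
qed

text \<open>Kindler's argument: the strips between two functions of \<open>C\<^sub>c(W)\<close> form a semiring on which \<open>I (g - f)\<close>
  is countably additive by Dini's theorem; the representing measure of \<open>A\<close> is the measure of \<open>A \<times> [0,1)\<close>.\<close>
definition strip :: "('b \<Rightarrow> real) \<Rightarrow> ('b \<Rightarrow> real) \<Rightarrow> ('b \<times> real) set" where
  "strip f g = {p. f (fst p) \<le> snd p \<and> snd p < g (fst p)}"

definition admissible :: "('b \<Rightarrow> real) \<Rightarrow> ('b \<Rightarrow> real) \<Rightarrow> bool" where
  "admissible f g \<longleftrightarrow> f \<in> Cc W \<and> g \<in> Cc W \<and> (\<forall>x. f x \<le> g x)"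

lemma strip_semiring: "semiring_of_sets UNIV {strip f g | f g. admissible f g}" (is "semiring_of_sets UNIV ?R")
proof
  show "?R \<subseteq> Pow UNIV" by auto
  have "strip (\<lambda>x. 0) (\<lambda>x. 0) = {}" "admissible (\<lambda>x. 0) (\<lambda>x. 0)"
    by (auto simp: strip_def admissible_def Cc_zero)
  then show "{} \<in> ?R" by force
  fix a b assume "a \<in> ?R" "b \<in> ?R"
  then obtain f g f' g' where a: "a = strip f g" "admissible f g" and b: "b = strip f' g'" "admissible f' g'"
    by auto
  note cc = Cc_max Cc_min
  \<comment> \<open>Where the fibres do not meet, the outer \<open>max\<close> collapses the upper
    function onto the lower one, so that the pair stays admissible.\<close>
  have "a \<inter> b = strip (\<lambda>x. max (f x) (f' x)) (\<lambda>x. max (max (f x) (f' x)) (min (g x) (g' x)))"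
    unfolding a b strip_def by auto
  moreover have "admissible (\<lambda>x. max (f x) (f' x)) (\<lambda>x. max (max (f x) (f' x)) (min (g x) (g' x)))"
    using a b by (auto simp: admissible_def intro!: cc)
  ultimately show "a \<inter> b \<in> ?R" by blast
  \<comment> \<open>\<open>?c1\<close> is the part of \<open>a\<close> below \<open>b\<close> and
    \<open>?c2\<close> the part above it; the outer \<open>max\<close> and \<open>min\<close> keep
    both inside \<open>a\<close>.\<close>
  let ?c1 = "strip f (\<lambda>x. max (f x) (min (g x) (f' x)))" and ?c2 = "strip (\<lambda>x. min (g x) (max (f x) (g' x))) g"
  have "a - b = ?c1 \<union> ?c2"
    using a(2) b(2) unfolding a(1) b(1) strip_def admissible_def
    by (auto simp: not_le not_less less_max_iff_disj min_le_iff_disj intro: order_trans less_imp_le)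
  moreover have "?c1 \<inter> ?c2 = {}"
  proof -
    have "f' x \<le> g' x" "f x \<le> g x" for x using a b by (auto simp: admissible_def)
    then have "\<not> (t < max (f x) (min (g x) (f' x)) \<and> f x \<le> t \<and> min (g x) (max (f x) (g' x)) \<le> t \<and> t < g x)" for t x
      by (smt (verit))
    then show ?thesis unfolding strip_def by blast
  qed
  moreover have "?c1 \<in> ?R" "?c2 \<in> ?R"
  proof -
    have "admissible f (\<lambda>x. max (f x) (min (g x) (f' x)))" "admissible (\<lambda>x. min (g x) (max (f x) (g' x))) g"
      using a b by (auto simp: admissible_def intro!: cc)
    then show "?c1 \<in> ?R" "?c2 \<in> ?R" by blast+
  qed
  ultimately show "\<exists>C\<subseteq>?R. finite C \<and> disjoint C \<and> a - b = \<Union> C"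
    by (intro exI[of _ "{?c1, ?c2}"]) (auto simp: disjoint_def)
qed

text \<open>On each fibre a half-open interval is partitioned into half-open intervals, so Lebesgue
  measure adds up their lengths. The remainders after n strips therefore decrease to 0 pointwise,
  and \<open>I_continuous\<close> carries this over to I.\<close>

lemma strip_countably_additive:
  assumes adm: "\<And>n. admissible (A n) (B n)" "admissible f g"
    and dis: "disjoint_family (\<lambda>n. strip (A n) (B n))" and un: "(\<Union>n. strip (A n) (B n)) = strip f g"
  shows "(\<Sum>n. ennreal (I (\<lambda>x. B n x - A n x))) = ennreal (I (\<lambda>x. g x - f x))"
proof -
  have cc: "A n \<in> Cc W" "B n \<in> Cc W" "f \<in> Cc W" "g \<in> Cc W" and le: "A n x \<le> B n x" "f x \<le> g x" for n x
    using adm by (auto simp: admissible_def)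
  have pw: "(\<lambda>n. B n x - A n x) sums (g x - f x)" for x
  proof -
    have "(\<Union>n. {A n x..<B n x}) = {f x..<g x}"
      using un by (auto simp: strip_def set_eq_iff) 
    moreover have "disjoint_family (\<lambda>n. {A n x..<B n x})"
      using dis unfolding disjoint_family_on_def strip_def by (auto simp: set_eq_iff) 
    ultimately have "(\<Sum>n. emeasure lborel {A n x..<B n x}) = emeasure lborel {f x..<g x}"
      using suminf_emeasure[of "\<lambda>n. {A n x..<B n x}" lborel] by (simp add: image_subset_iff)
    then have "(\<Sum>n. ennreal (B n x - A n x)) = ennreal (g x - f x)" using le by simp
    then have "(\<lambda>n. ennreal (B n x - A n x)) sums ennreal (g x - f x)"
      using summable_sums[of "\<lambda>n. ennreal (B n x - A n x)"] by simp
    then show ?thesis using le by (simp add: sums_ennreal)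
  qed
  define h where "h n x = (g x - f x) - (\<Sum>i<n. B i x - A i x)" for n x
  have hcc: "h n \<in> Cc W" for n unfolding h_def by (intro Cc_diff Cc_sum cc)
  have "(\<lambda>n. I (h n)) \<longlonglongrightarrow> 0"
  proof (rule I_continuous[OF hcc])
    show "h (Suc n) x \<le> h n x" for n x using le by (simp add: h_def)
    show "(\<lambda>n. h n x) \<longlonglongrightarrow> 0" for x
      using tendsto_diff[OF tendsto_const[of "g x - f x"] pw[of x, unfolded sums_def]] by (simp add: h_def)
  qed
  moreover have "I (h n) = I (\<lambda>x. g x - f x) - (\<Sum>i<n. I (\<lambda>x. B i x - A i x))" for n
    unfolding h_def by (subst I_diff, intro Cc_diff cc, intro Cc_sum Cc_diff cc, subst I_sum) (auto intro: Cc_diff cc)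
  ultimately have "(\<lambda>n. I (\<lambda>x. g x - f x) - (\<Sum>i<n. I (\<lambda>x. B i x - A i x))) \<longlonglongrightarrow> 0" by simp
  then have "(\<lambda>n. I (\<lambda>x. B n x - A n x)) sums I (\<lambda>x. g x - f x)"
    unfolding sums_def using tendsto_diff[OF tendsto_const[of "I (\<lambda>x. g x - f x)"]] by fastforce
  then have "(\<lambda>n. ennreal (I (\<lambda>x. B n x - A n x))) sums ennreal (I (\<lambda>x. g x - f x))"
    using le by (subst sums_ennreal) (auto intro!: I_pos Cc_diff cc)
  then show ?thesis by (simp add: sums_iff)
qed

definition strip_measure :: "('b \<times> real) measure" where
  "strip_measure = extend_measure UNIV {(f, g). admissible f g} (\<lambda>(f, g). strip f g)
     (\<lambda>(f, g). ennreal (I (\<lambda>x. g x - f x)))"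

lemma strip_sets: "admissible f g \<Longrightarrow> strip f g \<in> sets strip_measure"
  unfolding strip_measure_def by (subst sets_extend_measure) (auto intro!: sigma_sets.Basic image_eqI[where x="(f,g)"])

lemma space_strip_measure: "space strip_measure = UNIV"
  unfolding strip_measure_def by (subst space_extend_measure) auto

lemma emeasure_strip:
  assumes "admissible f g"
  shows "emeasure strip_measure (strip f g) = ennreal (I (\<lambda>x. g x - f x))"
proof (rule extend_measure_caratheodory_pair[OF strip_measure_def assms strip_semiring])
  \<comment> \<open>Different pairs may give the same strip, since a common value of both functions
    leaves no trace. The set still determines the length of every fibre, hence the difference of the
    two functions.\<close>
  fix a b c d assume ab: "admissible a b" and cd: "admissible c d" and eq: "strip a b = strip c d"
  have "b x - a x = d x - c x" for x
  proof -
    have "{a x..<b x} = {c x..<d x}" using eq by (auto simp: strip_def set_eq_iff) 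
    then have "emeasure lborel {a x..<b x} = emeasure lborel {c x..<d x}" by simp
    then show ?thesis using ab cd by (simp add: admissible_def)
  qed
  then show "ennreal (I (\<lambda>x. b x - a x)) = ennreal (I (\<lambda>x. d x - c x))" by simp
next
  fix a b assume ab: "admissible a b" "strip a b = {}"
  have "b x - a x = 0" for x
  proof -
    have "(x, a x) \<notin> strip a b" using ab by simp
    then show ?thesis using ab unfolding strip_def admissible_def by (simp add: antisym not_less)
  qed
  then show "ennreal (I (\<lambda>x. b x - a x)) = 0" using I_zero by simp
qed (use strip_countably_additive in auto)

text \<open>Strips below cutoffs that are 1 on larger and larger sets exhaust the cylinder. This is
  what makes the projection to the base measurable.\<close>

lemma open_strip_sets:
  assumes "open U" "U \<subseteq> W" shows "U \<times> {0..<1} \<in> sets strip_measure"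
proof -
  obtain V :: "nat \<Rightarrow> 'b set" where V: "\<And>n. compact (closure (V n))" "\<And>n. closure (V n) \<subseteq> U" "(\<Union>n. V n) = U"
    using open_exhaustion[OF lc assms(1)] by metis
  have "\<exists>c. c \<in> Cc U \<and> (\<forall>x. 0 \<le> c x \<and> c x \<le> 1) \<and> (\<forall>x\<in>V n. c x = 1)" for n
    using Cc_cutoff[OF lc V(1)[of n] assms(1) V(2)[of n]] closure_subset[of "V n"] by (metis subset_iff)
  then obtain c where c: "\<And>n. c n \<in> Cc U" "\<And>n x. 0 \<le> c n x \<and> c n x \<le> 1" "\<And>n x. x \<in> V n \<Longrightarrow> c n x = 1"
    by metis
  have "strip (\<lambda>x. 0) (c n) \<in> sets strip_measure" for n
    using c Cc_mono[OF c(1) assms(2)] by (intro strip_sets) (auto simp: admissible_def Cc_zero)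
  then have "(\<Union>n. strip (\<lambda>x. 0) (c n)) \<in> sets strip_measure" by auto
  also have "(\<Union>n. strip (\<lambda>x. 0) (c n)) = U \<times> {0..<1}"
  proof (intro equalityI subsetI)
    fix p assume "p \<in> (\<Union>n. strip (\<lambda>x. 0) (c n))"
    then obtain n where n: "0 \<le> snd p" "snd p < c n (fst p)" by (auto simp: strip_def)
    then have "fst p \<in> U" using not_in_fsupp[of "fst p" "c n"] Cc_subset[OF c(1)[of n]] by fastforce
    with n c(2)[of n "fst p"] show "p \<in> U \<times> {0..<1}" by (cases p) auto
  next
    fix p assume "p \<in> U \<times> {0..<1::real}"
    moreover then obtain n where "fst p \<in> V n" using V by auto
    ultimately show "p \<in> (\<Union>n. strip (\<lambda>x. 0) (c n))" using c(3)[of "fst p" n] 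
      by (auto simp: strip_def intro!: exI[of _ n])
  qed
  finally show ?thesis .
qed

definition rep :: "'b measure" where
  "rep = distr (restrict_space strip_measure (W \<times> {0..<1})) borel fst"

lemma fst_measurable: "fst \<in> measurable (restrict_space strip_measure (W \<times> {0..<1})) borel"
proof (rule borel_measurableI)
  fix U :: "'b set" assume "open U"
  have sp: "space (restrict_space strip_measure (W \<times> {0..<1::real})) = W \<times> {0..<1}"
    by (simp add: space_restrict_space space_strip_measure)
  have "fst -` U \<inter> (W \<times> {0..<1}) = (U \<inter> W) \<times> {0..<1::real}" by auto
  then show "fst -` U \<inter> space (restrict_space strip_measure (W \<times> {0..<1})) \<in> sets (restrict_space strip_measure (W \<times> {0..<1}))"
    unfolding sp using open_strip_sets[of "U \<inter> W"] open_strip_sets[of W] \<open>open U\<close> openW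
    by (subst sets_restrict_space_iff) (auto simp: space_strip_measure)
qed

lemma rep_sets: "A \<in> sets borel \<Longrightarrow> (A \<inter> W) \<times> {0..<1} \<in> sets strip_measure"
  and emeasure_rep: "A \<in> sets borel \<Longrightarrow> emeasure rep A = emeasure strip_measure ((A \<inter> W) \<times> {0..<1})"
proof -
  assume A: "A \<in> sets borel"
  have sp: "space (restrict_space strip_measure (W \<times> {0..<1::real})) = W \<times> {0..<1}"
    by (simp add: space_restrict_space space_strip_measure)
  have eq: "fst -` A \<inter> (W \<times> {0..<1}) = (A \<inter> W) \<times> {0..<1::real}" by auto
  have m: "W \<times> {0..<1} \<inter> space strip_measure \<in> sets strip_measure"
    using open_strip_sets[of W] openW by (simp add: space_strip_measure)
  show "(A \<inter> W) \<times> {0..<1} \<in> sets strip_measure"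
    using measurable_sets[OF fst_measurable A] m unfolding sp eq by (subst (asm) sets_restrict_space_iff) auto
  show "emeasure rep A = emeasure strip_measure ((A \<inter> W) \<times> {0..<1})"
    unfolding rep_def using A m by (subst emeasure_distr[OF fst_measurable A], unfold sp eq, subst emeasure_restrict_space) auto
qed

text \<open>Together with \<open>rep_le\<close> this links \<open>rep\<close> to I: the cylinder of
  height 1 over a set where h is at least 1 lies in the strip below h, and for
  \<open>h \<le> 1\<close> that strip lies in the cylinder over the set where h is positive.\<close>

lemma rep_ge:
  assumes h: "h \<in> Cc W" "\<And>x. 0 \<le> h x" and A: "A \<in> sets borel" "A \<subseteq> W" "\<And>x. x \<in> A \<Longrightarrow> 1 \<le> h x"
  shows "emeasure rep A \<le> ennreal (I h)"
proof -
  have adm: "admissible (\<lambda>x. 0) h" using h by (auto simp: admissible_def Cc_zero)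
  have "(A \<inter> W) \<times> {0..<1} \<subseteq> strip (\<lambda>x. 0) h" using A by (auto simp: strip_def intro: less_le_trans)
  then have "emeasure strip_measure ((A \<inter> W) \<times> {0..<1}) \<le> emeasure strip_measure (strip (\<lambda>x. 0) h)"
    by (rule emeasure_mono) (rule strip_sets[OF adm])
  then show ?thesis using emeasure_rep[OF A(1)] emeasure_strip[OF adm] by simp
qed

lemma rep_le:
  assumes h: "h \<in> Cc W" "\<And>x. 0 \<le> h x" "\<And>x. h x \<le> 1"
  shows "ennreal (I h) \<le> emeasure rep {x. 0 < h x}"
proof -
  have adm: "admissible (\<lambda>x. 0) h" using h by (auto simp: admissible_def Cc_zero)
  have o: "open {x. 0 < h x}" using open_Collect_less[of "\<lambda>_. 0" h] Cc_cont[OF h(1)] by auto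
  have "{x. 0 < h x} \<subseteq> W" using Cc_subset[OF h(1)] not_in_fsupp[of _ h] by fastforce
  moreover have "strip (\<lambda>x. 0) h \<subseteq> {x. 0 < h x} \<times> {0..<1}" using less_le_trans[OF _ h(3)] by (auto simp: strip_def intro: le_less_trans)
  ultimately have "strip (\<lambda>x. 0) h \<subseteq> ({x. 0 < h x} \<inter> W) \<times> {0..<1}" by (auto simp: strip_def)
  then have "emeasure strip_measure (strip (\<lambda>x. 0) h) \<le> emeasure strip_measure (({x. 0 < h x} \<inter> W) \<times> {0..<1})"
    by (rule emeasure_mono) (rule rep_sets, use o in auto)
  then show ?thesis using emeasure_rep[of "{x. 0 < h x}"] emeasure_strip[OF adm] o by simp
qed

lemma radon_on_rep: "radon_on W rep"
  unfolding radon_on_def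
proof (intro conjI allI impI)
  show "sets rep = sets borel" by (simp add: rep_def)
  show "emeasure rep (- W) = 0" using emeasure_rep[of "- W"] openW by simp
  fix C assume C: "compact C \<and> C \<subseteq> W"
  then obtain c V where "c \<in> Cc W" "\<And>x. 0 \<le> c x" "C \<subseteq> V" "\<And>x. x \<in> V \<Longrightarrow> c x = 1"
    using Cc_cutoff[OF lc _ openW, of C] by metis
  then have "emeasure rep C \<le> ennreal (I c)" using C
    by (intro rep_ge) (auto intro: borel_compact simp: subset_iff)
  then show "emeasure rep C < \<infinity>" by (auto intro: le_less_trans)
qed

text \<open>Cut \<open>n * f\<close> into layers \<open>h k\<close> of height 1. Both
  \<open>I (h k)\<close> and the integral of \<open>h k\<close> lie between the measures
  \<open>a (Suc k)\<close> and \<open>a k\<close> of consecutive level sets, so the sum of the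
  differences telescopes to at most the measure of the support. Dividing by n and letting n grow
  gives equality.\<close>

lemma integral_rep_nonneg:
  assumes f: "f \<in> Cc W" and f0: "\<And>x. 0 \<le> f x"
  shows "(\<integral>x. f x \<partial>rep) = I f"
proof -
  obtain B where B: "\<And>x. \<bar>f x\<bar> \<le> B" using Cc_bounded[OF f] by metis
  have approx: "\<bar>I f - (\<integral>x. f x \<partial>rep)\<bar> \<le> measure rep (fsupp f) / n" if "n \<ge> 1" for n :: nat
  proof -
    \<comment> \<open>Beyond height \<open>B * n\<close> all layers vanish, so N layers recover
      \<open>n * f\<close> exactly.\<close>
    obtain N where N: "B * n \<le> real N" using real_arch_simple by blast
    define h where "h k x = min 1 (max 0 (n * f x - real k))" for k x
    have hC: "h k \<in> Cc W" for k unfolding h_def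
      by (rule Cc_of_one[OF f]) (auto intro!: continuous_intros Cc_cont[OF f])
    have h01: "0 \<le> h k x" "h k x \<le> 1" for k x by (auto simp: h_def)
    have part: "(\<Sum>k<K. h k x) = min (real K) (n * f x)" for K x
    proof (induction K)
      case 0 then show ?case using f0[of x] by simp
    next
      case (Suc K) then show ?case using f0[of x] by (auto simp: h_def min_def max_def)
    qed
    have "n * f x \<le> real N" for x
      using B[of x] N f0[of x] mult_right_mono[of "f x" B "real n"] by (simp add: mult.commute)
    then have eq: "(\<Sum>k<N. h k x) = n * f x" for x using part[of x N] by auto
    define a where "a k = measure rep {x. real k < n * f x}" for k
    have pos_set: "{x. 0 < h k x} = {x. real k < n * f x}" for k by (auto simp: h_def)
    note sw = Cc_measure_sandwich[OF radon_on_rep hC h01]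
    have a_le: "a (Suc k) \<le> measure rep {x. h k x = 1}" for k
    proof -
      have "{x. real (Suc k) < n * f x} \<subseteq> {x. h k x = 1}" by (auto simp: h_def)
      then show ?thesis unfolding a_def using sw(4,6)[of k] sw(5)[of "Suc k"] pos_set[of "Suc k"]
        by (intro measure_mono_fmeasurable) (auto simp: fmeasurable_def)
    qed
    have Ih: "a (Suc k) \<le> I (h k)" "I (h k) \<le> a k" for k
    proof -
      have "{x. h k x = 1} \<subseteq> W" using Cc_subset[OF hC[of k]] not_in_fsupp[of _ "h k"] by fastforce
      moreover have "{x. h k x = 1} \<in> sets borel" using sw(6)[of k] radon_on_rep by (simp add: radon_on_def)
      ultimately have "emeasure rep {x. h k x = 1} \<le> ennreal (I (h k))" by (intro rep_ge hC h01) auto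
      then have "measure rep {x. h k x = 1} \<le> I (h k)"
        using I_pos[OF hC h01(1)] by (simp add: measure_def enn2real_leI)
      then show "a (Suc k) \<le> I (h k)" using a_le[of k] by linarith
      have "ennreal (I (h k)) \<le> ennreal (measure rep {x. 0 < h k x})"
        using rep_le[OF hC h01, of k] sw(3)[of k] by (simp add: emeasure_eq_ennreal_measure)
      then show "I (h k) \<le> a k" by (simp add: a_def pos_set)
    qed
    have int: "a (Suc k) \<le> (\<integral>x. h k x \<partial>rep)" "(\<integral>x. h k x \<partial>rep) \<le> a k" for k
      using sw(1,2)[of k] a_le[of k] by (auto simp: a_def pos_set)
    have "n * (I f - (\<integral>x. f x \<partial>rep)) = I (\<lambda>x. n * f x) - (\<integral>x. n * f x \<partial>rep)"
      using I_scale[OF f] by (simp add: algebra_simps)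
    also have "\<dots> = I (\<lambda>x. \<Sum>k<N. h k x) - (\<integral>x. (\<Sum>k<N. h k x) \<partial>rep)" by (simp add: eq)
    also have "\<dots> = (\<Sum>k<N. I (h k) - (\<integral>x. h k x \<partial>rep))"
      using I_sum[of "{..<N}" h] Cc_integrable[OF radon_on_rep hC]
      by (simp add: hC sum_subtractf Bochner_Integration.integral_sum)
    finally have "\<bar>n * (I f - (\<integral>x. f x \<partial>rep))\<bar> \<le> (\<Sum>k<N. \<bar>I (h k) - (\<integral>x. h k x \<partial>rep)\<bar>)"
      by (simp add: sum_abs)
    also have "\<dots> \<le> (\<Sum>k<N. a k - a (Suc k))"
    proof (rule sum_mono)
      fix k show "\<bar>I (h k) - (\<integral>x. h k x \<partial>rep)\<bar> \<le> a k - a (Suc k)" using Ih[of k] int[of k] by linarith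
    qed
    also have "\<dots> = a 0 - a N" by (rule sum_lessThan_telescope')
    also have "\<dots> \<le> a 0" by (simp add: a_def)
    also have "a 0 \<le> measure rep (fsupp f)" unfolding a_def
    proof (rule measure_mono_fmeasurable)
      show "{x. real 0 < n * f x} \<subseteq> fsupp f" using not_in_fsupp[of _ f] by fastforce
      show "{x. real 0 < n * f x} \<in> sets rep" using sw(5)[of 0] pos_set[of 0] by simp
      show "fsupp f \<in> fmeasurable rep" using radon_on_rep f by (auto simp: fmeasurable_def radon_on_def Cc_def)
    qed
    finally have "real n * \<bar>I f - (\<integral>x. f x \<partial>rep)\<bar> \<le> measure rep (fsupp f)" by (simp only: abs_mult abs_of_nat)
    then show ?thesis using that by (simp add: field_simps)
  qed
  have "(\<lambda>n. measure rep (fsupp f) / real n) \<longlonglongrightarrow> 0" by (rule lim_const_over_n)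
  then have "\<bar>I f - (\<integral>x. f x \<partial>rep)\<bar> \<le> 0"
    by (rule LIMSEQ_le_const) (use approx in auto)
  then show ?thesis by simp
qed

theorem integral_rep:
  assumes f: "f \<in> Cc W" shows "(\<integral>x. f x \<partial>rep) = I f"
proof -
  define p q where "p x = max 0 (f x)" and "q x = max 0 (- f x)" for x
  have pq: "p \<in> Cc W" "q \<in> Cc W" unfolding p_def q_def
    by (rule Cc_of_one[OF f]; auto intro!: continuous_intros Cc_cont[OF f])+
  have p_nonneg: "0 \<le> p x" and q_nonneg: "0 \<le> q x" for x by (auto simp: p_def q_def)
  have "f = (\<lambda>x. p x - q x)" by (auto simp: p_def q_def)
  moreover have "(\<integral>x. p x - q x \<partial>rep) = I (\<lambda>x. p x - q x)"
    by (subst Bochner_Integration.integral_diff[OF Cc_integrable[OF radon_on_rep pq(1)] Cc_integrable[OF radon_on_rep pq(2)]])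
       (use integral_rep_nonneg[OF pq(1)] integral_rep_nonneg[OF pq(2)] I_diff[OF pq] in \<open>simp add: p_nonneg q_nonneg\<close>)
  ultimately show ?thesis by simp
qed

end

section \<open>Functionals on dense spaces and vague limits\<close>

text \<open>The error is measured against a single function of the space, so that it is controlled by any positive
  linear functional defined there.\<close>
definition dense_in_Cc :: "'b::topological_space set \<Rightarrow> ('b \<Rightarrow> real) set \<Rightarrow> bool" where
  "dense_in_Cc W D \<longleftrightarrow> D \<subseteq> Cc W \<and>
     (\<forall>f\<in>Cc W. \<exists>s\<in>D. (\<forall>x. 0 \<le> s x) \<and> (\<forall>e>0. \<exists>g\<in>D. \<forall>x. \<bar>f x - g x\<bar> \<le> e * s x))"

lemma dense_in_CcE:
  assumes "dense_in_Cc W D" "f \<in> Cc W"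
  obtains s where "s \<in> D" "\<And>x. 0 \<le> s x" "\<And>e. 0 < e \<Longrightarrow> \<exists>g\<in>D. \<forall>x. \<bar>f x - g x\<bar> \<le> e * s x"
  using assms unfolding dense_in_Cc_def by meson

lemma le_mult_all_pos_imp_eq:
  fixes a b C :: real
  assumes "\<And>e. 0 < e \<Longrightarrow> \<bar>a - b\<bar> \<le> e * C"
  shows "a = b"
proof (rule ccontr)
  assume "a \<noteq> b"
  moreover have "C > 0" using assms[of 1] \<open>a \<noteq> b\<close> by auto
  ultimately show False using assms[of "\<bar>a - b\<bar> / (2 * C)"] by auto
qed

lemma integral_error:
  fixes f g s :: "'b::t2_space \<Rightarrow> real"
  assumes "radon_on W \<nu>" "f \<in> Cc W" "g \<in> Cc W" "s \<in> Cc W" "\<And>x. \<bar>f x - g x\<bar> \<le> e * s x"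
  shows "\<bar>(\<integral>x. f x \<partial>\<nu>) - (\<integral>x. g x \<partial>\<nu>)\<bar> \<le> e * (\<integral>x. s x \<partial>\<nu>)"
proof -
  note int = assms(2-4)[THEN Cc_integrable[OF assms(1)]]
  have "\<bar>(\<integral>x. f x \<partial>\<nu>) - (\<integral>x. g x \<partial>\<nu>)\<bar> = \<bar>\<integral>x. f x - g x \<partial>\<nu>\<bar>" using int by simp
  also have "\<dots> \<le> (\<integral>x. \<bar>f x - g x\<bar> \<partial>\<nu>)" by (rule integral_abs_bound)
  also have "\<dots> \<le> (\<integral>x. e * s x \<partial>\<nu>)" by (rule integral_mono) (use int assms(5) in auto)
  finally show ?thesis by simp
qed

text \<open>\<open>S\<close> is the graph of a functional not yet known to be single-valued; that,
  too, is forced by positivity, applied to differences. The form with pairs lets functionals be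
  given on spans, or by auxiliary choices, without a prior proof of well-definedness.\<close>

theorem dense_functional_representation:
  fixes W :: "'b::{metric_space, second_countable_topology} set" and S :: "(('b \<Rightarrow> real) \<times> real) set"
  assumes lc: "locally_compact_space (euclidean :: 'b topology)" and "open W"
    and add: "\<And>f c g d. (f, c) \<in> S \<Longrightarrow> (g, d) \<in> S \<Longrightarrow> (\<lambda>x. f x + g x, c + d) \<in> S"
    and scale: "\<And>f c r. (f, c) \<in> S \<Longrightarrow> (\<lambda>x. r * f x, r * c) \<in> S"
    and pos: "\<And>f c. (f, c) \<in> S \<Longrightarrow> (\<And>x. 0 \<le> f x) \<Longrightarrow> 0 \<le> c"
    and dense: "dense_in_Cc W (fst ` S)"
  obtains \<nu> where "radon_on W \<nu>" "\<And>f c. (f, c) \<in> S \<Longrightarrow> (\<integral>x. f x \<partial>\<nu>) = c"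
proof -
  have SC: "f \<in> Cc W" if "(f, c) \<in> S" for f c 
    using imageI[OF that, of fst] dense by (auto simp: dense_in_Cc_def simp del: image_iff)
  have mono: "c \<le> d" if "(f, c) \<in> S" "(g, d) \<in> S" "\<And>x. f x \<le> g x" for f c g d
    using pos[OF add[OF that(2) scale[OF that(1), of "-1"]]] that(3) by simp
  have approx: "\<exists>s d. (s, d) \<in> S \<and> (\<forall>x. 0 \<le> s x) \<and> 0 \<le> d \<and> (\<forall>e>0. \<exists>g c. (g, c) \<in> S \<and> (\<forall>x. \<bar>f x - g x\<bar> \<le> e * s x))"
    if f: "f \<in> Cc W" for f
  proof -
    obtain s where s: "s \<in> fst ` S" "\<And>x. 0 \<le> s x" "\<And>e. 0 < e \<Longrightarrow> \<exists>g\<in>fst ` S. \<forall>x. \<bar>f x - g x\<bar> \<le> e * s x"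
      by (rule dense_in_CcE[OF dense f]) (rule that)
    from s(1) obtain d where d: "(s, d) \<in> S" by auto
    have "\<exists>g c. (g, c) \<in> S \<and> (\<forall>x. \<bar>f x - g x\<bar> \<le> e * s x)" if e: "0 < e" for e

    proof -
      obtain g where "g \<in> fst ` S" "\<forall>x. \<bar>f x - g x\<bar> \<le> e * s x" using s(3)[OF e] by (elim bexE)
      then show ?thesis by auto
    qed
    moreover have "0 \<le> d" using pos[OF d] s(2) by simp
    ultimately show ?thesis using d s(2) by (intro exI[of _ s] exI[of _ d]) simp
  qed
  \<comment> \<open>Extension from below. If g is within \<open>e * s\<close> of f, then
    \<open>g - e * s\<close> and \<open>g + e * s\<close> bracket f, which is the estimate
    \<open>key\<close>; additivity, homogeneity and positivity all follow from it.\<close>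
  define I where "I f = Sup {c. \<exists>g. (g, c) \<in> S \<and> (\<forall>x. g x \<le> f x)}" for f
  have key: "\<bar>I f - c\<bar> \<le> e * d" if "(g, c) \<in> S" "(s, d) \<in> S" "\<And>x. \<bar>f x - g x\<bar> \<le> e * s x" for f g c s d e
  proof -
    let ?X = "{c. \<exists>g. (g, c) \<in> S \<and> (\<forall>x. g x \<le> f x)}"
    have lower: "(\<lambda>x. g x + (- e) * s x, c + (- e) * d) \<in> S" and upper: "(\<lambda>x. g x + e * s x, c + e * d) \<in> S"
      using add[OF that(1) scale[OF that(2)]] by blast+
    have lo: "c + (- e) * d \<in> ?X" using lower that(3) by (auto simp: abs_le_iff algebra_simps intro!: exI)
    have up: "x \<le> c + e * d" if x: "x \<in> ?X" for x
    proof -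
      obtain h where h: "(h, x) \<in> S" "\<And>y. h y \<le> f y" using x by auto
      have "h y \<le> g y + e * s y" for y
        using h(2)[of y] \<open>\<And>x. \<bar>f x - g x\<bar> \<le> e * s x\<close>[of y] by (auto simp: abs_le_iff)
      then show ?thesis by (rule mono[OF h(1) upper])
    qed
    have "c + (- e) * d \<le> I f" unfolding I_def by (rule cSup_upper[OF lo]) (use up in \<open>auto simp: bdd_above_def\<close>)
    moreover have "I f \<le> c + e * d" unfolding I_def by (rule cSup_least) (use lo up in blast)+
    ultimately show ?thesis by (auto simp: abs_le_iff)
  qed
  have IS: "I f = c" if "(f, c) \<in> S" for f c
    using key[OF that that, of f 0] by simp
  interpret positive_functional W I
  proof
    fix f g assume f: "f \<in> Cc W" and g: "g \<in> Cc W"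
    obtain s d s' d' where s: "(s, d) \<in> S" "\<forall>e>0. \<exists>g c. (g, c) \<in> S \<and> (\<forall>x. \<bar>f x - g x\<bar> \<le> e * s x)"
      and s': "(s', d') \<in> S" "\<forall>e>0. \<exists>h c. (h, c) \<in> S \<and> (\<forall>x. \<bar>g x - h x\<bar> \<le> e * s' x)"
      using approx[OF f] approx[OF g] by metis
    show "I (\<lambda>x. f x + g x) = I f + I g"
    proof (rule le_mult_all_pos_imp_eq)
      fix e :: real assume "0 < e"
      then obtain a c b c' where a: "(a, c) \<in> S" "\<And>x. \<bar>f x - a x\<bar> \<le> e * s x"
        and b: "(b, c') \<in> S" "\<And>x. \<bar>g x - b x\<bar> \<le> e * s' x"
        using s(2) s'(2) by metis
      have "\<bar>I (\<lambda>x. f x + g x) - (c + c')\<bar> \<le> e * (d + d')"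
      proof (rule key[OF add[OF a(1) b(1)] add[OF s(1) s'(1)]])
        show "\<bar>(f x + g x) - (a x + b x)\<bar> \<le> e * (s x + s' x)" for x
          using a(2)[of x] b(2)[of x] by (simp add: distrib_left abs_le_iff)
      qed
      then show "\<bar>I (\<lambda>x. f x + g x) - (I f + I g)\<bar> \<le> e * (2 * (d + d'))"
        using key[OF a(1) s(1) a(2)] key[OF b(1) s'(1) b(2)] by (simp add: algebra_simps abs_le_iff)
    qed
  next
    fix f c assume f: "f \<in> Cc W"
    obtain s d where s: "(s, d) \<in> S" "\<forall>e>0. \<exists>g c. (g, c) \<in> S \<and> (\<forall>x. \<bar>f x - g x\<bar> \<le> e * s x)"
      using approx[OF f] by metis
    show "I (\<lambda>x. c * f x) = c * I f"
    proof (rule le_mult_all_pos_imp_eq)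
      fix e :: real assume "0 < e"
      then obtain a r where a: "(a, r) \<in> S" "\<And>x. \<bar>f x - a x\<bar> \<le> e * s x" using s(2) by metis
      have "\<bar>c * f x - c * a x\<bar> \<le> (\<bar>c\<bar> * e) * s x" for x
      proof -
        have "\<bar>c * f x - c * a x\<bar> = \<bar>c\<bar> * \<bar>f x - a x\<bar>" by (simp add: abs_mult flip: right_diff_distrib)
        then show ?thesis using mult_left_mono[OF a(2)[of x], of "\<bar>c\<bar>"] by (simp add: mult.assoc)
      qed
      then have 1: "\<bar>I (\<lambda>x. c * f x) - c * r\<bar> \<le> (\<bar>c\<bar> * e) * d" by (rule key[OF scale[OF a(1)] s(1)])
      have "\<bar>c * r - c * I f\<bar> = \<bar>c\<bar> * \<bar>I f - r\<bar>" by (simp add: abs_mult abs_minus_commute flip: right_diff_distrib)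
      also have "\<dots> \<le> \<bar>c\<bar> * (e * d)" by (intro mult_left_mono key[OF a(1) s(1) a(2)]) auto
      finally show "\<bar>I (\<lambda>x. c * f x) - c * I f\<bar> \<le> e * (2 * \<bar>c\<bar> * d)" using 1 by (simp add: algebra_simps)
    qed
  next
    fix f assume f: "f \<in> Cc W" and f0: "\<And>x. 0 \<le> f x"
    obtain s d where s: "(s, d) \<in> S" "\<forall>e>0. \<exists>g c. (g, c) \<in> S \<and> (\<forall>x. \<bar>f x - g x\<bar> \<le> e * s x)" "0 \<le> d"
      using approx[OF f] by metis
    show "0 \<le> I f"
    proof (rule ccontr)
      assume neg: "\<not> 0 \<le> I f"
      \<comment> \<open>Chosen so that \<open>2 * e * d < - I f\<close>: an approximant with value r
        satisfies \<open>r \<le> I f + e * d\<close> and \<open>0 \<le> r + e * d\<close>, a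
        contradiction.\<close>
      define e where "e = - I f / (4 * (d + 1))"
      have e: "0 < e" "2 * e * d < - I f" 
      proof -
        show "0 < e" using neg s(3) by (simp add: e_def divide_neg_pos)
        have "2 * e * d = (- I f) * (d / (2 * (d + 1)))" using s(3) by (simp add: e_def field_simps)
        also have "\<dots> < (- I f) * 1" using neg s(3) by (intro mult_strict_left_mono) (auto simp: field_simps)
        finally show "2 * e * d < - I f" by simp
      qed
      obtain a r where a: "(a, r) \<in> S" "\<And>x. \<bar>f x - a x\<bar> \<le> e * s x" using s(2) e(1) by metis
      have "0 \<le> r + e * d"
        by (rule pos[OF add[OF a(1) scale[OF s(1), of e]]]) (use order_trans[OF f0 abs_ge_self] a(2) f0 in \<open>auto simp: abs_le_iff algebra_simps intro: order_trans[OF f0]\<close>)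
      then show False using key[OF a(1) s(1) a(2)] e(2) by (auto simp: abs_le_iff)
    qed
  qed (use lc \<open>open W\<close> in auto)
  show thesis using that[OF radon_on_rep] integral_rep IS SC by metis
qed

text \<open>Equality of integrals extends to \<open>Cc W\<close> by density, then to relatively
  compact open sets by cutoffs increasing to their indicators, then to Borel sets by uniqueness on
  an intersection-stable generator.\<close>

lemma radon_on_eq_if_dense:
  fixes W :: "'b::{metric_space, second_countable_topology} set"
  assumes lc: "locally_compact_space (euclidean :: 'b topology)" and W: "open W"
    and M: "radon_on W M" and N: "radon_on W N" and D: "dense_in_Cc W D"
    and eq: "\<And>f. f \<in> D \<Longrightarrow> (\<integral>x. f x \<partial>M) = (\<integral>x. f x \<partial>N)"
  shows "M = N"
proof -
  have eqC: "(\<integral>x. f x \<partial>M) = (\<integral>x. f x \<partial>N)" if f: "f \<in> Cc W" for f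
  proof -
    obtain s where s: "s \<in> D" "\<forall>e>0. \<exists>g\<in>D. \<forall>x. \<bar>f x - g x\<bar> \<le> e * s x"
      using D f unfolding dense_in_Cc_def by blast
    have DC: "D \<subseteq> Cc W" using D by (simp add: dense_in_Cc_def)
    show ?thesis
    proof (rule le_mult_all_pos_imp_eq)
      fix e :: real assume "0 < e"
      then obtain g where g: "g \<in> D" "\<And>x. \<bar>f x - g x\<bar> \<le> e * s x" using s(2) by blast
      have gs: "g \<in> Cc W" "s \<in> Cc W" using g s DC by auto
      show "\<bar>(\<integral>x. f x \<partial>M) - (\<integral>x. f x \<partial>N)\<bar> \<le> e * ((\<integral>x. s x \<partial>M) + (\<integral>x. s x \<partial>N))"
        using integral_error[OF M f gs g(2)] integral_error[OF N f gs g(2)] eq[OF g(1)]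
        by (simp add: algebra_simps abs_le_iff)
    qed
  qed
  have sM: "sets M = sets borel" and sN: "sets N = sets borel" using M N by (auto simp: radon_on_def)
  have eqO: "emeasure M U = emeasure N U" if U: "open U" "compact (closure U)" "closure U \<subseteq> W" for U
  proof -
    have UW: "U \<subseteq> W" using U closure_subset by blast
    obtain V :: "nat \<Rightarrow> 'b set" where V: "\<And>n. compact (closure (V n))" "\<And>n. closure (V n) \<subseteq> U" "(\<Union>n. V n) = U" "\<And>n. V n \<subseteq> V (Suc n)"
      using open_exhaustion[OF lc U(1)] by metis
    have "\<exists>c. c \<in> Cc U \<and> (\<forall>x. 0 \<le> c x \<and> c x \<le> 1) \<and> (\<forall>x\<in>V n. c x = 1)" for n
      using Cc_cutoff[OF lc V(1)[of n] U(1) V(2)[of n]] closure_subset[of "V n"] by (metis subset_iff)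
    then obtain c where c: "\<And>n. c n \<in> Cc U" "\<And>n x. 0 \<le> c n x \<and> c n x \<le> 1" "\<And>n x. x \<in> V n \<Longrightarrow> c n x = 1"
      by metis
    have cW: "c n \<in> Cc W" for n using Cc_mono[OF c(1) UW] .
    have lim: "(\<lambda>n. c n x) \<longlonglongrightarrow> indicat_real U x" for x
    proof (cases "x \<in> U")
      case True
      then obtain m where m: "x \<in> V m" using V by auto
      have "x \<in> V n" if "n \<ge> m" for n using that m V(4) by (induction rule: dec_induct) auto
      then have "\<forall>\<^sub>F n in sequentially. c n x = indicat_real U x" 
        using True c(3) by (auto simp: eventually_sequentially intro!: exI[of _ m])
      then show ?thesis by (rule tendsto_eventually)
    next
      case False
      then have "c n x = 0" for n using Cc_subset[OF c(1)[of n]] not_in_fsupp[of x "c n"] by auto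
      then show ?thesis using False by simp
    qed
    have conv: "(\<lambda>n. \<integral>x. c n x \<partial>Q) \<longlonglongrightarrow> measure Q U" and fin: "emeasure Q U < \<infinity>" if Q: "radon_on W Q" for Q
    proof -
      have sQ: "sets Q = sets borel" using Q by (simp add: radon_on_def)
      have clU: "emeasure Q (closure U) < \<infinity>" using Q U by (simp add: radon_on_def)
      then show fin: "emeasure Q U < \<infinity>"
        using emeasure_mono[OF closure_subset, of U Q] by (auto simp: sQ intro: le_less_trans)
      have "(\<lambda>n. \<integral>x. c n x \<partial>Q) \<longlonglongrightarrow> (\<integral>x. indicator U x \<partial>Q)"
      proof (rule integral_dominated_convergence[where w = "indicat_real U"])
        show "indicat_real U \<in> borel_measurable Q" unfolding measurable_cong_sets[OF sQ refl] using U(1) by simp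
        show "c n \<in> borel_measurable Q" for n by (rule Cc_measurable[OF sQ cW])
        show "integrable Q (indicat_real U)" using fin U sQ by (intro integrable_real_indicator) auto
        show "AE x in Q. (\<lambda>n. c n x) \<longlonglongrightarrow> indicat_real U x" using lim by simp
        have "norm (c n x) \<le> indicat_real U x" for n x
      proof (cases "x \<in> U")
        case False
        then have "x \<notin> fsupp (c n)" using Cc_subset[OF c(1)[of n]] by blast
        then show ?thesis using not_in_fsupp[of x "c n"] by simp
      qed (use c(2)[of n x] in auto)
        then show "AE x in Q. norm (c n x) \<le> indicat_real U x" for n by simp
      qed
      then show "(\<lambda>n. \<integral>x. c n x \<partial>Q) \<longlonglongrightarrow> measure Q U" using radon_on_space[OF Q] by simp
    qed
    have "measure M U = measure N U"
      using LIMSEQ_unique[OF conv[OF M]] conv[OF N] eqC[OF cW] by simp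
    then show ?thesis using fin[OF M] fin[OF N] by (simp add: emeasure_eq_ennreal_measure)
  qed
  obtain V :: "nat \<Rightarrow> 'b set" where V: "\<And>n. open (V n)" "\<And>n. compact (closure (V n))"
    "\<And>n. closure (V n) \<subseteq> W" "\<And>n. V n \<subseteq> V (Suc n)" "(\<Union>n. V n) = W"
    using open_exhaustion[OF lc W] by metis
  have eqV: "emeasure M (V n \<inter> A) = emeasure N (V n \<inter> A)" if A: "A \<in> sets borel" for A n
  proof -
    \<comment> \<open>Restricting to the relatively compact \<open>V n\<close> makes both measures
      finite, so the open sets generate and the constant sequence \<open>UNIV\<close> serves as the
      exhausting one.\<close>
    have "density M (indicator (V n)) = density N (indicator (V n))"
    proof (rule measure_eqI_generator_eq[where E = "{S. open S}" and A = "\<lambda>_. UNIV" and \<Omega> = UNIV])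
      show "Int_stable {S::'b set. open S}" by (auto simp: Int_stable_def)
      fix X :: "'b set" assume "X \<in> {S. open S}"
      then have X: "open X" by simp
      have cl: "closure (V n \<inter> X) \<subseteq> closure (V n)" by (rule closure_mono) auto
      have "emeasure M (V n \<inter> X) = emeasure N (V n \<inter> X)"
        using compact_Int_closed[OF V(2)[of n] closed_closure[of "V n \<inter> X"]] cl V(1)[of n] X
        by (intro eqO open_Int order_trans[OF cl V(3)]) (auto simp: Int_absorb1)
      then show "emeasure (density M (indicator (V n))) X = emeasure (density N (indicator (V n))) X"
        using V X by (simp add: emeasure_restricted sM sN)
    next
      have "emeasure M (V n) \<le> emeasure M (closure (V n))" by (rule emeasure_mono[OF closure_subset]) (simp add: sM)
      also have "\<dots> < \<infinity>" using M V by (simp add: radon_on_def)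
      finally show "emeasure (density M (indicator (V n))) UNIV \<noteq> \<infinity>"
        using V by (simp add: emeasure_restricted sM)
    qed (auto simp: sM sN borel_def)
    then have "emeasure (density M (indicator (V n))) A = emeasure (density N (indicator (V n))) A" by simp
    then show ?thesis using V A by (simp add: emeasure_restricted sM sN)
  qed
  show ?thesis
  proof (rule measure_eqI)
    show "sets M = sets N" using sM sN by simp
    fix A assume "A \<in> sets M"
    then have A: "A \<in> sets borel" using sM by simp
    have lim: "(\<lambda>n. emeasure Q (V n \<inter> A)) \<longlonglongrightarrow> emeasure Q A" if Q: "radon_on W Q" for Q
    proof -
      have sQ: "sets Q = sets borel" using Q by (simp add: radon_on_def)
      have "(\<lambda>n. emeasure Q (V n \<inter> A)) \<longlonglongrightarrow> emeasure Q (\<Union>n. V n \<inter> A)"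
        by (rule Lim_emeasure_incseq) (use V(1) A sQ in \<open>auto intro!: incseq_SucI intro: subsetD[OF V(4)]\<close>)
      also have "(\<Union>n. V n \<inter> A) = W \<inter> A" using V by auto
      also have "emeasure Q (W \<inter> A) = emeasure Q A"
      proof (rule emeasure_eq_AE)
        have "- W \<in> null_sets Q" using Q W sQ by (auto simp: radon_on_def null_sets_def)
        then have "AE x in Q. x \<notin> - W" by (rule AE_not_in)
        then show "AE x in Q. (x \<in> W \<inter> A) = (x \<in> A)" by eventually_elim auto
      qed (use A W sQ in auto)
      finally show ?thesis .
    qed
    show "emeasure M A = emeasure N A"
      using LIMSEQ_unique[OF lim[OF M]] lim[OF N] eqV[OF A] by simp
  qed
qed

text \<open>The approximation error is at most \<open>d * s\<close> with \<open>s\<close> itself in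
  D, so \<open>t * (\<integral>x. s x \<partial>M t)\<close> converges and stays bounded. This
  bounds the error uniformly in t although the total mass of \<open>t * M t\<close> may blow up
  outside W.\<close>

lemma vague_limit:
  fixes W :: "'b::{metric_space, second_countable_topology} set"
  assumes D: "dense_in_Cc W D" and M: "\<And>t. t > t0 \<Longrightarrow> radon (M t)" and \<nu>: "radon_on W \<nu>"
    and lim: "\<And>s. s \<in> D \<Longrightarrow> ((\<lambda>t. t * (\<integral>x. s x \<partial>M t)) \<longlongrightarrow> c * (\<integral>x. s x \<partial>\<nu>)) at_top"
    and c: "0 \<le> c" and f: "f \<in> Cc W"
  shows "((\<lambda>t::real. t * (\<integral>x. f x \<partial>M t)) \<longlongrightarrow> c * (\<integral>x. f x \<partial>\<nu>)) at_top"
proof (rule tendstoI)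
  fix e :: real assume e: "0 < e"
  obtain s where s: "s \<in> D" "\<forall>x. 0 \<le> s x" "\<forall>e>0. \<exists>g\<in>D. \<forall>x. \<bar>f x - g x\<bar> \<le> e * s x"
    using D f unfolding dense_in_Cc_def by blast
  have DC: "D \<subseteq> Cc W" using D by (simp add: dense_in_Cc_def)
  \<comment> \<open>The summand 1 makes C a strict upper bound of the limit, so it eventually bounds
    the convergent quantity, and it makes C positive.\<close>
  define C where "C = c * (\<integral>x. s x \<partial>\<nu>) + 1"
  have "0 \<le> (\<integral>x. s x \<partial>\<nu>)" using s by (intro integral_nonneg_AE) auto
  then have C: "0 < C" using c by (simp add: C_def add_nonneg_pos)
  define d where "d = e / (4 * C)"
  have d: "0 < d" "d * C = e / 4" using e C by (auto simp: d_def)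
  then obtain g where g: "g \<in> D" "\<And>x. \<bar>f x - g x\<bar> \<le> d * s x" using s(3) by blast
  have fgs: "f \<in> Cc W" "g \<in> Cc W" "s \<in> Cc W" using f g s DC by auto
  have fgsU: "f \<in> Cc UNIV" "g \<in> Cc UNIV" "s \<in> Cc UNIV" using fgs Cc_mono by auto
  have 1: "\<bar>c * (\<integral>x. f x \<partial>\<nu>) - c * (\<integral>x. g x \<partial>\<nu>)\<bar> \<le> d * C"
  proof -
    have "\<bar>c * (\<integral>x. f x \<partial>\<nu>) - c * (\<integral>x. g x \<partial>\<nu>)\<bar> \<le> c * (d * (\<integral>x. s x \<partial>\<nu>))"
      using mult_left_mono[OF integral_error[OF \<nu> fgs g(2)] c] c by (simp add: abs_mult flip: right_diff_distrib)
    then show ?thesis using d(1) by (simp add: C_def algebra_simps)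
  qed
  have "\<forall>\<^sub>F t in at_top. t > max 0 t0" by (rule eventually_gt_at_top)
  moreover have "\<forall>\<^sub>F t in at_top. t * (\<integral>x. s x \<partial>M t) < C"
    by (rule order_tendstoD[OF lim[OF s(1)]]) (simp add: C_def)
  moreover have "\<forall>\<^sub>F t in at_top. dist (t * (\<integral>x. g x \<partial>M t)) (c * (\<integral>x. g x \<partial>\<nu>)) < e / 4"
    by (rule tendstoD[OF lim[OF g(1)]]) (use e in simp)
  ultimately show "\<forall>\<^sub>F t in at_top. dist (t * (\<integral>x. f x \<partial>M t)) (c * (\<integral>x. f x \<partial>\<nu>)) < e"
  proof eventually_elim
    case (elim t)
    have R: "radon_on UNIV (M t)" using M elim by (simp add: radon_on_UNIV)
    have "\<bar>t * (\<integral>x. f x \<partial>M t) - t * (\<integral>x. g x \<partial>M t)\<bar> \<le> t * (d * (\<integral>x. s x \<partial>M t))"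
      using mult_left_mono[OF integral_error[OF R fgsU g(2)], of t] elim by (simp add: abs_mult flip: right_diff_distrib)
    also have "\<dots> \<le> d * C" using elim d mult_left_mono[of "t * (\<integral>x. s x \<partial>M t)" C d] by (simp add: algebra_simps)
    finally show ?case using 1 elim(3) d(2) e unfolding dist_real_def by linarith
  qed
qed

section \<open>Vague limits on continuity sets\<close>

lemma indicator_closed_decreasing_limit:
  fixes F :: "'b::metric_space set"
  assumes "closed F"
  obtains d :: "nat \<Rightarrow> 'b \<Rightarrow> real" where "\<And>k. continuous_on UNIV (d k)" "\<And>k x. 0 \<le> d k x" "\<And>k x. d k x \<le> 1"
    "\<And>k x. x \<in> F \<Longrightarrow> d k x = 1" "\<And>x. (\<lambda>k. d k x) \<longlonglongrightarrow> indicator F x"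
proof (cases "F = {}")
  \<comment> \<open>\<open>infdist\<close> to the empty set is 0 by convention, so the formula for
    nonempty \<open>F\<close> would give 1 here.\<close>
  case True then show thesis by (intro that[of "\<lambda>k x. 0"]) auto
next
  case False
  show thesis
  proof (rule that[of "\<lambda>k x. max 0 (1 - real k * infdist x F)"])
    fix x show "(\<lambda>k. max 0 (1 - real k * infdist x F)) \<longlonglongrightarrow> indicator F x"
    proof (cases "x \<in> F")
      case True then show ?thesis by simp
    next
      case x: False
      then have i: "infdist x F > 0" using in_closed_iff_infdist_zero[OF assms False] infdist_nonneg[of x F] by fastforce
      obtain N :: nat where N: "1 / infdist x F < N" using reals_Archimedean2 by blast
      have "max 0 (1 - real k * infdist x F) = 0" if "k \<ge> N" for k
      proof -
        have "1 \<le> real N * infdist x F" using N i by (simp add: field_simps)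
        also have "\<dots> \<le> real k * infdist x F" using that i by (intro mult_right_mono) auto
        finally show ?thesis by simp
      qed
      then show ?thesis using x by (intro tendsto_eventually) (auto simp: eventually_sequentially)
    qed
  qed (auto intro!: continuous_intros simp: infdist_nonneg)
qed

text \<open>Portmanteau argument: for a nonnegative integrand, squeeze its product with the
  indicator of \<Gamma> between functions of \<open>Cc W\<close> that approach the versions with
  closure and interior. The frontier is \<nu>-null, so both bounds have the same limit. Signs are
  handled by positive and negative parts.\<close>

lemma vague_limit_continuity_set:
  fixes W :: "'b::{metric_space, second_countable_topology} set"
  assumes lc: "locally_compact_space (euclidean :: 'b topology)" and W: "open W"
    and M: "\<And>t. t > t0 \<Longrightarrow> radon (M t)" and \<nu>: "radon_on W \<nu>"
    and lim: "\<And>f. f \<in> Cc W \<Longrightarrow> ((\<lambda>t. t * (\<integral>x. f x \<partial>M t)) \<longlongrightarrow> c * (\<integral>x. f x \<partial>\<nu>)) at_top"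
    and c: "0 \<le> c" and \<Gamma>: "\<Gamma> \<in> sets borel" "compact (closure \<Gamma>)" "closure \<Gamma> \<subseteq> W" "emeasure \<nu> (frontier \<Gamma>) = 0"
    and \<phi>: "continuous_on UNIV \<phi>"
  shows "((\<lambda>t::real. t * (\<integral>x. indicator \<Gamma> x * \<phi> x \<partial>M t)) \<longlongrightarrow> c * (\<integral>x. indicator \<Gamma> x * \<phi> x \<partial>\<nu>)) at_top"
proof -
  obtain a V where a: "a \<in> Cc W" "\<And>x. 0 \<le> a x" "\<And>x. a x \<le> 1" "closure \<Gamma> \<subseteq> V" "\<And>x. x \<in> V \<Longrightarrow> a x = 1"
    using Cc_cutoff[OF lc \<Gamma>(2) W \<Gamma>(3)] by metis
  have a1: "a x = 1" if "x \<in> closure \<Gamma>" for x using a that by auto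
  have s\<nu>: "sets \<nu> = sets borel" using \<nu> by (simp add: radon_on_def)
  have int_ind: "integrable Q (\<lambda>x. indicator \<Gamma> x * \<psi> x)" if Q: "radon_on W' Q" "W \<subseteq> W'" and \<psi>: "continuous_on UNIV \<psi>" for Q W' and \<psi> :: "'b \<Rightarrow> real"
  proof (rule Bochner_Integration.integrable_bound)
    have "(\<lambda>x. a x * \<psi> x) \<in> Cc W'" by (rule Cc_mult[OF Cc_mono[OF a(1) Q(2)] \<psi>])
    then show "integrable Q (\<lambda>x. a x * \<psi> x)" by (rule Cc_integrable[OF Q(1)])
    have [measurable]: "\<psi> \<in> borel_measurable borel" using \<psi> by (rule borel_measurable_continuous_onI)
    have "sets Q = sets borel" using Q by (simp add: radon_on_def)
    moreover have "(\<lambda>x. indicator \<Gamma> x * \<psi> x) \<in> borel_measurable borel" using \<Gamma>(1) by measurable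
    ultimately show "(\<lambda>x. indicator \<Gamma> x * \<psi> x) \<in> borel_measurable Q" using measurable_cong_sets by blast
    have "norm (indicator \<Gamma> x * \<psi> x) \<le> norm (a x * \<psi> x)" for x
      using a1[of x] closure_subset[of \<Gamma>] by (auto simp: indicator_def)
    then show "AE x in Q. norm (indicator \<Gamma> x * \<psi> x) \<le> norm (a x * \<psi> x)" by simp
  qed
  have nonneg: "((\<lambda>t. t * (\<integral>x. indicator \<Gamma> x * \<psi> x \<partial>M t)) \<longlongrightarrow> c * (\<integral>x. indicator \<Gamma> x * \<psi> x \<partial>\<nu>)) at_top"
    if \<psi>: "continuous_on UNIV \<psi>" and \<psi>0: "\<And>x. 0 \<le> \<psi> x" for \<psi> :: "'b \<Rightarrow> real"
  proof -
    obtain d where d: "\<And>k. continuous_on UNIV (d k)" "\<And>k x. 0 \<le> d k x" "\<And>k x. d k x \<le> 1"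
      "\<And>k x. x \<in> closure \<Gamma> \<Longrightarrow> d k x = 1" "\<And>x. (\<lambda>k::nat. d k x) \<longlonglongrightarrow> indicat_real (closure \<Gamma>) x"
      using indicator_closed_decreasing_limit[OF closed_closure] by metis
    have "closed (- interior \<Gamma>)" by auto
    then obtain b where b: "\<And>k. continuous_on UNIV (b k)" "\<And>k x. 0 \<le> b k x" "\<And>k x. b k x \<le> 1"
      "\<And>k x. x \<in> - interior \<Gamma> \<Longrightarrow> b k x = 1" "\<And>x. (\<lambda>k::nat. b k x) \<longlonglongrightarrow> indicat_real (- interior \<Gamma>) x"
      using indicator_closed_decreasing_limit by metis
    \<comment> \<open>\<open>d k\<close> tends to the indicator of the closure and
      \<open>1 - b k\<close> to that of the interior; the cutoff \<open>a\<close> makes the supports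
      compact inside W.\<close>
    define u l where "u k x = a x * (\<psi> x * d k x)" and "l k x = a x * (\<psi> x * (1 - b k x))" for k x
    have uC: "u k \<in> Cc W" and lC: "l k \<in> Cc W" for k unfolding u_def l_def
      by (intro Cc_mult[OF a(1)] continuous_intros \<psi> d b)+
    have ge: "indicator \<Gamma> x * \<psi> x \<le> u k x" for k x
      using a1[of x] d(4)[of x k] closure_subset[of \<Gamma>] a(2)[of x] d(2)[of k x] \<psi>0[of x]
      by (auto simp: indicator_def u_def)
    have le: "l k x \<le> indicator \<Gamma> x * \<psi> x" for k x
    proof (cases "x \<in> \<Gamma>")
      case True
      have "a x * (1 - b k x) \<le> 1" using a(2,3)[of x] b(2,3)[of k x] by (intro mult_le_one) auto
      then show ?thesis using True mult_left_mono[of "a x * (1 - b k x)" 1 "\<psi> x"] \<psi>0[of x] by (simp add: l_def algebra_simps)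
    next
      case False
      then have "b k x = 1" using interior_subset[of \<Gamma>] by (intro b(4)) auto
      then show ?thesis using False by (simp add: l_def)
    qed
    have a\<psi>: "integrable \<nu> (\<lambda>x. a x * \<psi> x)" by (rule Cc_integrable[OF \<nu> Cc_mult[OF a(1) \<psi>]])
    have ms: "\<psi> \<in> borel_measurable \<nu>" using borel_measurable_continuous_onI[OF \<psi>] measurable_cong_sets[OF s\<nu> refl] by blast
    have fr: "AE x in \<nu>. x \<notin> frontier \<Gamma>"
      by (rule AE_not_in) (use \<Gamma>(4) s\<nu> in \<open>auto simp: null_sets_def\<close>)
    have lim_u: "(\<lambda>k. \<integral>x. u k x \<partial>\<nu>) \<longlonglongrightarrow> (\<integral>x. indicator \<Gamma> x * \<psi> x \<partial>\<nu>)"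
    proof (rule integral_dominated_convergence[OF _ _ a\<psi>])
      show "(\<lambda>x. indicator \<Gamma> x * \<psi> x) \<in> borel_measurable \<nu>" using int_ind[OF \<nu> order_refl \<psi>] by auto
      show "u k \<in> borel_measurable \<nu>" for k by (rule Cc_measurable[OF s\<nu> uC])
      show "AE x in \<nu>. (\<lambda>k. u k x) \<longlonglongrightarrow> indicator \<Gamma> x * \<psi> x" using fr
      proof eventually_elim
        case (elim x)
        have "(\<lambda>k. u k x) \<longlonglongrightarrow> a x * (\<psi> x * indicat_real (closure \<Gamma>) x)" unfolding u_def by (intro tendsto_intros d(5))
        also have "a x * (\<psi> x * indicat_real (closure \<Gamma>) x) = indicator \<Gamma> x * \<psi> x"
          using elim a1[of x] closure_subset[of \<Gamma>] interior_subset[of \<Gamma>] by (auto simp: indicator_def frontier_def)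
        finally show ?case .
      qed
      have "norm (u k x) \<le> a x * \<psi> x" for k x
        using a(2)[of x] \<psi>0[of x] d(2,3)[of k x] mult_left_mono[of "d k x" 1 "a x * \<psi> x"] by (simp add: u_def abs_mult mult.assoc)
      then show "AE x in \<nu>. norm (u k x) \<le> a x * \<psi> x" for k by simp
    qed
    have lim_l: "(\<lambda>k. \<integral>x. l k x \<partial>\<nu>) \<longlonglongrightarrow> (\<integral>x. indicator \<Gamma> x * \<psi> x \<partial>\<nu>)"
    proof (rule integral_dominated_convergence[OF _ _ a\<psi>])
      show "(\<lambda>x. indicator \<Gamma> x * \<psi> x) \<in> borel_measurable \<nu>" using int_ind[OF \<nu> order_refl \<psi>] by auto
      show "l k \<in> borel_measurable \<nu>" for k by (rule Cc_measurable[OF s\<nu> lC])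
      show "AE x in \<nu>. (\<lambda>k. l k x) \<longlonglongrightarrow> indicator \<Gamma> x * \<psi> x" using fr
      proof eventually_elim
        case (elim x)
        have "(\<lambda>k. l k x) \<longlonglongrightarrow> a x * (\<psi> x * (1 - indicat_real (- interior \<Gamma>) x))" unfolding l_def by (intro tendsto_intros b(5))
        also have "a x * (\<psi> x * (1 - indicat_real (- interior \<Gamma>) x)) = indicator \<Gamma> x * \<psi> x"
          using elim a1[of x] closure_subset[of \<Gamma>] interior_subset[of \<Gamma>] by (auto simp: indicator_def frontier_def)
        finally show ?case .
      qed
      have "norm (l k x) \<le> a x * \<psi> x" for k x
        using a(2)[of x] \<psi>0[of x] b(2,3)[of k x] mult_left_mono[of "1 - b k x" 1 "a x * \<psi> x"] by (simp add: l_def abs_mult mult.assoc)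
      then show "AE x in \<nu>. norm (l k x) \<le> a x * \<psi> x" for k by simp
    qed
    let ?L = "c * (\<integral>x. indicator \<Gamma> x * \<psi> x \<partial>\<nu>)"
    have pos: "\<forall>\<^sub>F t in at_top. t > max 0 t0" by (rule eventually_gt_at_top)
    show ?thesis
    proof (rule order_tendstoI)
      fix y assume "y < ?L"
      moreover have "(\<lambda>k. c * (\<integral>x. l k x \<partial>\<nu>)) \<longlonglongrightarrow> ?L" by (intro tendsto_intros lim_l)
      ultimately obtain k where "y < c * (\<integral>x. l k x \<partial>\<nu>)"
        using eventually_happens'[OF sequentially_bot order_tendstoD(1)] by blast
      from order_tendstoD(1)[OF lim[OF lC] this] pos
      show "\<forall>\<^sub>F t in at_top. y < t * (\<integral>x. indicator \<Gamma> x * \<psi> x \<partial>M t)"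
      proof eventually_elim
        case (elim t)
        then have R: "radon_on UNIV (M t)" using M by (simp add: radon_on_UNIV)
        have "(\<integral>x. l k x \<partial>M t) \<le> (\<integral>x. indicator \<Gamma> x * \<psi> x \<partial>M t)"
          by (rule integral_mono[OF Cc_integrable[OF R Cc_mono[OF lC]] int_ind[OF R _ \<psi>] le]) auto
        then show ?case
          using elim by (intro less_le_trans[OF elim(1)] mult_left_mono) auto
      qed
    next
      fix y assume "?L < y"
      moreover have "(\<lambda>k. c * (\<integral>x. u k x \<partial>\<nu>)) \<longlonglongrightarrow> ?L" by (intro tendsto_intros lim_u)
      ultimately obtain k where "c * (\<integral>x. u k x \<partial>\<nu>) < y"
        using eventually_happens'[OF sequentially_bot order_tendstoD(2)] by blast
      from order_tendstoD(2)[OF lim[OF uC] this] pos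
      show "\<forall>\<^sub>F t in at_top. t * (\<integral>x. indicator \<Gamma> x * \<psi> x \<partial>M t) < y"
      proof eventually_elim
        case (elim t)
        then have R: "radon_on UNIV (M t)" using M by (simp add: radon_on_UNIV)
        have "(\<integral>x. indicator \<Gamma> x * \<psi> x \<partial>M t) \<le> (\<integral>x. u k x \<partial>M t)"
          by (rule integral_mono[OF int_ind[OF R _ \<psi>] Cc_integrable[OF R Cc_mono[OF uC]] ge]) auto
        then show ?case
          using elim by (intro le_less_trans[OF _ elim(1)] mult_left_mono) auto
      qed
    qed
  qed
  define p q where "p x = max 0 (\<phi> x)" and "q x = max 0 (- \<phi> x)" for x
  have pq: "continuous_on UNIV p" "continuous_on UNIV q" unfolding p_def q_def by (intro continuous_intros \<phi>)+
  have split: "(\<integral>x. indicator \<Gamma> x * \<phi> x \<partial>Q) = (\<integral>x. indicator \<Gamma> x * p x \<partial>Q) - (\<integral>x. indicator \<Gamma> x * q x \<partial>Q)"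
    if Q: "radon_on W' Q" "W \<subseteq> W'" for Q W'
  proof -
    have "(\<integral>x. indicator \<Gamma> x * \<phi> x \<partial>Q) = (\<integral>x. indicator \<Gamma> x * p x - indicator \<Gamma> x * q x \<partial>Q)"
      by (rule Bochner_Integration.integral_cong) (auto simp: p_def q_def indicator_def)
    then show ?thesis using int_ind[OF Q pq(1)] int_ind[OF Q pq(2)] by simp
  qed
  have L: "((\<lambda>t. t * (\<integral>x. indicator \<Gamma> x * p x \<partial>M t) - t * (\<integral>x. indicator \<Gamma> x * q x \<partial>M t)) \<longlongrightarrow>
     c * (\<integral>x. indicator \<Gamma> x * p x \<partial>\<nu>) - c * (\<integral>x. indicator \<Gamma> x * q x \<partial>\<nu>)) at_top"
    by (intro tendsto_diff nonneg pq) (auto simp: p_def q_def)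
  have R: "c * (\<integral>x. indicator \<Gamma> x * p x \<partial>\<nu>) - c * (\<integral>x. indicator \<Gamma> x * q x \<partial>\<nu>) = c * (\<integral>x. indicator \<Gamma> x * \<phi> x \<partial>\<nu>)"
    using split[OF \<nu>] by (simp add: right_diff_distrib)
  have E: "\<forall>\<^sub>F t in at_top. t * (\<integral>x. indicator \<Gamma> x * p x \<partial>M t) - t * (\<integral>x. indicator \<Gamma> x * q x \<partial>M t)
      = t * (\<integral>x. indicator \<Gamma> x * \<phi> x \<partial>M t)"
    using eventually_gt_at_top[of t0]
  proof eventually_elim
    case (elim t)
    then have R: "radon_on UNIV (M t)" using M by (simp add: radon_on_UNIV)
    show ?case using split[OF R] by (simp add: right_diff_distrib)
  qed
  show ?thesis by (rule Lim_transform_eventually[OF L[unfolded R] E])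
qed

section \<open>Sums of products of functions of one variable\<close>

definition tensor :: "('a \<Rightarrow> real) \<Rightarrow> ('a \<Rightarrow> real) \<Rightarrow> 'a \<times> 'a \<Rightarrow> real" where
  "tensor u v p = u (fst p) * v (snd p)"

text \<open>The second component is the value of the bilinear map \<open>B\<close>. Recording pairs avoids having to prove
  beforehand that this value depends only on the function.\<close>
inductive_set tensor_span :: "(('a \<Rightarrow> real) \<times> ('a \<Rightarrow> real)) set \<Rightarrow> (('a \<Rightarrow> real) \<Rightarrow> ('a \<Rightarrow> real) \<Rightarrow> real) \<Rightarrow>
    (('a \<times> 'a \<Rightarrow> real) \<times> real) set" for T B where
  tensor_span_base: "(u, v) \<in> T \<Longrightarrow> (tensor u v, B u v) \<in> tensor_span T B"
| tensor_span_add: "(f, c) \<in> tensor_span T B \<Longrightarrow> (g, d) \<in> tensor_span T B \<Longrightarrow>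
    (\<lambda>p. f p + g p, c + d) \<in> tensor_span T B"

text \<open>Stone-Weierstrass needs an algebra with constants, which the functions of
  \<open>tensor_span\<close> need not form. Multiplication by an element of this ring maps them into
  themselves, and that is how approximations are brought back into the span.\<close>

inductive_set tensor_ring :: "('a \<Rightarrow> real) set \<Rightarrow> ('a \<times> 'a \<Rightarrow> real) set" for A where
  tensor_ring_const: "(\<lambda>p. c) \<in> tensor_ring A"
| tensor_ring_base: "u \<in> A \<Longrightarrow> v \<in> A \<Longrightarrow> tensor u v \<in> tensor_ring A"
| tensor_ring_add: "f \<in> tensor_ring A \<Longrightarrow> g \<in> tensor_ring A \<Longrightarrow> (\<lambda>p. f p + g p) \<in> tensor_ring A"
| tensor_ring_mult: "f \<in> tensor_ring A \<Longrightarrow> g \<in> tensor_ring A \<Longrightarrow> (\<lambda>p. f p * g p) \<in> tensor_ring A"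

lemma continuous_tensor:
  fixes u v :: "'a::topological_space \<Rightarrow> real"
  assumes "continuous_on UNIV u" "continuous_on UNIV v" shows "continuous_on S (tensor u v)"
  unfolding tensor_def[abs_def]
  by (intro continuous_on_mult continuous_on_compose2[OF assms(1)] continuous_on_compose2[OF assms(2)]
      continuous_on_fst continuous_on_snd continuous_on_id) auto

lemma tensor_Cc:
  fixes u v :: "'a::t2_space \<Rightarrow> real"
  assumes "u \<in> C0" "v \<in> C0" "fsupp u \<times> fsupp v \<subseteq> W"
  shows "tensor u v \<in> Cc W"
proof (rule CcI[of _ "fsupp u \<times> fsupp v"])
  show "continuous_on UNIV (tensor u v)" using assms by (intro continuous_tensor) (auto simp: C0_def)
  show "compact (fsupp u \<times> fsupp v)" using assms by (intro compact_Times) (auto simp: C0_def)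
qed (use assms in \<open>auto simp: tensor_def intro: in_fsupp\<close>)

section \<open>Algebras with cutoffs and the density of their tensor products\<close>

definition supported_pairs :: "('a::topological_space \<Rightarrow> real) set \<Rightarrow> ('a \<times> 'a) set \<Rightarrow> (('a \<Rightarrow> real) \<times> ('a \<Rightarrow> real)) set" where
  "supported_pairs A W = {(u, v). u \<in> A \<and> v \<in> A \<and> fsupp u \<times> fsupp v \<subseteq> W}"

text \<open>Two algebras are meant: \<open>C0\<close>, on which \<sigma>-hat is characterised, and
  \<open>C0 \<inter> D\<close>, on which J is characterised. Cutoffs inside the algebra provide
  separation of points and localisation in W.\<close>

locale cutoff_algebra =
  fixes A :: "('a::{metric_space, second_countable_topology} \<Rightarrow> real) set"
  assumes lc: "locally_compact_space (euclidean :: 'a topology)"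
    and A_C0: "A \<subseteq> C0"
    and A_add: "f \<in> A \<Longrightarrow> g \<in> A \<Longrightarrow> (\<lambda>x. f x + g x) \<in> A"
    and A_scale: "f \<in> A \<Longrightarrow> (\<lambda>x. c * f x) \<in> A"
    and A_mult: "f \<in> A \<Longrightarrow> g \<in> A \<Longrightarrow> (\<lambda>x. f x * g x) \<in> A"
    and A_cutoff: "compact K \<Longrightarrow> open U \<Longrightarrow> K \<subseteq> U \<Longrightarrow>
      \<exists>a\<in>A. fsupp a \<subseteq> U \<and> (\<forall>x. 0 \<le> a x \<and> a x \<le> 1) \<and> (\<exists>V. open V \<and> K \<subseteq> V \<and> (\<forall>x\<in>V. a x = 1))"
begin

lemma A_cutoffE:
  assumes "compact K" "open U" "K \<subseteq> U"
  obtains a V where "a \<in> A" "fsupp a \<subseteq> U" "\<And>x. 0 \<le> a x" "\<And>x. a x \<le> 1" "open V" "K \<subseteq> V" "\<And>x. x \<in> V \<Longrightarrow> a x = 1"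
  using A_cutoff[OF assms] by meson

lemma A_point:
  assumes "open U" "x \<in> U"
  obtains a where "a \<in> A" "fsupp a \<subseteq> U" "\<And>y. 0 \<le> a y" "a x = 1" "\<And>y. y \<notin> U \<Longrightarrow> a y = 0"
proof -
  have "{x} \<subseteq> U" using assms by simp
  then obtain a V where "a \<in> A" "fsupp a \<subseteq> U" "\<And>y. 0 \<le> a y" "{x} \<subseteq> V" "\<And>y. y \<in> V \<Longrightarrow> a y = 1"
    using A_cutoffE[OF compact_sing assms(1)] by metis
  then show thesis using that[of a] not_in_fsupp[of _ a] by (auto simp: subset_iff)
qed

lemma A_cont: "f \<in> A \<Longrightarrow> continuous_on UNIV f"
  using A_C0 by (auto simp: C0_def)

lemma A_diff: "f \<in> A \<Longrightarrow> g \<in> A \<Longrightarrow> (\<lambda>x. f x - g x) \<in> A"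
  using A_add[OF _ A_scale[of g "-1"], of f] by simp

lemma A_zero: "(\<lambda>x. 0) \<in> A"
  using A_cutoff[of "{}" "{}"] A_scale[of _ 0] by fastforce

lemma tensor_span_scale:
  assumes "\<And>u v r. (u, v) \<in> supported_pairs A W \<Longrightarrow> B (\<lambda>x. r * u x) v = r * B u v"
    and "(f, c) \<in> tensor_span (supported_pairs A W) B"
  shows "(\<lambda>p. r * f p, r * c) \<in> tensor_span (supported_pairs A W) B"
  using assms(2)
proof induction
  case (tensor_span_base u v)
  have "fsupp (\<lambda>x. r * u x) \<subseteq> fsupp u" by (rule fsupp_mono) auto
  then have "(\<lambda>x. r * u x, v) \<in> supported_pairs A W"
    using tensor_span_base A_scale by (auto simp: supported_pairs_def)
  from tensor_span.tensor_span_base[OF this, of B] show ?case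
    using assms(1)[OF tensor_span_base] by (simp add: tensor_def[abs_def] mult.assoc)
next
  case (tensor_span_add f c g d)
  from tensor_span.tensor_span_add[OF tensor_span_add.IH] show ?case by (simp add: distrib_left)
qed

lemma tensor_span_mult_tensor:
  assumes "(f, c) \<in> tensor_span (supported_pairs A W) B" "a \<in> A" "b \<in> A"
  shows "\<exists>d. (\<lambda>p. f p * tensor a b p, d) \<in> tensor_span (supported_pairs A W) B"
  using assms(1)
proof induction
  case (tensor_span_base u v)
  have "fsupp (\<lambda>x. u x * a x) \<subseteq> fsupp u" "fsupp (\<lambda>x. v x * b x) \<subseteq> fsupp v" by (rule fsupp_mono; simp)+
  then have "(\<lambda>x. u x * a x, \<lambda>x. v x * b x) \<in> supported_pairs A W"
    using tensor_span_base A_mult assms by (auto simp: supported_pairs_def)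
  from tensor_span.tensor_span_base[OF this, of B] show ?case
    by (auto simp: tensor_def[abs_def] algebra_simps)
next
  case (tensor_span_add f c g d)
  then show ?case using tensor_span.tensor_span_add by (fastforce simp: distrib_right)
qed

text \<open>Multiplication does not act on the recorded value, so \<open>B\<close> is taken to be 0
  here; by \<open>fst_tensor_span\<close> the set of functions does not depend on
  \<open>B\<close>.\<close>

lemma tensor_span_mult_ring:
  assumes "g \<in> tensor_ring A" "(f, c) \<in> tensor_span (supported_pairs A W) (\<lambda>_ _. 0)"
  shows "\<exists>d. (\<lambda>p. f p * g p, d) \<in> tensor_span (supported_pairs A W) (\<lambda>_ _. 0)"
  using assms
proof (induction arbitrary: f c)
  case (tensor_ring_const r)
  then show ?case using tensor_span_scale[of W "\<lambda>_ _. 0" f c r] by (auto simp: mult.commute)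
next
  case (tensor_ring_base u v)
  then show ?case by (rule tensor_span_mult_tensor[rotated])
next
  case (tensor_ring_add g h)
  obtain d d' where "(\<lambda>p. f p * g p, d) \<in> tensor_span (supported_pairs A W) (\<lambda>_ _. 0)"
    "(\<lambda>p. f p * h p, d') \<in> tensor_span (supported_pairs A W) (\<lambda>_ _. 0)"
    using tensor_ring_add.IH[OF tensor_ring_add.prems] by blast
  from tensor_span.tensor_span_add[OF this] show ?case by (auto simp: distrib_left)
next
  case (tensor_ring_mult g h)
  obtain d where "(\<lambda>p. f p * g p, d) \<in> tensor_span (supported_pairs A W) (\<lambda>_ _. 0)"
    using tensor_ring_mult.IH(1)[OF tensor_ring_mult.prems] by blast
  from tensor_ring_mult.IH(2)[OF this] show ?case by (simp add: mult.assoc)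
qed

lemma fst_tensor_span: "fst ` tensor_span T B = fst ` tensor_span T B'"
proof -
  have "\<exists>d. (f, d) \<in> tensor_span T B'" if "(f, c) \<in> tensor_span T B" for f c B B'
    using that by induction (auto intro: tensor_span.intros)
  then show ?thesis by (force intro!: equalityI)
qed

lemma tensor_span_Cc:
  assumes "(f, c) \<in> tensor_span (supported_pairs A W) B" shows "f \<in> Cc W"
  using assms
proof induction
  case (tensor_span_base u v)
  then show ?case using A_C0 by (intro tensor_Cc) (auto simp: supported_pairs_def)
qed (rule Cc_add)

lemma tensor_span_zero: "(\<lambda>p. 0, 0) \<in> tensor_span (supported_pairs A W) (\<lambda>_ _. 0)"
proof -
  have "(\<lambda>x. 0, \<lambda>x. 0) \<in> supported_pairs A W" by (auto simp: supported_pairs_def A_zero fsupp_def)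
  from tensor_span.tensor_span_base[OF this, of "\<lambda>_ _. 0"] show ?thesis by (simp add: tensor_def[abs_def])
qed

text \<open>Factor \<open>f = s * q\<close> with a nonnegative \<open>s\<close> in the span that
  exceeds 1/2 on the support of f. Stone-Weierstrass approximates \<open>q\<close> on the support of
  \<open>s\<close> by some \<open>h\<close> in the ring, and \<open>s * h\<close> is again in the
  span. The error is then automatically at most \<open>e * s\<close>, as \<open>dense_in_Cc\<close>
  demands.\<close>

theorem tensor_span_dense:
  assumes W: "open W"
  shows "dense_in_Cc W (fst ` tensor_span (supported_pairs A W) B)"
proof -
  define L where "L = fst ` tensor_span (supported_pairs A W) (\<lambda>_ _. 0)"
  have L_sum: "(\<lambda>x. \<Sum>i\<in>F. h i x) \<in> L" if "\<And>i. i \<in> F \<Longrightarrow> h i \<in> L" for F :: "('a \<times> 'a) set" and h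
    using that
  proof (induction F rule: infinite_finite_induct)
    case (insert x F)
    then have "h x \<in> L" "(\<lambda>y. \<Sum>i\<in>F. h i y) \<in> L" by auto
    then obtain c d where "(h x, c) \<in> tensor_span (supported_pairs A W) (\<lambda>_ _. 0)"
      "(\<lambda>y. \<Sum>i\<in>F. h i y, d) \<in> tensor_span (supported_pairs A W) (\<lambda>_ _. 0)" by (auto simp: L_def)
    from tensor_span.tensor_span_add[OF this] insert show ?case by (force simp: L_def)
  qed (use tensor_span_zero in \<open>force simp: L_def\<close>)+
  have "\<exists>s\<in>L. (\<forall>x. 0 \<le> s x) \<and> (\<forall>e>0. \<exists>g\<in>L. \<forall>x. \<bar>f x - g x\<bar> \<le> e * s x)" if f: "f \<in> Cc W" for f
  proof -
    have "\<exists>b. b \<in> L \<and> b \<in> Cc W \<and> (\<forall>x. 0 \<le> b x) \<and> 1/2 < b p" if "p \<in> fsupp f" for p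
    proof -
      have "p \<in> W" using that f by (auto simp: Cc_def)
      then obtain U V where UV: "open U" "open V" "fst p \<in> U" "snd p \<in> V" "U \<times> V \<subseteq> W"
        using open_prod_elim[OF W] by (metis mem_Times_iff)
      obtain a where a: "a \<in> A" "fsupp a \<subseteq> U" "\<And>x. 0 \<le> a x" "a (fst p) = 1"
        using A_point[OF UV(1,3)] by metis
      obtain b where b: "b \<in> A" "fsupp b \<subseteq> V" "\<And>x. 0 \<le> b x" "b (snd p) = 1"
        using A_point[OF UV(2,4)] by metis
      have ab: "(a, b) \<in> supported_pairs A W" using a b UV by (auto simp: supported_pairs_def)
      have "tensor a b \<in> L" using tensor_span.tensor_span_base[OF ab, of "\<lambda>_ _. 0"] by (force simp: L_def)
      moreover have "tensor a b \<in> Cc W"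
        using tensor_span_Cc[OF tensor_span.tensor_span_base[OF ab, of "\<lambda>_ _. 0"]] .
      ultimately show ?thesis using a b by (intro exI[of _ "tensor a b"]) (auto simp: tensor_def)
    qed
    then obtain b where b: "\<And>p. p \<in> fsupp f \<Longrightarrow> b p \<in> L \<and> b p \<in> Cc W \<and> (\<forall>x. 0 \<le> b p x) \<and> 1/2 < (b p p :: real)"
      by metis
    obtain F where F: "finite F" "F \<subseteq> fsupp f" "\<And>x. x \<in> fsupp f \<Longrightarrow> 1/2 < (\<Sum>p\<in>F. b p x)"
      by (rule finite_bump_sum[OF Cc_compact[OF f], of b W]) (use b in blast, rule that)
    define s where "s x = (\<Sum>p\<in>F. b p x)" for x
    have sL: "s \<in> L" unfolding s_def using F b by (intro L_sum) auto
    have sC: "s \<in> Cc W" unfolding s_def using F b by (intro Cc_sum) auto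
    have s0: "0 \<le> s x" for x unfolding s_def using F(2) b by (intro sum_nonneg) (metis subsetD)
    \<comment> \<open>The \<open>max\<close> keeps the denominator away from 0 everywhere and
      changes nothing on the support of f.\<close>
    define q where "q x = f x / max (s x) (1/2)" for x
    have qs: "f x = s x * q x" for x
    proof (cases "x \<in> fsupp f")
      case True then show ?thesis using F(3)[of x] by (auto simp: q_def s_def)
    qed (use not_in_fsupp[of x f] in \<open>auto simp: q_def\<close>)
    have q_cont: "continuous_on UNIV q" unfolding q_def
      by (intro continuous_intros Cc_cont[OF f] Cc_cont[OF sC]) (simp add: max_def)
    have fr: "function_ring_on (tensor_ring A) (fsupp s)"
    proof
      show "compact (fsupp s)" by (rule Cc_compact[OF sC])
      show "continuous_on (fsupp s) g" if "g \<in> tensor_ring A" for g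
        using that
      proof induction
        case (tensor_ring_base u v)
        then show ?case by (intro continuous_tensor A_cont)
      qed (intro continuous_on_const continuous_on_add continuous_on_mult; assumption)+
      fix x y :: "'a \<times> 'a" assume "x \<noteq> y"
      have *: "\<exists>g\<in>tensor_ring A. g x \<noteq> g y" if "fst x \<noteq> fst y \<or> snd x \<noteq> snd y" for x y :: "'a \<times> 'a"
      proof -
        obtain a where a: "a \<in> A" "a (fst x) = 1" "fst x \<noteq> fst y \<Longrightarrow> a (fst y) = 0"
        proof (cases "fst x = fst y")
          case True then show thesis using A_point[OF open_UNIV UNIV_I] that by metis
        next
          case False
          then have "open (- {fst y})" "fst x \<in> - {fst y}" by auto
          from A_point[OF this] show thesis using that by (metis ComplD singletonI)
        qed
        obtain b where b: "b \<in> A" "b (snd x) = 1" "snd x \<noteq> snd y \<Longrightarrow> b (snd y) = 0"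
        proof (cases "snd x = snd y")
          case True then show thesis using A_point[OF open_UNIV UNIV_I] that by metis
        next
          case False
          then have "open (- {snd y})" "snd x \<in> - {snd y}" by auto
          from A_point[OF this] show thesis using that by (metis ComplD singletonI)
        qed
        show ?thesis using a b that by (intro bexI[of _ "tensor a b"]) (auto simp: tensor_def intro: tensor_ring.intros)
      qed
      show "\<exists>g\<in>tensor_ring A. g x \<noteq> g y" using * \<open>x \<noteq> y\<close> by (metis prod_eqI)
    qed (auto intro: tensor_ring.intros)
    have "\<exists>g\<in>L. \<forall>x. \<bar>f x - g x\<bar> \<le> e * s x" if "0 < e" for e
    proof -
      obtain h where h: "h \<in> tensor_ring A" "\<And>x. x \<in> fsupp s \<Longrightarrow> \<bar>q x - h x\<bar> < e"
        using function_ring_on.Stone_Weierstrass_basic[OF fr continuous_on_subset[OF q_cont] \<open>0 < e\<close>] by blast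
      have "(\<lambda>p. s p * h p) \<in> L" using sL tensor_span_mult_ring[OF h(1)] by (force simp: L_def)
      moreover have "\<bar>f x - s x * h x\<bar> \<le> e * s x" for x
      proof (cases "x \<in> fsupp s")
        case True
        have "\<bar>f x - s x * h x\<bar> = s x * \<bar>q x - h x\<bar>" 
          using s0[of x] by (simp add: qs[of x] abs_mult flip: right_diff_distrib)
        also have "\<dots> \<le> s x * e" using h(2)[OF True] s0 by (intro mult_left_mono) auto
        finally show ?thesis by (simp add: mult.commute)
      qed (use not_in_fsupp[of x s] qs[of x] in auto)
      ultimately show ?thesis by (intro bexI[of _ "\<lambda>p. s p * h p"]) auto
    qed
    then show ?thesis using sL s0 by (intro bexI[of _ s]) auto
  qed
  moreover have "L \<subseteq> Cc W" using tensor_span_Cc by (auto simp: L_def)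
  ultimately show ?thesis
    unfolding dense_in_Cc_def L_def by (subst (1 2 3) fst_tensor_span[of _ B "\<lambda>_ _. 0"]) blast
qed

end

section \<open>Hilbert space methods\<close>

text \<open>Definiteness is left out because functions equal almost everywhere are not identified.
  Hence representatives below are unique only up to null vectors, and Cauchy-Schwarz has to treat
  null vectors separately.\<close>

locale psd_form =
  fixes V :: "('a \<Rightarrow> real) set" and a :: "('a \<Rightarrow> real) \<Rightarrow> ('a \<Rightarrow> real) \<Rightarrow> real"
  assumes V_add: "f \<in> V \<Longrightarrow> g \<in> V \<Longrightarrow> (\<lambda>x. f x + g x) \<in> V"
    and V_scale: "f \<in> V \<Longrightarrow> (\<lambda>x. c * f x) \<in> V"
    and add_left: "f \<in> V \<Longrightarrow> g \<in> V \<Longrightarrow> h \<in> V \<Longrightarrow> a (\<lambda>x. f x + g x) h = a f h + a g h"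
    and add_right: "f \<in> V \<Longrightarrow> g \<in> V \<Longrightarrow> h \<in> V \<Longrightarrow> a h (\<lambda>x. f x + g x) = a h f + a h g"
    and scale_left: "f \<in> V \<Longrightarrow> h \<in> V \<Longrightarrow> a (\<lambda>x. c * f x) h = c * a f h"
    and scale_right: "f \<in> V \<Longrightarrow> h \<in> V \<Longrightarrow> a h (\<lambda>x. c * f x) = c * a h f"
    and nonneg: "f \<in> V \<Longrightarrow> 0 \<le> a f f"
begin

lemma V_diff: "f \<in> V \<Longrightarrow> g \<in> V \<Longrightarrow> (\<lambda>x. f x - g x) \<in> V"
  using V_add[OF _ V_scale[of g "-1"], of f] by simp

lemma diff_left: "f \<in> V \<Longrightarrow> g \<in> V \<Longrightarrow> h \<in> V \<Longrightarrow> a (\<lambda>x. f x - g x) h = a f h - a g h"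
  using add_left[OF _ V_scale[of g "-1"], of f h] scale_left[of g h "-1"] by simp

lemma diff_right: "f \<in> V \<Longrightarrow> g \<in> V \<Longrightarrow> h \<in> V \<Longrightarrow> a h (\<lambda>x. f x - g x) = a h f - a h g"
  using add_right[OF _ V_scale[of g "-1"], of f h] scale_right[of g h "-1"] by simp

lemmas V_ops = V_add V_scale V_diff
lemmas form_simps = add_left add_right scale_left scale_right diff_left diff_right V_ops

end

locale inner_form = psd_form +
  assumes sym: "f \<in> V \<Longrightarrow> g \<in> V \<Longrightarrow> a f g = a g f"
begin

lemma cauchy_schwarz_square:
  assumes "f \<in> V" "g \<in> V" shows "(a f g)\<^sup>2 \<le> a f f * a g g"
proof -
  have q: "0 \<le> a f f - 2 * t * a f g + t\<^sup>2 * a g g" for t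
  proof -
    have "0 \<le> a (\<lambda>x. f x - t * g x) (\<lambda>x. f x - t * g x)" by (intro nonneg V_ops assms)
    also have "\<dots> = a f f - 2 * t * a f g + t\<^sup>2 * a g g"
      using assms sym[OF assms] by (simp add: form_simps algebra_simps power2_eq_square)
    finally show ?thesis .
  qed
  show ?thesis
  proof (cases "a g g = 0")
    case True
    have "a f g = 0"
    proof (rule ccontr)
      assume "a f g \<noteq> 0"
      \<comment> \<open>At this t the quadratic polynomial takes the value -1.\<close>
      then show False using q[of "(a f f + 1) / (2 * a f g)"] True nonneg[OF assms(1)] by simp
    qed
    then show ?thesis using True by simp
  next
    case False
    then have "0 < a g g" using nonneg[OF assms(2)] by simp
    then show ?thesis using q[of "a f g / a g g"] by (simp add: field_simps power2_eq_square)
  qed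
qed

lemma cauchy_schwarz:
  assumes "f \<in> V" "g \<in> V" shows "\<bar>a f g\<bar> \<le> sqrt (a f f) * sqrt (a g g)"
  using real_sqrt_le_mono[OF cauchy_schwarz_square[OF assms]] by (simp add: real_sqrt_mult)

lemma sum_bound:
  assumes "f \<in> V" "g \<in> V"
  shows "a f f \<le> 2 * a (\<lambda>x. f x - g x) (\<lambda>x. f x - g x) + 2 * a g g"
proof -
  have "0 \<le> a (\<lambda>x. f x - 2 * g x) (\<lambda>x. f x - 2 * g x)" by (intro nonneg V_ops assms)
  then show ?thesis using assms sym[OF assms] by (simp add: form_simps)
qed

end

locale hilbert_form = inner_form +
  assumes complete: "(\<And>n. h n \<in> V) \<Longrightarrow>
    (\<And>e. 0 < e \<Longrightarrow> \<exists>N. \<forall>n\<ge>N. \<forall>k\<ge>N. a (\<lambda>x. h n x - h k x) (\<lambda>x. h n x - h k x) < e) \<Longrightarrow>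
    \<exists>f\<in>V. (\<lambda>n. a (\<lambda>x. h n x - f x) (\<lambda>x. h n x - f x)) \<longlonglongrightarrow> 0"
    and V_nonempty: "V \<noteq> {}"
begin

lemma tendsto_form:
  assumes h: "\<And>n. h n \<in> V" and f: "f \<in> V" and w: "w \<in> V"
    and lim: "(\<lambda>n. a (\<lambda>x. h n x - f x) (\<lambda>x. h n x - f x)) \<longlonglongrightarrow> 0"
  shows "(\<lambda>n. a (h n) w) \<longlonglongrightarrow> a f w"
proof -
  have "(\<lambda>n. sqrt (a (\<lambda>x. h n x - f x) (\<lambda>x. h n x - f x)) * sqrt (a w w)) \<longlonglongrightarrow> sqrt 0 * sqrt (a w w)"
    by (intro tendsto_intros lim)
  then have "(\<lambda>n. a (\<lambda>x. h n x - f x) w) \<longlonglongrightarrow> 0"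
    by (intro Lim_null_comparison[of "\<lambda>n. a (\<lambda>x. h n x - f x) w"])
       (use cauchy_schwarz[OF V_diff[OF h f] w] in auto)
  then have "(\<lambda>n. a (h n) w - a f w) \<longlonglongrightarrow> 0" using h f w by (simp add: form_simps)
  then show ?thesis by (simp add: LIM_zero_iff)
qed

text \<open>Direct method: a minimising sequence of \<open>J w = a w w - 2 * l w\<close> is Cauchy
  by the parallelogram identity, and its limit satisfies the Euler equation
  \<open>a g w = l w\<close>.\<close>

theorem riesz_representation:
  assumes l_add: "\<And>f g. f \<in> V \<Longrightarrow> g \<in> V \<Longrightarrow> l (\<lambda>x. f x + g x) = l f + l g"
    and l_scale: "\<And>f c. f \<in> V \<Longrightarrow> l (\<lambda>x. c * f x) = c * l f"
    and l_bound: "\<And>f. f \<in> V \<Longrightarrow> \<bar>l f\<bar> \<le> C * sqrt (a f f)"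
  shows "\<exists>g\<in>V. \<forall>w\<in>V. a g w = l w"
proof -
  define J where "J w = a w w - 2 * l w" for w
  define m where "m = Inf (J ` V)"
  have "- (C\<^sup>2) \<le> J w" if "w \<in> V" for w
  proof -
    have "0 \<le> (sqrt (a w w) - C)\<^sup>2" by simp
    also have "\<dots> = a w w - 2 * (C * sqrt (a w w)) + C\<^sup>2"
      using nonneg[OF that] by (simp add: power2_diff)
    finally show ?thesis using l_bound[OF that] by (simp add: J_def)
  qed
  then have bdd: "bdd_below (J ` V)" by (auto simp: bdd_below_def)
  have m_le: "m \<le> J w" if "w \<in> V" for w unfolding m_def by (rule cInf_lower) (use that bdd in auto)
  have "\<exists>w\<in>V. J w < m + 1 / real (Suc n)" for n
    using cInf_lessD[of "J ` V" "m + 1 / real (Suc n)"] V_nonempty by (auto simp: m_def)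
  then obtain h where h: "\<And>n. h n \<in> V" "\<And>n. J (h n) < m + 1 / real (Suc n)" by metis
  \<comment> \<open>The left side equals 2 J(f) + 2 J(g) - 4 J((f + g)/2), and the midpoint value is
    at least m.\<close>
  have par: "a (\<lambda>x. f x - g x) (\<lambda>x. f x - g x) \<le> 2 * (J f - m) + 2 * (J g - m)" if "f \<in> V" "g \<in> V" for f g
  proof -
    have "m \<le> J (\<lambda>x. (1/2) * (f x + g x))" by (intro m_le V_ops that)
    also have J_scale: "J (\<lambda>x. c * (f x + g x)) = c * c * (a f f + 2 * a f g + a g g) - 2 * c * (l f + l g)" for c
    proof -
      have "a (\<lambda>x. c * (f x + g x)) (\<lambda>x. c * (f x + g x)) = c * (c * (a f f + 2 * a f g + a g g))"
        using that sym[OF that] by (simp only: scale_left scale_right V_add V_scale) (simp add: form_simps)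
      moreover have "l (\<lambda>x. c * (f x + g x)) = c * (l f + l g)" using that by (simp only: l_scale l_add V_add)
      ultimately show ?thesis by (simp add: J_def)
    qed
    finally have "m \<le> (a f f + 2 * a f g + a g g) / 4 - (l f + l g)" by simp
    moreover have "a (\<lambda>x. f x - g x) (\<lambda>x. f x - g x) = a f f - 2 * a f g + a g g"
      using that sym[OF that] by (simp add: form_simps)
    ultimately show ?thesis unfolding J_def by argo
  qed
  have "\<exists>g\<in>V. (\<lambda>n. a (\<lambda>x. h n x - g x) (\<lambda>x. h n x - g x)) \<longlonglongrightarrow> 0"
  proof (rule complete[OF h(1)])
    fix e :: real assume "0 < e"
    then obtain N where N: "4 / e < real N" using reals_Archimedean2 by blast
    have small: "J (h n) - m < e / 4" if "n \<ge> N" for n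
    proof -
      have "4 / e < real (Suc n)" using N that by simp
      then have "1 / real (Suc n) < e / 4" using \<open>0 < e\<close> by (simp add: field_simps)
      then show ?thesis using h(2)[of n] by simp
    qed
    have "a (\<lambda>x. h n x - h k x) (\<lambda>x. h n x - h k x) < e" if "n \<ge> N" "k \<ge> N" for n k
      using par[OF h(1)[of n] h(1)[of k]] small[OF that(1)] small[OF that(2)] by simp
    then show "\<exists>N. \<forall>n\<ge>N. \<forall>k\<ge>N. a (\<lambda>x. h n x - h k x) (\<lambda>x. h n x - h k x) < e" by blast
  qed
  then obtain g where g: "g \<in> V" "(\<lambda>n. a (\<lambda>x. h n x - g x) (\<lambda>x. h n x - g x)) \<longlonglongrightarrow> 0" by blast
  have "a g w = l w" if w: "w \<in> V" for w
  proof -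
    define Q where "Q = a w w + 1"
    have Q: "0 < Q" using nonneg[OF w] by (simp add: Q_def)
    have "(a (h n) w - l w)\<^sup>2 \<le> Q / real (Suc n)" for n
    proof -
      define d where "d = a (h n) w - l w"
      \<comment> \<open>The minimiser of t^2 Q + 2 t d. Near-minimality of \<open>h n\<close> then
        bounds its decrease d^2/Q by \<open>1 / Suc n\<close>. The 1 in Q avoids division by 0 for
        null vectors w.\<close>
      define t where "t = - d / Q"
      have "m \<le> J (\<lambda>x. h n x + t * w x)" by (intro m_le V_ops h w)
      also have "\<dots> = J (h n) + (t\<^sup>2 * a w w + 2 * t * d)"
        using h(1)[of n] w sym[OF h(1)[of n] w] unfolding J_def d_def
        by (simp add: form_simps l_add l_scale algebra_simps power2_eq_square)
      also have "t\<^sup>2 * a w w + 2 * t * d \<le> t\<^sup>2 * Q + 2 * t * d" by (simp add: Q_def algebra_simps)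
      also have "t\<^sup>2 * Q + 2 * t * d = - (d\<^sup>2 / Q)" using Q by (simp add: t_def field_simps power2_eq_square)
      finally have "d\<^sup>2 / Q \<le> 1 / real (Suc n)" using h(2)[of n] by simp
      then show ?thesis using Q by (simp add: d_def field_simps)
    qed
    moreover have "(\<lambda>n. Q / real (Suc n)) \<longlonglongrightarrow> 0" using LIMSEQ_Suc[OF lim_const_over_n[of Q]] .
    ultimately have "(\<lambda>n. (a (h n) w - l w)\<^sup>2) \<longlonglongrightarrow> 0"
      by (intro Lim_null_comparison[of "\<lambda>n. (a (h n) w - l w)\<^sup>2"]) auto
    moreover have "(\<lambda>n. (a (h n) w - l w)\<^sup>2) \<longlonglongrightarrow> (a g w - l w)\<^sup>2"
      by (intro tendsto_intros tendsto_form[OF h(1) g(1) w g(2)])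
    ultimately show ?thesis using LIMSEQ_unique by fastforce
  qed
  with g(1) show ?thesis by blast
qed

lemma equivalent_hilbert_form:
  assumes b: "inner_form V b" and lower: "\<And>f. f \<in> V \<Longrightarrow> a f f \<le> b f f"
    and upper: "\<And>f. f \<in> V \<Longrightarrow> b f f \<le> C * a f f"
  shows "hilbert_form V b"
proof -
  interpret b: inner_form V b by fact
  show ?thesis
  proof
    fix h :: "nat \<Rightarrow> 'a \<Rightarrow> real" assume h: "\<And>n. h n \<in> V"
      and C: "\<And>e. 0 < e \<Longrightarrow> \<exists>N. \<forall>n\<ge>N. \<forall>k\<ge>N. b (\<lambda>x. h n x - h k x) (\<lambda>x. h n x - h k x) < e"
    have "\<exists>f\<in>V. (\<lambda>n. a (\<lambda>x. h n x - f x) (\<lambda>x. h n x - f x)) \<longlonglongrightarrow> 0"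
    proof (rule complete[OF h])
      fix e :: real assume "0 < e"
      then show "\<exists>N. \<forall>n\<ge>N. \<forall>k\<ge>N. a (\<lambda>x. h n x - h k x) (\<lambda>x. h n x - h k x) < e"
        using C lower[OF V_diff[OF h h]] by (meson le_less_trans)
    qed
    then obtain f where f: "f \<in> V" "(\<lambda>n. a (\<lambda>x. h n x - f x) (\<lambda>x. h n x - f x)) \<longlonglongrightarrow> 0" by blast
    have "(\<lambda>n. C * a (\<lambda>x. h n x - f x) (\<lambda>x. h n x - f x)) \<longlonglongrightarrow> 0"
      using tendsto_mult_left[OF f(2), of C] by simp
    then have "(\<lambda>n. b (\<lambda>x. h n x - f x) (\<lambda>x. h n x - f x)) \<longlonglongrightarrow> 0"
      by (rule Lim_null_comparison[rotated])
         (use upper[OF V_diff[OF h f(1)]] b.nonneg[OF V_diff[OF h f(1)]] in auto)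
    with f(1) show "\<exists>f\<in>V. (\<lambda>n. b (\<lambda>x. h n x - f x) (\<lambda>x. h n x - f x)) \<longlonglongrightarrow> 0" by blast
  qed (rule V_nonempty)
qed

text \<open>If \<open>h\<^sub>n\<close> represents \<open>l\<close> for the form \<open>a + n q\<close>, then \<open>l (h\<^sub>n)\<close> decreases, which makes \<open>h\<^sub>n\<close> a Cauchy
  sequence; its limit is null for \<open>q\<close>, hence for \<open>a\<close>.\<close>
lemma weak_limit_zero:
  assumes q: "inner_form V q" and q_le: "\<And>f. f \<in> V \<Longrightarrow> q f f \<le> a f f"
    and definite: "\<And>f. f \<in> V \<Longrightarrow> q f f = 0 \<Longrightarrow> a f f = 0"
    and l_add: "\<And>f g. f \<in> V \<Longrightarrow> g \<in> V \<Longrightarrow> l (\<lambda>x. f x + g x) = l f + l g"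
    and l_scale: "\<And>f c. f \<in> V \<Longrightarrow> l (\<lambda>x. c * f x) = c * l f"
    and l_bound: "\<And>f. f \<in> V \<Longrightarrow> \<bar>l f\<bar> \<le> C * sqrt (a f f)"
    and F: "\<forall>\<^sub>F t in G. F t \<in> V \<and> a (F t) (F t) \<le> M" and F0: "((\<lambda>t. q (F t) (F t)) \<longlongrightarrow> 0) G"
  shows "((\<lambda>t. l (F t)) \<longlongrightarrow> 0) G"
proof -
  interpret q: inner_form V q by fact
  have "\<exists>h\<in>V. \<forall>w\<in>V. a h w + real n * q h w = l w" for n
  proof -
    interpret n: hilbert_form V "\<lambda>f g. a f g + real n * q f g"
    proof (rule equivalent_hilbert_form)
      show "inner_form V (\<lambda>f g. a f g + real n * q f g)"
        by unfold_locales (auto simp: form_simps q.form_simps algebra_simps nonneg q.nonneg sym q.sym)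
      show "a f f + real n * q f f \<le> (1 + real n) * a f f" if "f \<in> V" for f
        using q_le[OF that] mult_left_mono[of "q f f" "a f f" "real n"] by (simp add: distrib_right)
    qed (use q.nonneg in auto)
    show ?thesis
    proof (rule n.riesz_representation[OF l_add l_scale])
      fix f assume f: "f \<in> V"
      have "a f f \<le> a f f + real n * q f f" using q.nonneg[OF f] by simp
      then have "\<bar>C\<bar> * sqrt (a f f) \<le> \<bar>C\<bar> * sqrt (a f f + real n * q f f)" by (intro mult_left_mono real_sqrt_le_mono) auto
      moreover have "C * sqrt (a f f) \<le> \<bar>C\<bar> * sqrt (a f f)" using nonneg[OF f] by (intro mult_right_mono) auto
      ultimately show "\<bar>l f\<bar> \<le> \<bar>C\<bar> * sqrt (a f f + real n * q f f)" using l_bound[OF f] by linarith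
    qed
  qed
  then obtain h where h: "\<And>n. h n \<in> V" "\<And>n w. w \<in> V \<Longrightarrow> a (h n) w + real n * q (h n) w = l w" by metis
  have lh: "l (h n) = a (h n) (h n) + real n * q (h n) (h n)" for n using h by simp
  have lh0: "0 \<le> l (h n)" for n using lh[of n] nonneg[OF h(1)] q.nonneg[OF h(1)] by simp
  \<comment> \<open>Test the equation for \<open>h n\<close> with \<open>h k\<close>. The right side
    minus the left side is n q(h_n - h_k, h_n - h_k) + (k - n) q(h_k, h_k), nonnegative for n \<le>
    k.\<close>
  have gap: "a (\<lambda>x. h n x - h k x) (\<lambda>x. h n x - h k x) \<le> l (h n) - l (h k)" if "n \<le> k" for n k
  proof -
    have nk: "a (h n) (h k) + real n * q (h n) (h k) = l (h k)" using h by simp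
    have "real n * q (h k) (h k) \<le> real k * q (h k) (h k)"
      using that q.nonneg[OF h(1)[of k]] by (intro mult_right_mono) auto
    moreover have "0 \<le> real n * q (\<lambda>x. h n x - h k x) (\<lambda>x. h n x - h k x)"
      using q.nonneg[OF V_diff[OF h(1) h(1)]] by simp
    ultimately show ?thesis
      using nk lh[of n] lh[of k] h(1) sym[OF h(1)[of n] h(1)[of k]] q.sym[OF h(1)[of n] h(1)[of k]]
      by (simp add: form_simps q.form_simps algebra_simps)
  qed
  have dec: "decseq (\<lambda>n. l (h n))"
    using gap nonneg[OF V_diff[OF h(1) h(1)]] by (auto simp: decseq_def intro: order_trans) (smt (verit))
  then have "Cauchy (\<lambda>n. l (h n))"
    using lh0 by (intro convergent_Cauchy Bseq_monoseq_convergent decseq_imp_monoseq)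
       (auto intro!: BseqI'[of _ "l (h 0)"] simp: decseq_def)
  have "\<exists>z\<in>V. (\<lambda>n. a (\<lambda>x. h n x - z x) (\<lambda>x. h n x - z x)) \<longlonglongrightarrow> 0"
  proof (rule complete[OF h(1)])
    fix e :: real assume "0 < e"
    then obtain N where N: "\<And>n k. n \<ge> N \<Longrightarrow> k \<ge> N \<Longrightarrow> \<bar>l (h n) - l (h k)\<bar> < e"
      using \<open>Cauchy _\<close>[unfolded Cauchy_def dist_real_def] by blast
    have "a (\<lambda>x. h n x - h k x) (\<lambda>x. h n x - h k x) < e" if "n \<ge> N" "k \<ge> N" for n k
    proof (cases "n \<le> k")
      case True then show ?thesis using gap[OF True] N[OF that] by simp
    next
      case False
      then have "a (\<lambda>x. h k x - h n x) (\<lambda>x. h k x - h n x) < e" using gap[of k n] N[OF that] by simp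
      then show ?thesis using h(1) sym[OF h(1)[of n] h(1)[of k]] by (simp add: form_simps algebra_simps)
    qed
    then show "\<exists>N. \<forall>n\<ge>N. \<forall>k\<ge>N. a (\<lambda>x. h n x - h k x) (\<lambda>x. h n x - h k x) < e" by blast
  qed
  then obtain z where z: "z \<in> V" "(\<lambda>n. a (\<lambda>x. h n x - z x) (\<lambda>x. h n x - z x)) \<longlonglongrightarrow> 0" by blast
  have q_small: "q (h n) (h n) \<le> l (h 0) / real n" if "n > 0" for n
  proof -
    have "real n * q (h n) (h n) \<le> l (h 0)"
      using lh[of n] nonneg[OF h(1)[of n]] dec by (auto simp: decseq_def dest: spec[of _ 0] spec2[of _ 0 n])
    then show ?thesis using that by (simp add: field_simps)
  qed
  have q0: "(\<lambda>n. q (h n) (h n)) \<longlonglongrightarrow> 0"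
    by (rule Lim_null_comparison[OF _ lim_const_over_n[of "l (h 0)"]])
       (use q_small q.nonneg[OF h(1)] in \<open>auto simp: eventually_sequentially intro!: exI[of _ 1]\<close>)
  have "q z z \<le> 0"
  proof (rule LIMSEQ_le_const)
    have "(\<lambda>n. 2 * a (\<lambda>x. h n x - z x) (\<lambda>x. h n x - z x) + 2 * q (h n) (h n)) \<longlonglongrightarrow> 2 * 0 + 2 * 0"
      by (intro tendsto_intros z q0)
    then show "(\<lambda>n. 2 * a (\<lambda>x. h n x - z x) (\<lambda>x. h n x - z x) + 2 * q (h n) (h n)) \<longlonglongrightarrow> 0" by simp
    have "q z z \<le> 2 * a (\<lambda>x. h n x - z x) (\<lambda>x. h n x - z x) + 2 * q (h n) (h n)" for n
    proof -
      have "q (\<lambda>x. z x - h n x) (\<lambda>x. z x - h n x) \<le> a (\<lambda>x. h n x - z x) (\<lambda>x. h n x - z x)"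
        using q_le[OF V_diff[OF h(1) z(1)], of n] h(1)[of n] z(1) by (simp add: q.form_simps algebra_simps)
      then show ?thesis using q.sum_bound[OF z(1) h(1)[of n]] by simp
    qed
    then show "\<exists>N. \<forall>n\<ge>N. q z z \<le> 2 * a (\<lambda>x. h n x - z x) (\<lambda>x. h n x - z x) + 2 * q (h n) (h n)" by blast
  qed
  then have z0: "a z z = 0" using definite[OF z(1)] q.nonneg[OF z(1)] by simp
  have a0: "(\<lambda>n. a (h n) (h n)) \<longlonglongrightarrow> 0"
  proof (rule Lim_null_comparison)
    show "(\<lambda>n. 2 * a (\<lambda>x. h n x - z x) (\<lambda>x. h n x - z x)) \<longlonglongrightarrow> 0" using tendsto_mult_left[OF z(2), of 2] by simp
    show "\<forall>\<^sub>F n in sequentially. norm (a (h n) (h n)) \<le> 2 * a (\<lambda>x. h n x - z x) (\<lambda>x. h n x - z x)"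
      using sum_bound[OF h(1) z(1)] z0 nonneg[OF h(1)] by simp
  qed
  show ?thesis
  proof (rule tendstoI)
    fix e :: real assume e: "0 < e"
    \<comment> \<open>Split l(F_t) = a(h_n, F_t) + n q(h_n, F_t). A fixed large n makes the first
      term small uniformly in t because F is bounded for a; then t makes the second small because F
      tends to 0 for q.\<close>
    have "(\<lambda>n. sqrt (a (h n) (h n)) * sqrt \<bar>M\<bar>) \<longlonglongrightarrow> sqrt 0 * sqrt \<bar>M\<bar>" by (intro tendsto_intros a0)
    then have "\<forall>\<^sub>F n in sequentially. sqrt (a (h n) (h n)) * sqrt \<bar>M\<bar> < e / 2"
      using e by (intro order_tendstoD(2)) auto
    then obtain n where n: "sqrt (a (h n) (h n)) * sqrt \<bar>M\<bar> < e / 2"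
      using eventually_happens'[OF sequentially_bot] by blast
    have "((\<lambda>t. real n * (sqrt (q (h n) (h n)) * sqrt (q (F t) (F t)))) \<longlongrightarrow> real n * (sqrt (q (h n) (h n)) * sqrt 0)) G"
      by (intro tendsto_intros F0)
    then have "\<forall>\<^sub>F t in G. real n * (sqrt (q (h n) (h n)) * sqrt (q (F t) (F t))) < e / 2"
      using e by (intro order_tendstoD(2)) auto
    with F show "\<forall>\<^sub>F t in G. dist (l (F t)) 0 < e"
    proof eventually_elim
      case (elim t)
      then have Ft: "F t \<in> V" by simp
      have "\<bar>a (h n) (F t)\<bar> \<le> sqrt (a (h n) (h n)) * sqrt \<bar>M\<bar>"
        using elim by (intro order_trans[OF cauchy_schwarz[OF h(1) Ft]] mult_left_mono) (auto simp: nonneg[OF h(1)])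
      moreover have "\<bar>real n * q (h n) (F t)\<bar> \<le> real n * (sqrt (q (h n) (h n)) * sqrt (q (F t) (F t)))"
        using q.cauchy_schwarz[OF h(1)[of n] Ft] by (simp add: abs_mult mult_left_mono)
      ultimately show ?case using h(2)[OF Ft, of n] n elim(2) unfolding dist_real_def by linarith
    qed
  qed
qed

end

text \<open>If \<open>T g\<close> represents \<open>a \<cdot> g\<close> for the symmetric part \<open>s\<close>, then \<open>s (T f) (T g)\<close> is an equivalent inner product,
  and the Riesz representation for it inverts \<open>T\<close>.\<close>
theorem lax_milgram:
  assumes psd: "psd_form V a" and bound: "\<And>f g. f \<in> V \<Longrightarrow> g \<in> V \<Longrightarrow> \<bar>a f g\<bar> \<le> K * sqrt (a f f) * sqrt (a g g)"
    and hil: "hilbert_form V (\<lambda>f g. (a f g + a g f) / 2)"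
    and l_add: "\<And>f g. f \<in> V \<Longrightarrow> g \<in> V \<Longrightarrow> l (\<lambda>x. f x + g x) = l f + l g"
    and l_scale: "\<And>f c. f \<in> V \<Longrightarrow> l (\<lambda>x. c * f x) = c * l f"
    and l_bound: "\<And>f. f \<in> V \<Longrightarrow> \<bar>l f\<bar> \<le> C * sqrt (a f f)"
  shows "\<exists>g\<in>V. \<forall>w\<in>V. a w g = l w"
proof -
  interpret a: psd_form V a by fact
  define s where "s f g = (a f g + a g f) / 2" for f g
  interpret s: hilbert_form V s using hil by (simp add: s_def[abs_def])
  have saa: "s f f = a f f" for f by (simp add: s_def)
  have "\<exists>T\<in>V. \<forall>w\<in>V. s T w = a w g" if g: "g \<in> V" for g
  proof (rule s.riesz_representation)
    show "\<bar>a f g\<bar> \<le> (K * sqrt (a g g)) * sqrt (s f f)" if "f \<in> V" for f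
      using bound[OF that g] by (simp add: saa algebra_simps)
  qed (use g in \<open>auto simp: a.form_simps\<close>)
  then obtain T where T: "\<And>g. g \<in> V \<Longrightarrow> T g \<in> V" "\<And>g w. g \<in> V \<Longrightarrow> w \<in> V \<Longrightarrow> s (T g) w = a w g" by metis
  obtain b where b: "b \<in> V" "\<And>w. w \<in> V \<Longrightarrow> s b w = l w"
    using s.riesz_representation[OF l_add l_scale l_bound[folded saa]] by metis
  define r where "r f g = s (T f) (T g)" for f g
  have r_eq: "r f g = a (T g) f" "r f g = a (T f) g" if "f \<in> V" "g \<in> V" for f g
    using T that s.sym[of "T f" "T g"] by (auto simp: r_def)
  have r_nonneg: "0 \<le> r f f" if "f \<in> V" for f using T(1)[OF that] s.nonneg by (simp add: r_def)
  have "inner_form V r"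
  proof
    fix f g h assume fgh: "f \<in> V" "g \<in> V" "h \<in> V"
    show "r (\<lambda>x. f x + g x) h = r f h + r g h" using fgh T(1) by (simp add: r_eq(1) a.form_simps)
    show "r h (\<lambda>x. f x + g x) = r h f + r h g" using fgh T(1) by (simp add: r_eq(2) a.form_simps)
  next
    fix f h c assume fh: "f \<in> V" "h \<in> V"
    show "r (\<lambda>x. c * f x) h = c * r f h" using fh T(1) by (simp add: r_eq(1) a.form_simps)
    show "r h (\<lambda>x. c * f x) = c * r h f" using fh T(1) by (simp add: r_eq(2) a.form_simps)
  qed (use r_nonneg T s.sym in \<open>auto simp: r_def s.V_ops\<close>)
  \<comment> \<open>Cauchy-Schwarz for \<open>s f f = s (T f) f\<close>; together with the upper
    bound below, this makes r equivalent to s, hence complete.\<close>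
  moreover have "s f f \<le> r f f" if f: "f \<in> V" for f
  proof -
    have "s f f = s (T f) f" using T(2)[OF f f] saa by simp
    then have "(s f f)\<^sup>2 \<le> r f f * s f f"
      using s.cauchy_schwarz_square[OF T(1)[OF f] f] by (simp add: r_def)
    then show ?thesis using s.nonneg[OF f] r_nonneg[OF f]
      by (cases "s f f = 0") (auto simp: power2_eq_square)
  qed
  moreover have "r f f \<le> K\<^sup>2 * s f f" if f: "f \<in> V" for f
  proof -
    have "r f f \<le> K * sqrt (r f f) * sqrt (s f f)"
      using bound[OF T(1)[OF f] f] r_eq[OF f f] T(1)[OF f] by (auto simp: r_def saa)
    then have "(r f f)\<^sup>2 \<le> (K * sqrt (r f f) * sqrt (s f f))\<^sup>2" using r_nonneg[OF f] by (intro power_mono)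
    also have "\<dots> = r f f * (K\<^sup>2 * s f f)" using r_nonneg[OF f] s.nonneg[OF f] by (simp add: power_mult_distrib algebra_simps)
    finally show ?thesis using r_nonneg[OF f] s.nonneg[OF f]
      by (cases "r f f = 0") (auto simp: power2_eq_square)
  qed
  ultimately interpret r: hilbert_form V r by (rule s.equivalent_hilbert_form)
  \<comment> \<open>Since \<open>r g w = a (T g) w\<close>, solving this equation says that
    \<open>T g\<close> agrees with the representer \<open>b\<close> of \<open>l\<close> up to a null
    vector, which inverts T at \<open>b\<close>.\<close>
  have "\<exists>g\<in>V. \<forall>w\<in>V. r g w = a b w"
  proof (rule r.riesz_representation)
    show "\<bar>a b f\<bar> \<le> sqrt (s b b) * sqrt (r f f)" if f: "f \<in> V" for f
      using s.cauchy_schwarz[OF T(1)[OF f] b(1)] T(2)[OF f b(1)] by (simp add: r_def mult.commute)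
  qed (use b in \<open>auto simp: a.form_simps\<close>)
  then obtain g where g: "g \<in> V" "\<And>w. w \<in> V \<Longrightarrow> r g w = a b w" by blast
  let ?d = "\<lambda>x. T g x - b x"
  have d: "?d \<in> V" using T(1)[OF g(1)] b(1) by (rule s.V_diff)
  have "a ?d w = 0" if "w \<in> V" for w
    using r_eq(2)[OF g(1) that] g(2)[OF that] T(1)[OF g(1)] b(1) that by (simp add: a.form_simps)
  then have d0: "s ?d ?d = 0" using d saa by simp
  have "a w g = l w" if w: "w \<in> V" for w
  proof -
    have "(s ?d w)\<^sup>2 \<le> 0" using s.cauchy_schwarz_square[OF d w] d0 by simp
    then have "s (T g) w = s b w" using T(1)[OF g(1)] b(1) w by (simp add: s.form_simps)
    then show ?thesis using T(2)[OF g(1) w] b(2)[OF w] by simp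
  qed
  with g(1) show ?thesis by blast
qed

section \<open>The resolvent and the measures of the approximating forms\<close>

lemma cutoff_algebra_C0:
  assumes lc: "locally_compact_space (euclidean :: 'a::{metric_space, second_countable_topology} topology)"
  shows "cutoff_algebra (C0 :: ('a \<Rightarrow> real) set)"
proof
  fix f g :: "'a \<Rightarrow> real" and c
  assume f: "f \<in> C0" and g: "g \<in> C0"
  then show "(\<lambda>x. f x + g x) \<in> C0" "(\<lambda>x. f x * g x) \<in> C0"
    unfolding C0_eq_Cc by (auto intro: Cc_add Cc_mult Cc_cont)
next
  fix f :: "'a \<Rightarrow> real" and c
  assume f: "f \<in> C0"
  then show "(\<lambda>x. c * f x) \<in> C0" unfolding C0_eq_Cc by (rule Cc_scale)
next
  fix K U :: "'a set" assume "compact K" "open U" "K \<subseteq> U"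
  then show "\<exists>a\<in>C0. fsupp a \<subseteq> U \<and> (\<forall>x. 0 \<le> a x \<and> a x \<le> 1) \<and> (\<exists>V. open V \<and> K \<subseteq> V \<and> (\<forall>x\<in>V. a x = 1))"
    using Cc_cutoff[OF lc, of K U] unfolding C0_eq_Cc by (metis Cc_mono Cc_subset subset_UNIV)
qed (use lc in auto)

lemma L2_mult_integrable:
  assumes "f \<in> L2 m" "g \<in> L2 m" shows "integrable m (\<lambda>x. f x * g x)"
proof (rule Bochner_Integration.integrable_bound)
  show "integrable m (\<lambda>x. (f x)\<^sup>2 + (g x)\<^sup>2)" using assms by (auto simp: L2_def)
  show "(\<lambda>x. f x * g x) \<in> borel_measurable m" using assms by (auto simp: L2_def)
  have "\<bar>f x * g x\<bar> \<le> (f x)\<^sup>2 + (g x)\<^sup>2" for x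
    using sum_squares_bound[of "\<bar>f x\<bar>" "\<bar>g x\<bar>"] mult_nonneg_nonneg[OF abs_ge_zero abs_ge_zero, of "f x" "g x"]
    unfolding abs_mult power2_abs by linarith
  then show "AE x in m. norm (f x * g x) \<le> norm ((f x)\<^sup>2 + (g x)\<^sup>2)" by simp
qed

lemma inner_form_L2: "inner_form (L2 m) (ip m)"
proof
  fix f g h assume fgh: "f \<in> L2 m" "g \<in> L2 m" "h \<in> L2 m"
  note i = L2_mult_integrable
  show "ip m (\<lambda>x. f x + g x) h = ip m f h + ip m g h" "ip m h (\<lambda>x. f x + g x) = ip m h f + ip m h g"
    unfolding ip_def using i[OF fgh(1,3)] i[OF fgh(2,3)] i[OF fgh(3,1)] i[OF fgh(3,2)]
    by (simp_all add: distrib_left distrib_right)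
next
  fix f g assume fg: "f \<in> L2 m" "g \<in> L2 m"
  have "integrable m (\<lambda>x. (f x)\<^sup>2 + 2 * (f x * g x) + (g x)\<^sup>2)"
    using fg L2_mult_integrable[OF fg] by (auto simp: L2_def)
  then show "(\<lambda>x. f x + g x) \<in> L2 m"
    using fg by (auto simp: L2_def power2_sum algebra_simps)
next
  fix f and c :: real assume f: "f \<in> L2 m"
  then show "(\<lambda>x. c * f x) \<in> L2 m" by (auto simp: L2_def power_mult_distrib)
next
  fix f h and c :: real
  show "ip m (\<lambda>x. c * f x) h = c * ip m f h" "ip m h (\<lambda>x. c * f x) = c * ip m h f"
    unfolding ip_def by (simp_all add: mult.assoc mult.left_commute)
qed (auto simp: ip_def mult.commute)

lemma C0_L2:
  fixes f :: "'a::t2_space \<Rightarrow> real"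
  assumes "radon m" "f \<in> C0" shows "f \<in> L2 m"
proof -
  have "(\<lambda>x. f x * f x) \<in> Cc UNIV"

    using Cc_mult[OF assms(2)[unfolded C0_eq_Cc] Cc_cont[OF assms(2)[unfolded C0_eq_Cc]]] .
  then have "integrable m (\<lambda>x. f x * f x)" using assms by (auto simp flip: radon_on_UNIV intro: Cc_integrable)
  moreover have "f \<in> borel_measurable m" using assms by (auto simp: radon_def C0_eq_Cc intro: Cc_measurable)
  ultimately show ?thesis by (simp add: L2_def power2_eq_square)
qed

lemma tensor_span_integral:
  fixes T :: "(('a::metric_space \<Rightarrow> real) \<times> ('a \<Rightarrow> real)) set"
  assumes \<nu>: "radon_on W \<nu>" and T: "\<And>u v. (u, v) \<in> T \<Longrightarrow> tensor u v \<in> Cc W \<and> (\<integral>p. tensor u v p \<partial>\<nu>) = B u v"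
    and "(f, c) \<in> tensor_span T B"
  shows "f \<in> Cc W \<and> (\<integral>p. f p \<partial>\<nu>) = c"
  using assms(3)
proof induction
  case (tensor_span_add f c g d)
  then show ?case using Cc_integrable[OF \<nu>] by (auto intro: Cc_add)
qed (use T in auto)

text \<open>The uniqueness half of \<open>THE\<close>, for \<sigma>-hat with W the whole product and
  for J with W the complement of the diagonal.\<close>

lemma radon_tensor_unique:
  fixes A :: "('a::{metric_space, second_countable_topology} \<Rightarrow> real) set"
  assumes A: "cutoff_algebra A" and W: "open W" and M: "radon_on W M" and N: "radon_on W N"
    and eq: "\<And>u v. u \<in> A \<Longrightarrow> v \<in> A \<Longrightarrow> fsupp u \<times> fsupp v \<subseteq> W \<Longrightarrow> (\<integral>p. tensor u v p \<partial>M) = (\<integral>p. tensor u v p \<partial>N)"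
  shows "M = N"
proof -
  interpret cutoff_algebra A by fact
  let ?B = "\<lambda>u v. \<integral>p. tensor u v p \<partial>M"
  show ?thesis
  proof (rule radon_on_eq_if_dense[OF locally_compact_space_prod_euclidean[OF lc] W M N tensor_span_dense[OF W, of ?B]])
    fix f assume "f \<in> fst ` tensor_span (supported_pairs A W) ?B"
    then obtain c where c: "(f, c) \<in> tensor_span (supported_pairs A W) ?B" by auto
    have T: "tensor u v \<in> Cc W" if "(u, v) \<in> supported_pairs A W" for u v
      using that A_C0 by (intro tensor_Cc) (auto simp: supported_pairs_def)
    show "(\<integral>x. f x \<partial>M) = (\<integral>x. f x \<partial>N)"
      using tensor_span_integral[OF M _ c] tensor_span_integral[OF N _ c] T eq by (auto simp: supported_pairs_def)
  qed
qed

text \<open>An explicit finite sum is needed to fix x and regard the function as a linear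
  combination in y.\<close>

lemma tensor_span_list:
  assumes "(f, c) \<in> tensor_span T B"
  shows "\<exists>xs. set xs \<subseteq> T \<and> f = (\<lambda>p. \<Sum>(u, v)\<leftarrow>xs. tensor u v p) \<and> c = (\<Sum>(u, v)\<leftarrow>xs. B u v)"
  using assms
proof induction
  case (tensor_span_base u v)
  then show ?case by (intro exI[of _ "[(u, v)]"]) auto
next
  case (tensor_span_add f c g d)
  then obtain xs ys where "set xs \<subseteq> T" "f = (\<lambda>p. \<Sum>(u, v)\<leftarrow>xs. tensor u v p)" "c = (\<Sum>(u, v)\<leftarrow>xs. B u v)"
    "set ys \<subseteq> T" "g = (\<lambda>p. \<Sum>(u, v)\<leftarrow>ys. tensor u v p)" "d = (\<Sum>(u, v)\<leftarrow>ys. B u v)" by blast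
  then show ?case by (intro exI[of _ "xs @ ys"]) auto
qed

text \<open>Coefficients are approximated by rational ones, so that the countably many almost-sure
  inequalities in the hypothesis suffice.\<close>
lemma nonneg_combination_from_rational:
  fixes a h :: "nat \<Rightarrow> real" and v :: "nat \<Rightarrow> 'a::t2_space \<Rightarrow> real"
  assumes v: "\<And>i. i < n \<Longrightarrow> v i \<in> C0" and pos: "\<And>y. 0 \<le> (\<Sum>i<n. a i * v i y)"
    and rat: "\<And>(q::rat list) (r::rat). 0 < r \<Longrightarrow> (\<And>y. - of_rat r \<le> (\<Sum>i<n. of_rat (q ! i) * v i y)) \<Longrightarrow>
      - of_rat r \<le> (\<Sum>i<n. of_rat (q ! i) * h i)"
  shows "0 \<le> (\<Sum>i<n. a i * h i)"
proof -
  have "\<forall>i<n. \<exists>B>0. \<forall>y. \<bar>v i y\<bar> \<le> B"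
    using v Cc_bounded unfolding C0_eq_Cc by metis
  then obtain B where B: "\<And>i. i < n \<Longrightarrow> 0 < B i" "\<And>i y. i < n \<Longrightarrow> \<bar>v i y\<bar> \<le> B i" by metis
  define b where "b = 1 + (\<Sum>i<n. B i)"
  define k where "k = (\<Sum>i<n. \<bar>h i\<bar>)"
  have b: "0 < b" unfolding b_def using B(1) by (intro add_pos_nonneg sum_nonneg) (auto intro: less_imp_le)
  have k: "0 \<le> k" by (auto simp: k_def intro: sum_nonneg)
  have "- e \<le> (\<Sum>i<n. a i * h i)" if e: "0 < e" for e
  proof -
    \<comment> \<open>The final error is at most \<open>2 * d * b\<close> from the slack r plus
      \<open>d * k\<close> from replacing coefficients in front of \<open>h i\<close>; this d makes
      the sum equal to e.\<close>
    define d where "d = e / (2 * b + k)"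
    have bk: "0 < 2 * b + k" using b k by simp
    then have "d * (2 * b + k) = e" by (simp add: d_def)
    then have d: "2 * d * b + d * k = e" "0 < d" using e bk by (simp add: algebra_simps, simp add: d_def)
    have "\<exists>q::rat. \<bar>of_rat q - a i\<bar> < d" for i
    proof -
      obtain q :: rat where "a i < of_rat q" "of_rat q < a i + d"
        using of_rat_dense[of "a i" "a i + d"] d(2) by auto
      then show ?thesis by (intro exI[of _ q]) (simp add: abs_if)
    qed
    then obtain q :: "nat \<Rightarrow> rat" where q: "\<And>i. \<bar>of_rat (q i) - a i\<bar> < d" by metis
    have near: "\<bar>(\<Sum>i<n. of_rat (q i) * w i) - (\<Sum>i<n. a i * w i)\<bar> \<le> d * (\<Sum>i<n. \<bar>w i\<bar>)" for w
    proof -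
      have "(\<Sum>i<n. of_rat (q i) * w i) - (\<Sum>i<n. a i * w i) = (\<Sum>i<n. (of_rat (q i) - a i) * w i)"
        by (simp add: sum_subtractf left_diff_distrib)
      also have "\<bar>\<dots>\<bar> \<le> (\<Sum>i<n. \<bar>(of_rat (q i) - a i) * w i\<bar>)" by (rule sum_abs)
      also have "\<dots> \<le> (\<Sum>i<n. d * \<bar>w i\<bar>)" unfolding abs_mult
        by (intro sum_mono mult_right_mono) (auto intro: less_imp_le[OF q])
      finally show ?thesis by (simp add: sum_distrib_left)
    qed
    define ql where "ql = map q [0..<n]"
    have ql: "(\<Sum>i<n. of_rat (ql ! i) * w i) = (\<Sum>i<n. of_rat (q i) * w i)" for w :: "nat \<Rightarrow> real"
      by (rule sum.cong) (auto simp: ql_def)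
    \<comment> \<open>\<open>d * b\<close> bounds the effect of the rational coefficients on the
      nonnegative combination of the \<open>v i\<close>, so r is a valid positive slack.\<close>
    obtain r :: rat where r: "d * b < of_rat r" "of_rat r < 2 * d * b"
      using of_rat_dense[of "d * b" "2 * d * b"] d(2) b by auto
    have "0 < real_of_rat r" using r(1) d(2) b mult_pos_pos[of d b] by linarith
    then have r0: "0 < r" by simp
    have "- of_rat r \<le> (\<Sum>i<n. of_rat (ql ! i) * v i y)" for y
    proof -
      have "(\<Sum>i<n. \<bar>v i y\<bar>) \<le> b" unfolding b_def using sum_mono[of "{..<n}" "\<lambda>i. \<bar>v i y\<bar>" B] B(2) by auto
      then have "d * (\<Sum>i<n. \<bar>v i y\<bar>) \<le> d * b" using d(2) by (intro mult_left_mono) auto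
      then show ?thesis using near[of "\<lambda>i. v i y"] pos[of y] r(1) unfolding ql by linarith
    qed
    from rat[OF r0 this] have "- of_rat r \<le> (\<Sum>i<n. of_rat (q i) * h i)" by (simp add: ql)
    then show ?thesis using near[of h] r(2) d(1,2) by (simp add: k_def)
  qed
  then have "0 \<le> (\<Sum>i<n. a i * h i) + e" if "0 < e" for e
  proof -
    have "- e \<le> (\<Sum>i<n. a i * h i)" using \<open>\<And>e. 0 < e \<Longrightarrow> - e \<le> (\<Sum>i<n. a i * h i)\<close> that .
    then show ?thesis by linarith
  qed
  then show ?thesis by (rule field_le_epsilon)
qed

text \<open>The standing assumption is split: its integrability half speaks of \<open>Jm\<close>,
  which is under control only after J and K have been constructed here. It joins in
  \<open>standing_setting\<close>.\<close>

locale semi_dirichlet_space =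
  fixes m :: "'a::{metric_space, second_countable_topology} measure"
    and \<E> :: "('a \<Rightarrow> real) \<Rightarrow> ('a \<Rightarrow> real) \<Rightarrow> real" and D :: "('a \<Rightarrow> real) set"
  assumes loc_comp: "locally_compact_space (euclidean :: 'a topology)"
    and radon_m: "radon m"
    and regular: "regular_semi_dirichlet m \<E> D"
    and algebra: "f \<in> C0 \<inter> D \<Longrightarrow> g \<in> C0 \<inter> D \<Longrightarrow> (\<lambda>x. f x * g x) \<in> C0 \<inter> D"
begin

section \<open>Bilinearity, sector condition and completeness of the form\<close>

lemma closed_form: "coercive_closed_form m \<E> D"
  using regular by (simp add: regular_semi_dirichlet_def semi_dirichlet_def)

lemmas closed_form_rest = closed_form[unfolded coercive_closed_form_def, THEN conjunct2, THEN conjunct2]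

lemmas closed_form_tail = closed_form_rest[THEN conjunct2, THEN conjunct2, THEN conjunct2, THEN conjunct2, THEN conjunct2]

lemma D_L2: "D \<subseteq> L2 m"
  and D_add: "f \<in> D \<Longrightarrow> g \<in> D \<Longrightarrow> (\<lambda>x. f x + g x) \<in> D"
  and D_scale: "f \<in> D \<Longrightarrow> (\<lambda>x. c * f x) \<in> D"
  and E_add1: "f \<in> D \<Longrightarrow> g \<in> D \<Longrightarrow> h \<in> D \<Longrightarrow> \<E> (\<lambda>x. f x + g x) h = \<E> f h + \<E> g h"
  and E_add2: "f \<in> D \<Longrightarrow> g \<in> D \<Longrightarrow> h \<in> D \<Longrightarrow> \<E> h (\<lambda>x. f x + g x) = \<E> h f + \<E> h g"
  and E_scale1: "f \<in> D \<Longrightarrow> h \<in> D \<Longrightarrow> \<E> (\<lambda>x. c * f x) h = c * \<E> f h"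
  and E_scale2: "f \<in> D \<Longrightarrow> h \<in> D \<Longrightarrow> \<E> h (\<lambda>x. c * f x) = c * \<E> h f"
  and E_nonneg: "f \<in> D \<Longrightarrow> 0 \<le> \<E> f f"
  using closed_form[unfolded coercive_closed_form_def, THEN conjunct1]
    closed_form_rest[THEN conjunct2, THEN conjunct1]
    closed_form_rest[THEN conjunct2, THEN conjunct2, THEN conjunct1]
    closed_form_rest[THEN conjunct2, THEN conjunct2, THEN conjunct2, THEN conjunct1]
    closed_form_rest[THEN conjunct2, THEN conjunct2, THEN conjunct2, THEN conjunct2, THEN conjunct1]
    closed_form_rest[THEN conjunct2, THEN conjunct2, THEN conjunct2, THEN conjunct2, THEN conjunct2, THEN conjunct2, THEN conjunct1]
  by simp_all

lemma E_AE_zero: "f \<in> D \<Longrightarrow> AE x in m. f x = 0 \<Longrightarrow> \<E> f f = 0"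
proof -
  assume f: "f \<in> D" and z: "AE x in m. f x = 0"
  have z0: "(\<lambda>x. 0 * f x) \<in> D" using D_scale[OF f] .
  have AE: "AE x in m. f x = 0 * f x" using z by simp
  have "\<E> f f = \<E> (\<lambda>x. 0 * f x) f"
    using closed_form_rest[THEN conjunct1, rule_format, of f "\<lambda>x. 0 * f x" f] f z0 AE by simp
  then show ?thesis using E_scale1[OF f f, of 0] by simp
qed

lemma clip:
  assumes "f \<in> D"
  shows "(\<lambda>x. min (max (f x) 0) 1) \<in> D" "0 \<le> \<E> (\<lambda>x. min (max (f x) 0) 1) (\<lambda>x. f x - min (max (f x) 0) 1)"
  using regular assms by (auto simp: regular_semi_dirichlet_def semi_dirichlet_def)

lemma E_psd: "psd_form D \<E>"
  by unfold_locales (auto intro: D_add D_scale E_add1 E_add2 E_scale1 E_scale2 E_nonneg)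

sublocale E: psd_form D \<E> by (rule E_psd)
sublocale L: inner_form "L2 m" "ip m" by (rule inner_form_L2)

lemma DL: "f \<in> D \<Longrightarrow> f \<in> L2 m" using D_L2 by auto

text \<open>The constant of the sector condition, chosen nonnegative (the absolute value of any
  admissible constant) so that inequalities may be multiplied by it.\<close>

definition form_bound :: real where
  "form_bound = (SOME K. 0 \<le> K \<and> (\<forall>f\<in>D. \<forall>g\<in>D. \<bar>E1 m \<E> f g\<bar> \<le> K * (sqrt (E1 m \<E> f f) * sqrt (E1 m \<E> g g))))"

lemma E1_nonneg: "f \<in> D \<Longrightarrow> 0 \<le> E1 m \<E> f f"
  using E_nonneg L.nonneg DL by (simp add: E1_def)

lemma form_bound: "0 \<le> form_bound"
  "f \<in> D \<Longrightarrow> g \<in> D \<Longrightarrow> \<bar>E1 m \<E> f g\<bar> \<le> form_bound * (sqrt (E1 m \<E> f f) * sqrt (E1 m \<E> g g))"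
proof -
  have "\<exists>K. \<forall>f \<in> D. \<forall>g \<in> D. \<bar>E1 m \<E> f g\<bar> \<le> K * sqrt (E1 m \<E> f f) * sqrt (E1 m \<E> g g)"
    by (rule closed_form_tail[THEN conjunct2, THEN conjunct2, THEN conjunct1])
  then obtain K where K: "\<And>f g. f \<in> D \<Longrightarrow> g \<in> D \<Longrightarrow> \<bar>E1 m \<E> f g\<bar> \<le> K * sqrt (E1 m \<E> f f) * sqrt (E1 m \<E> g g)" by blast
  have "\<bar>E1 m \<E> f g\<bar> \<le> \<bar>K\<bar> * (sqrt (E1 m \<E> f f) * sqrt (E1 m \<E> g g))" if "f \<in> D" "g \<in> D" for f g
  proof -
    have "K * (sqrt (E1 m \<E> f f) * sqrt (E1 m \<E> g g)) \<le> \<bar>K\<bar> * (sqrt (E1 m \<E> f f) * sqrt (E1 m \<E> g g))"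
      using E1_nonneg that by (intro mult_right_mono) auto
    then show ?thesis using K[OF that] by (simp add: mult.assoc)
  qed
  then have "\<exists>K. 0 \<le> K \<and> (\<forall>f\<in>D. \<forall>g\<in>D. \<bar>E1 m \<E> f g\<bar> \<le> K * (sqrt (E1 m \<E> f f) * sqrt (E1 m \<E> g g)))"
    by (intro exI[of _ "\<bar>K\<bar>"]) auto
  from someI_ex[OF this, folded form_bound_def]
  show "0 \<le> form_bound" "f \<in> D \<Longrightarrow> g \<in> D \<Longrightarrow> \<bar>E1 m \<E> f g\<bar> \<le> form_bound * (sqrt (E1 m \<E> f f) * sqrt (E1 m \<E> g g))"
    by auto
qed

lemma E_bound:
  assumes "f \<in> D" "g \<in> D"
  shows "\<bar>\<E> f g\<bar> \<le> (form_bound + 1) * (sqrt (E1 m \<E> f f) * sqrt (E1 m \<E> g g))"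
proof -
  have "\<bar>ip m f g\<bar> \<le> sqrt (ip m f f) * sqrt (ip m g g)" using assms DL by (intro L.cauchy_schwarz)
  also have "\<dots> \<le> sqrt (E1 m \<E> f f) * sqrt (E1 m \<E> g g)"
    using assms E_nonneg L.nonneg[OF DL] by (intro mult_mono real_sqrt_le_mono) (auto simp: E1_def)
  finally show ?thesis using form_bound(2)[OF assms] by (simp add: E1_def algebra_simps abs_le_iff)
qed

abbreviation "sym1 f g \<equiv> (E1 m \<E> f g + E1 m \<E> g f) / 2"

lemma hilbert_E1: "hilbert_form D sym1"
proof -
  have i: "inner_form D sym1"
    by unfold_locales
       (use E_nonneg L.nonneg[OF DL] in \<open>auto simp: E1_def E.form_simps L.form_simps DL field_simps\<close>)
  interpret inner_form D sym1 by (rule i)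
  show ?thesis
  proof
    fix h :: "nat \<Rightarrow> 'a \<Rightarrow> real"
    assume "\<And>n. h n \<in> D" "\<And>e. 0 < e \<Longrightarrow> \<exists>N. \<forall>n\<ge>N. \<forall>k\<ge>N. sym1 (\<lambda>x. h n x - h k x) (\<lambda>x. h n x - h k x) < e"
    then show "\<exists>f\<in>D. (\<lambda>n. sym1 (\<lambda>x. h n x - f x) (\<lambda>x. h n x - f x)) \<longlonglongrightarrow> 0"
      using closed_form_tail[THEN conjunct2, THEN conjunct2, THEN conjunct2, rule_format, of h] by simp
  next
    have "(\<lambda>x. 0) \<in> L2 m" by (simp add: L2_def)
    then have "\<exists>g\<in>D. ip m (\<lambda>x. 0 - g x) (\<lambda>x. 0 - g x) < 1"
      by (rule closed_form_tail[THEN conjunct1, rule_format]) simp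
    then show "D \<noteq> {}" by auto
  qed
qed

sublocale S: hilbert_form D sym1 by (rule hilbert_E1)

section \<open>Resolvent, co-resolvent and the sub-Markov property\<close>

definition E_beta :: "real \<Rightarrow> ('a \<Rightarrow> real) \<Rightarrow> ('a \<Rightarrow> real) \<Rightarrow> real" where
  "E_beta \<beta> f g = \<E> f g + \<beta> * ip m f g"

text \<open>For \<beta> \<ge> 1 the form \<open>E_beta \<beta>\<close> lies between
  \<open>E1\<close> and \<beta> times \<open>E1\<close> on the diagonal, so completeness and the
  sector condition carry over. Exchanging the two arguments in Lax-Milgram gives the second
  equation. All later limits are for \<beta> to infinity, so this range is enough.\<close>

lemma resolvent_equation_solvable:
  assumes \<beta>: "1 \<le> \<beta>" and f: "f \<in> L2 m"
  shows "\<exists>g\<in>D. \<forall>w\<in>D. E_beta \<beta> w g = ip m f w" "\<exists>g\<in>D. \<forall>w\<in>D. E_beta \<beta> g w = ip m f w"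
proof -
  have psd: "psd_form D (E_beta \<beta>)" "psd_form D (\<lambda>f g. E_beta \<beta> g f)"
    using E_nonneg L.nonneg[OF DL] \<beta>
    by (unfold_locales; auto simp: E_beta_def E.form_simps L.form_simps DL algebra_simps)+
  have inner: "inner_form D (\<lambda>f g. (E_beta \<beta> f g + E_beta \<beta> g f) / 2)"
    by unfold_locales
       (use E_nonneg L.nonneg[OF DL] \<beta> in \<open>auto simp: E_beta_def E.form_simps L.form_simps DL field_simps
          intro!: add_nonneg_nonneg mult_nonneg_nonneg\<close>)
  have lower: "E1 m \<E> f f \<le> E_beta \<beta> f f" and upper: "E_beta \<beta> f f \<le> \<beta> * E1 m \<E> f f" if "f \<in> D" for f
    using \<beta> L.nonneg[OF DL[OF that]] E_nonneg[OF that] mult_right_mono[of 1 \<beta> "ip m f f"] mult_right_mono[of 1 \<beta> "\<E> f f"]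
    by (auto simp: E1_def E_beta_def algebra_simps)
  have hil: "hilbert_form D (\<lambda>f g. (E_beta \<beta> f g + E_beta \<beta> g f) / 2)"
    by (rule S.equivalent_hilbert_form[OF inner, of \<beta>]) (use lower upper in auto)
  have ip_le: "sqrt (ip m f f) \<le> sqrt (E_beta \<beta> f f)" if "f \<in> D" for f
    using lower[OF that] E_nonneg[OF that] by (simp add: E1_def)
  have bound: "\<bar>E_beta \<beta> f g\<bar> \<le> (form_bound + 1 + \<beta>) * sqrt (E_beta \<beta> f f) * sqrt (E_beta \<beta> g g)" if "f \<in> D" "g \<in> D" for f g
  proof -
    have "\<bar>\<E> f g\<bar> \<le> (form_bound + 1) * (sqrt (E_beta \<beta> f f) * sqrt (E_beta \<beta> g g))"
      using lower that E1_nonneg psd_form.nonneg[OF psd(1)] form_bound(1)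
      by (intro order_trans[OF E_bound[OF that]] mult_left_mono mult_mono) auto
    moreover have "\<bar>ip m f g\<bar> \<le> sqrt (E_beta \<beta> f f) * sqrt (E_beta \<beta> g g)"
      using that ip_le L.nonneg[OF DL] psd_form.nonneg[OF psd(1)]
      by (intro order_trans[OF L.cauchy_schwarz[OF DL DL]] mult_mono) auto
    then have "\<bar>\<beta> * ip m f g\<bar> \<le> \<beta> * (sqrt (E_beta \<beta> f f) * sqrt (E_beta \<beta> g g))"
      using \<beta> by (simp add: abs_mult mult_left_mono)
    ultimately show ?thesis unfolding E_beta_def[of \<beta> f g] by (simp add: algebra_simps abs_le_iff)
  qed
  have l: "\<bar>ip m f w\<bar> \<le> sqrt (ip m f f) * sqrt (E_beta \<beta> w w)" if "w \<in> D" for w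
    using ip_le[OF that] L.nonneg[OF f] that
    by (intro order_trans[OF L.cauchy_schwarz[OF f DL]] mult_left_mono) auto
  show "\<exists>g\<in>D. \<forall>w\<in>D. E_beta \<beta> w g = ip m f w"
    by (rule lax_milgram[OF psd(1) bound hil _ _ l]) (use f in \<open>auto simp: L.form_simps DL\<close>)
  show "\<exists>g\<in>D. \<forall>w\<in>D. E_beta \<beta> g w = ip m f w"
  proof (rule lax_milgram[OF psd(2) _ _ _ _ l])
    show "\<bar>E_beta \<beta> g f\<bar> \<le> (form_bound + 1 + \<beta>) * sqrt (E_beta \<beta> f f) * sqrt (E_beta \<beta> g g)" if "f \<in> D" "g \<in> D" for f g
      using bound[OF that(2,1)] by (simp add: algebra_simps)
    show "hilbert_form D (\<lambda>f g. (E_beta \<beta> g f + E_beta \<beta> f g) / 2)" using hil by (simp add: add.commute)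
  qed (use f in \<open>auto simp: L.form_simps DL\<close>)
qed

lemma Ghat:
  assumes "1 \<le> \<beta>" "f \<in> L2 m"
  shows "Ghat m \<E> D \<beta> f \<in> D" "w \<in> D \<Longrightarrow> \<E> w (Ghat m \<E> D \<beta> f) + \<beta> * ip m w (Ghat m \<E> D \<beta> f) = ip m f w"
proof -
  have "\<exists>g. g \<in> D \<and> (\<forall>w \<in> D. \<E> w g + \<beta> * ip m w g = ip m f w)"
    using resolvent_equation_solvable(1)[OF assms] by (auto simp: E_beta_def)
  from someI_ex[OF this, folded Ghat_def]
  show "Ghat m \<E> D \<beta> f \<in> D" "w \<in> D \<Longrightarrow> \<E> w (Ghat m \<E> D \<beta> f) + \<beta> * ip m w (Ghat m \<E> D \<beta> f) = ip m f w"
    by auto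
qed

text \<open>The relation \<open>g = \<beta> G\<^sub>\<beta> f\<close>, stated for an arbitrary version of the resolvent.\<close>
definition is_resolvent :: "real \<Rightarrow> ('a \<Rightarrow> real) \<Rightarrow> ('a \<Rightarrow> real) \<Rightarrow> bool" where
  "is_resolvent \<beta> f g \<longleftrightarrow> g \<in> D \<and> (\<forall>w\<in>D. \<E> g w + \<beta> * ip m g w = \<beta> * ip m f w)"

lemma is_resolvent_exists:
  assumes "1 \<le> \<beta>" "f \<in> L2 m" shows "\<exists>g. is_resolvent \<beta> f g"
proof -
  obtain g where "g \<in> D" "\<And>w. w \<in> D \<Longrightarrow> E_beta \<beta> g w = ip m f w"
    using resolvent_equation_solvable(2)[OF assms] by blast
  then have "is_resolvent \<beta> f (\<lambda>x. \<beta> * g x)"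
    unfolding is_resolvent_def using assms by (auto simp: E.form_simps L.form_simps DL E_beta_def simp flip: distrib_left)
  then show ?thesis by blast
qed

lemma is_resolvent_scale:
  assumes "f \<in> L2 m" "is_resolvent \<beta> f g" shows "is_resolvent \<beta> (\<lambda>x. c * f x) (\<lambda>x. c * g x)"
  unfolding is_resolvent_def
proof (intro conjI ballI)
  have g: "g \<in> D" using assms by (simp add: is_resolvent_def)
  then show "(\<lambda>x. c * g x) \<in> D" by (rule D_scale)
  fix w assume w: "w \<in> D"
  have "\<E> g w + \<beta> * ip m g w = \<beta> * ip m f w" using assms w by (simp add: is_resolvent_def)
  then have "c * (\<E> g w + \<beta> * ip m g w) = c * (\<beta> * ip m f w)" by simp
  then show "\<E> (\<lambda>x. c * g x) w + \<beta> * ip m (\<lambda>x. c * g x) w = \<beta> * ip m (\<lambda>x. c * f x) w"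
    using g w assms(1) by (simp add: E_scale1 L.form_simps DL algebra_simps)
qed

lemma is_resolvent_add:
  assumes "f \<in> L2 m" "is_resolvent \<beta> f g" "f' \<in> L2 m" "is_resolvent \<beta> f' g'"
  shows "is_resolvent \<beta> (\<lambda>x. f x + f' x) (\<lambda>x. g x + g' x)"
proof -
  have g: "g \<in> D" "g' \<in> D" using assms by (auto simp: is_resolvent_def)
  show ?thesis unfolding is_resolvent_def
  proof (intro conjI ballI)
    show "(\<lambda>x. g x + g' x) \<in> D" using g by (rule D_add)
    fix w assume w: "w \<in> D"
    have "\<E> g w + \<beta> * ip m g w = \<beta> * ip m f w" "\<E> g' w + \<beta> * ip m g' w = \<beta> * ip m f' w"
      using assms w by (auto simp: is_resolvent_def)
    then show "\<E> (\<lambda>x. g x + g' x) w + \<beta> * ip m (\<lambda>x. g x + g' x) w = \<beta> * ip m (\<lambda>x. f x + f' x) w"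
      using g w assms(1,3) by (simp add: E_add1 L.form_simps DL algebra_simps)
  qed
qed

lemma is_resolvent_sum:
  assumes "\<And>i. i < (n::nat) \<Longrightarrow> f i \<in> L2 m \<and> is_resolvent \<beta> (f i) (g i)"
  shows "(\<lambda>x. \<Sum>i<n. c i * f i x) \<in> L2 m \<and> is_resolvent \<beta> (\<lambda>x. \<Sum>i<n. c i * f i x) (\<lambda>x. \<Sum>i<n. c i * g i x)"
  using assms
proof (induction n)
  case 0
  have z: "(\<lambda>x. 0) \<in> L2 m" by (simp add: L2_def)
  have "D \<noteq> {}" by (rule S.V_nonempty)
  then obtain d where "d \<in> D" by auto
  then have zD: "(\<lambda>x. 0) \<in> D" using D_scale[of d 0] by simp
  have "\<E> (\<lambda>x. 0) w = 0" if "w \<in> D" for w using E_scale1[OF zD that, of 0] by simp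
  then show ?case using z zD by (simp add: is_resolvent_def ip_def)
next
  case (Suc n)
  then have IH: "(\<lambda>x. \<Sum>i<n. c i * f i x) \<in> L2 m" "is_resolvent \<beta> (\<lambda>x. \<Sum>i<n. c i * f i x) (\<lambda>x. \<Sum>i<n. c i * g i x)"
    and n: "f n \<in> L2 m" "is_resolvent \<beta> (f n) (g n)" by auto
  show ?case
    using is_resolvent_add[OF IH L.V_scale[OF n(1), of "c n"] is_resolvent_scale[OF n]] L.V_add[OF IH(1) L.V_scale[OF n(1), of "c n"]]
    by simp
qed

lemma ip_zero_AE: "f \<in> L2 m \<Longrightarrow> ip m f f = 0 \<Longrightarrow> AE x in m. f x = 0"
  using L2_mult_integrable[of f m f] by (auto simp: ip_def integral_nonneg_eq_0_iff_AE)

lemma is_resolvent_unique: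
  assumes \<beta>: "1 \<le> \<beta>" and f: "f \<in> L2 m" and g: "is_resolvent \<beta> f g" "is_resolvent \<beta> f g'"
  shows "AE x in m. g x = g' x"
proof -
  have gD: "g \<in> D" "g' \<in> D" using g by (auto simp: is_resolvent_def)
  define h where "h = (\<lambda>x. g x - g' x)"
  have hD: "h \<in> D" using gD E.V_diff by (simp add: h_def)
  have "\<E> g h + \<beta> * ip m g h = \<E> g' h + \<beta> * ip m g' h" using g hD by (auto simp: is_resolvent_def)
  have "\<E> h h + \<beta> * ip m h h = 0"
  proof -
    have "\<E> h h = \<E> g h - \<E> g' h" "ip m h h = ip m g h - ip m g' h"
      using E.diff_left[OF gD hD] L.diff_left[OF DL[OF gD(1)] DL[OF gD(2)] DL[OF hD]] by (simp_all add: h_def)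
    then have "\<E> h h + \<beta> * ip m h h = (\<E> g h - \<E> g' h) + \<beta> * (ip m g h - ip m g' h)" by (simp only:)
    also have "\<dots> = 0" using \<open>\<E> g h + \<beta> * ip m g h = \<E> g' h + \<beta> * ip m g' h\<close> by (simp add: algebra_simps)
    finally show ?thesis .
  qed
  then have "ip m h h = 0"
    using E_nonneg[OF hD] L.nonneg[OF DL[OF hD]] \<beta> mult_nonneg_nonneg[of \<beta> "ip m h h"]
    by (smt (verit, best) mult_eq_0_iff)
  from ip_zero_AE[OF DL[OF hD] this] show ?thesis by (auto simp: h_def)
qed

text \<open>Test with w = g - c, where c is the unit contraction of g. Then \<E>(g, w) = \<E>(w, w)
  + \<E>(c, w) \<ge> 0, so the resolvent equation makes the integral of (g - f)w nonpositive. But (g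
  - f)w \<ge> 0 pointwise because f takes values in [0,1], so the product, and with it w, vanishes
  almost everywhere.\<close>

lemma is_resolvent_markov:
  assumes \<beta>: "1 \<le> \<beta>" and f: "f \<in> L2 m" "\<And>x. 0 \<le> f x" "\<And>x. f x \<le> 1" and g: "is_resolvent \<beta> f g"
  shows "AE x in m. 0 \<le> g x \<and> g x \<le> 1"
proof -
  have gD: "g \<in> D" using g by (simp add: is_resolvent_def)
  define c where "c = (\<lambda>x. min (max (g x) 0) 1)"
  have cD: "c \<in> D" and c: "0 \<le> \<E> c (\<lambda>x. g x - c x)" using clip[OF gD] by (auto simp: c_def)
  define w where "w = (\<lambda>x. g x - c x)"
  have wD: "w \<in> D" using gD cD E.V_diff by (simp add: w_def)
  have "\<E> g w = \<E> w w + \<E> c w" using E.diff_left[OF gD cD wD] by (simp add: w_def)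
  then have "0 \<le> \<E> g w" using E_nonneg[OF wD] c by (simp add: w_def)
  moreover have "\<E> g w + \<beta> * ip m g w = \<beta> * ip m f w" using g wD by (simp add: is_resolvent_def)
  ultimately have "\<beta> * ip m g w \<le> \<beta> * ip m f w" by linarith
  then have "ip m g w \<le> ip m f w" using \<beta> by simp
  then have le: "ip m (\<lambda>x. g x - f x) w \<le> 0" using L.diff_left[OF DL[OF gD] f(1) DL[OF wD]] by simp
  have nonneg: "0 \<le> (g x - f x) * w x" for x
    using f(2)[of x] f(3)[of x] by (auto simp: w_def c_def min_def max_def intro: mult_nonpos_nonpos)
  have int: "integrable m (\<lambda>x. (g x - f x) * w x)"
    by (rule L2_mult_integrable[OF L.V_diff[OF DL[OF gD] f(1)] DL[OF wD]])
  have "(\<integral>x. (g x - f x) * w x \<partial>m) = 0"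
    using le nonneg by (intro antisym integral_nonneg_AE) (auto simp: ip_def)
  then have "AE x in m. (g x - f x) * w x = 0"
    using integral_nonneg_eq_0_iff_AE[OF int] nonneg by simp
  then show ?thesis
  proof eventually_elim
    case (elim x)
    then show ?case using f(2)[of x] f(3)[of x] by (auto simp: w_def c_def min_def max_def split: if_splits)
  qed
qed

lemma is_resolvent_bounds:
  assumes \<beta>: "1 \<le> \<beta>" and c: "0 < c" and f: "f \<in> L2 m" "\<And>x. 0 \<le> f x" "\<And>x. f x \<le> c" and g: "is_resolvent \<beta> f g"
  shows "AE x in m. 0 \<le> g x \<and> g x \<le> c"
proof -
  have "AE x in m. 0 \<le> 1 / c * g x \<and> 1 / c * g x \<le> 1"
  proof (rule is_resolvent_markov[OF \<beta>])
    show "is_resolvent \<beta> (\<lambda>x. 1 / c * f x) (\<lambda>x. 1 / c * g x)" by (rule is_resolvent_scale[OF f(1) g])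
    show "(\<lambda>x. 1 / c * f x) \<in> L2 m" by (rule L.V_scale[OF f(1)])
  qed (use f c in auto)
  then show ?thesis
  proof eventually_elim
    case (elim x) then show ?case using c by (auto simp: field_simps)
  qed
qed

text \<open>The image of the positive part of f is nonnegative and that of the negative part is at
  most c. The proof scales by 1/c, which is why the rational inequalities in
  \<open>tensor_form_positive\<close> carry a strictly positive slack.\<close>

lemma is_resolvent_lower:
  assumes \<beta>: "1 \<le> \<beta>" and c: "0 < c" and f: "f \<in> C0" "\<And>x. - c \<le> f x" and g: "is_resolvent \<beta> f g"
  shows "AE x in m. - c \<le> g x"
proof -
  define p q where "p = (\<lambda>x. max (f x) 0)" and "q = (\<lambda>x. max (- f x) 0)"
  have pq: "p \<in> C0" "q \<in> C0" unfolding p_def q_def C0_eq_Cc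
    by (rule Cc_of_one[OF f(1)[unfolded C0_eq_Cc]]; auto intro!: continuous_intros Cc_cont[OF f(1)[unfolded C0_eq_Cc]])+
  note pqL = pq[THEN C0_L2[OF radon_m]]
  obtain gp gq where gp: "is_resolvent \<beta> p gp" and gq: "is_resolvent \<beta> q gq"
    using is_resolvent_exists[OF \<beta>] pqL by metis
  obtain B where B: "0 < B" "\<And>x. \<bar>f x\<bar> \<le> B" using Cc_bounded f(1) unfolding C0_eq_Cc by metis
  have 1: "AE x in m. 0 \<le> gp x \<and> gp x \<le> B"
    by (rule is_resolvent_bounds[OF \<beta> B(1) pqL(1) _ _ gp]) (use B in \<open>auto simp: p_def abs_le_iff intro: order_trans[OF abs_ge_zero]\<close>)
  have 2: "AE x in m. 0 \<le> gq x \<and> gq x \<le> c"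
    by (rule is_resolvent_bounds[OF \<beta> c pqL(2) _ _ gq]) (use f(2) c in \<open>auto simp: q_def minus_le_iff\<close>)
  have "is_resolvent \<beta> (\<lambda>x. p x + (-1) * q x) (\<lambda>x. gp x + (-1) * gq x)"
    by (rule is_resolvent_add[OF pqL(1) gp L.V_scale[OF pqL(2)] is_resolvent_scale[OF pqL(2) gq]])
  moreover have "(\<lambda>x. p x + (-1) * q x) = f" by (auto simp: p_def q_def max_def)
  ultimately have "AE x in m. g x = gp x + (-1) * gq x"
    using is_resolvent_unique[OF \<beta> C0_L2[OF radon_m f(1)] g] by simp
  with 1 2 show ?thesis by eventually_elim auto
qed

text \<open>The contraction acts on the first argument of \<E> and so controls the resolvent. This
  duality moves the co-resolvent, in terms of which \<sigma>-hat is defined, onto the resolvent of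
  v.\<close>

lemma ip_Ghat:
  assumes \<beta>: "1 \<le> \<beta>" and u: "u \<in> L2 m" and v: "v \<in> L2 m" and h: "is_resolvent \<beta> v h"
  shows "ip m (\<lambda>x. \<beta> * Ghat m \<E> D \<beta> u x) v = ip m u h"
proof -
  let ?g = "Ghat m \<E> D \<beta> u"
  have gD: "?g \<in> D" using Ghat(1)[OF \<beta> u] .
  have hD: "h \<in> D" using h by (simp add: is_resolvent_def)
  have "\<E> h ?g + \<beta> * ip m h ?g = ip m u h" by (rule Ghat(2)[OF \<beta> u hD])
  moreover have "\<E> h ?g + \<beta> * ip m h ?g = \<beta> * ip m v ?g" using h gD by (simp add: is_resolvent_def)
  moreover have "ip m (\<lambda>x. \<beta> * ?g x) v = \<beta> * ip m v ?g"
    using L.scale_left[OF DL[OF gD] v] L.sym[OF v DL[OF gD]] by simp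
  ultimately show ?thesis by simp
qed

text \<open>For fixed x the function \<phi>(x, \<cdot>) is nonnegative, so its resolvent is, too;
  evaluate it at x and integrate over x. The null set depends on the coefficients
  \<open>u i x\<close>, of which there may be uncountably many, so the almost-sure statement is made
  for rational coefficients only.\<close>

lemma tensor_form_positive:
  assumes \<beta>: "1 \<le> \<beta>" and \<phi>: "(\<phi>, c) \<in> tensor_span (supported_pairs C0 UNIV) (\<lambda>u v. ip m (\<lambda>x. \<beta> * Ghat m \<E> D \<beta> u x) v)"
    and pos: "\<And>p. 0 \<le> \<phi> p"
  shows "0 \<le> c"
proof -
  obtain xs where xs: "set xs \<subseteq> supported_pairs C0 UNIV" "\<phi> = (\<lambda>p. \<Sum>(u, v)\<leftarrow>xs. tensor u v p)"
    "c = (\<Sum>(u, v)\<leftarrow>xs. ip m (\<lambda>x. \<beta> * Ghat m \<E> D \<beta> u x) v)" using tensor_span_list[OF \<phi>] by blast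
  define n where "n = length xs"
  define u v where "u i = fst (xs ! i)" and "v i = snd (xs ! i)" for i
  have uv: "u i \<in> C0" "v i \<in> C0" if "i < n" for i
  proof -
    have "xs ! i \<in> supported_pairs C0 UNIV" using that xs(1) nth_mem[of i xs] by (auto simp: n_def)
    then show "u i \<in> C0" "v i \<in> C0" by (auto simp: u_def v_def supported_pairs_def)
  qed
  note uL = uv(1)[THEN C0_L2[OF radon_m]] and vL = uv(2)[THEN C0_L2[OF radon_m]]
  have "\<exists>h. i < n \<longrightarrow> is_resolvent \<beta> (v i) h" for i using is_resolvent_exists[OF \<beta> vL] by blast
  then obtain h where h: "\<And>i. i < n \<Longrightarrow> is_resolvent \<beta> (v i) (h i)" by metis
  have hL: "h i \<in> L2 m" if "i < n" for i using h[OF that] DL by (simp add: is_resolvent_def)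
  have \<phi>_eq: "\<phi> (x, y) = (\<Sum>i<n. u i x * v i y)" for x y
    unfolding xs(2) by (simp add: sum_list_sum_nth n_def u_def v_def tensor_def case_prod_beta atLeast0LessThan)
  have "AE x in m. \<forall>(q::rat list) (r::rat). 0 < r \<longrightarrow> (\<forall>y. - of_rat r \<le> (\<Sum>i<n. of_rat (q ! i) * v i y)) \<longrightarrow>
      - of_rat r \<le> (\<Sum>i<n. of_rat (q ! i) * h i x)"
    unfolding AE_all_countable
  proof (intro allI)
    fix q :: "rat list" and r :: rat
    show "AE x in m. 0 < r \<longrightarrow> (\<forall>y. - of_rat r \<le> (\<Sum>i<n. of_rat (q ! i) * v i y)) \<longrightarrow>
      - of_rat r \<le> (\<Sum>i<n. of_rat (q ! i) * h i x)"
    proof (cases "0 < r \<and> (\<forall>y. - of_rat r \<le> (\<Sum>i<n. of_rat (q ! i) * v i y))")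
      case True
      have "AE x in m. - of_rat r \<le> (\<Sum>i<n. of_rat (q ! i) * h i x)"
      proof (rule is_resolvent_lower[OF \<beta>])
        show "is_resolvent \<beta> (\<lambda>y. \<Sum>i<n. of_rat (q ! i) * v i y) (\<lambda>x. \<Sum>i<n. of_rat (q ! i) * h i x)"
          using is_resolvent_sum[of n v \<beta> h "\<lambda>i. of_rat (q ! i)"] vL h by auto
        show "(\<lambda>y. \<Sum>i<n. of_rat (q ! i) * v i y) \<in> C0"
          unfolding C0_eq_Cc using uv by (intro Cc_sum Cc_scale) (auto simp: C0_eq_Cc)
      qed (use True in auto)
      then show ?thesis by eventually_elim auto
    qed auto
  qed
  then have "AE x in m. 0 \<le> (\<Sum>i<n. u i x * h i x)"
  proof eventually_elim
    case (elim x)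
    show ?case
      by (rule nonneg_combination_from_rational[where v = v]) (use uv pos[of "(x, _)"] elim in \<open>auto simp: \<phi>_eq\<close>)
  qed
  then have "0 \<le> (\<integral>x. (\<Sum>i<n. u i x * h i x) \<partial>m)" by (rule integral_nonneg_AE)
  also have "\<dots> = (\<Sum>i<n. ip m (u i) (h i))"
    unfolding ip_def using L2_mult_integrable[OF uL hL] by (intro Bochner_Integration.integral_sum) auto
  also have "\<dots> = (\<Sum>i<n. ip m (\<lambda>x. \<beta> * Ghat m \<E> D \<beta> (u i) x) (v i))"
    by (rule sum.cong) (use ip_Ghat[OF \<beta> uL vL h] in auto)
  also have "\<dots> = c"
    unfolding xs(3) by (simp add: sum_list_sum_nth n_def u_def v_def case_prod_beta atLeast0LessThan)
  finally show ?thesis .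
qed

lemma sigma_hat:
  assumes \<beta>: "1 \<le> \<beta>"
  shows "radon (sigma_hat m \<E> D \<beta>)"
    "u \<in> C0 \<Longrightarrow> v \<in> C0 \<Longrightarrow> (\<integral>p. tensor u v p \<partial>sigma_hat m \<E> D \<beta>) = ip m (\<lambda>x. \<beta> * Ghat m \<E> D \<beta> u x) v"
proof -
  interpret C: cutoff_algebra "C0 :: ('a \<Rightarrow> real) set" by (rule cutoff_algebra_C0[OF loc_comp])
  define B where "B u v = ip m (\<lambda>x. \<beta> * Ghat m \<E> D \<beta> u x) v" for u v
  have B_scale: "B (\<lambda>x. r * u x) v = r * B u v" if u: "u \<in> C0" and v: "v \<in> C0" for u v r
  proof -
    note uL = C0_L2[OF radon_m u] and vL = C0_L2[OF radon_m v]
    obtain h where h: "is_resolvent \<beta> v h" using is_resolvent_exists[OF \<beta> vL] by blast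
    then have "h \<in> L2 m" using DL by (simp add: is_resolvent_def)
    then show ?thesis unfolding B_def ip_Ghat[OF \<beta> uL vL h] ip_Ghat[OF \<beta> L.V_scale[OF uL] vL h]
      by (rule L.scale_left[OF uL])
  qed
  obtain \<nu> where \<nu>: "radon_on UNIV \<nu>"
    "\<And>f c. (f, c) \<in> tensor_span (supported_pairs C0 UNIV) B \<Longrightarrow> (\<integral>p. f p \<partial>\<nu>) = c"
  proof (rule dense_functional_representation[OF locally_compact_space_prod_euclidean[OF loc_comp] open_UNIV,
      of "tensor_span (supported_pairs C0 UNIV) B"])
    show "dense_in_Cc UNIV (fst ` tensor_span (supported_pairs C0 UNIV) B)" by (rule C.tensor_span_dense) simp
    show "(\<lambda>x. r * f x, r * c) \<in> tensor_span (supported_pairs C0 UNIV) B"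
      if "(f, c) \<in> tensor_span (supported_pairs C0 UNIV) B" for f c r
      by (rule C.tensor_span_scale[OF _ that]) (auto simp: supported_pairs_def B_scale)
    show "0 \<le> c" if "(f, c) \<in> tensor_span (supported_pairs C0 UNIV) B" "\<And>x. 0 \<le> f x" for f c
      using tensor_form_positive[OF \<beta> _ that(2)] that(1) by (simp add: B_def[abs_def])
  qed (auto intro: tensor_span_add)
  have T: "(\<integral>p. tensor u v p \<partial>\<nu>) = B u v" if "u \<in> C0" "v \<in> C0" for u v
    using that by (intro \<nu>(2) tensor_span_base) (auto simp: supported_pairs_def)
  have char: "(\<forall>u \<in> C0. \<forall>v \<in> C0. ip m (\<lambda>x. \<beta> * Ghat m \<E> D \<beta> u x) v = (\<integral>p. u (fst p) * v (snd p) \<partial>\<sigma>))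
     \<longleftrightarrow> (\<forall>u \<in> C0. \<forall>v \<in> C0. (\<integral>p. tensor u v p \<partial>\<sigma>) = B u v)" for \<sigma>
    by (auto simp: B_def tensor_def[abs_def])
  have "sigma_hat m \<E> D \<beta> = \<nu>"
    unfolding sigma_hat_def char
  proof (rule the_equality)
    show "radon \<nu> \<and> (\<forall>u\<in>C0. \<forall>v\<in>C0. (\<integral>p. tensor u v p \<partial>\<nu>) = B u v)" using \<nu>(1) T by (simp add: radon_on_UNIV)
    fix \<sigma> assume "radon \<sigma> \<and> (\<forall>u\<in>C0. \<forall>v\<in>C0. (\<integral>p. tensor u v p \<partial>\<sigma>) = B u v)"
    then show "\<sigma> = \<nu>" using \<nu>(1) T
      by (intro radon_tensor_unique[OF C.cutoff_algebra_axioms open_UNIV]) (auto simp: radon_on_UNIV)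
  qed
  then show "radon (sigma_hat m \<E> D \<beta>)" using \<nu>(1) by (simp add: radon_on_UNIV)
  show "(\<integral>p. tensor u v p \<partial>sigma_hat m \<E> D \<beta>) = ip m (\<lambda>x. \<beta> * Ghat m \<E> D \<beta> u x) v" if "u \<in> C0" "v \<in> C0"
    using T[OF that] \<open>sigma_hat m \<E> D \<beta> = \<nu>\<close> by (simp add: B_def)
qed

text \<open>Put F_\<beta> = g - \<beta> Ghat_\<beta> g. The co-resolvent equation reads
  \<beta>(F_\<beta>, w) = \<E>(w, g - F_\<beta>), so the claim is that \<E>(f, F_\<beta>) tends to
  0. F_\<beta> is bounded in the \<open>E1\<close> norm and tends to 0 in L^2, so weak convergence,
  as in \<open>weak_limit_zero\<close>, suffices.\<close>

lemma Ghat_weak_limit: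
  assumes f: "f \<in> D" and g: "g \<in> D"
  shows "((\<lambda>\<beta>. \<beta> * (ip m f g - ip m (\<lambda>x. \<beta> * Ghat m \<E> D \<beta> g x) f)) \<longlongrightarrow> \<E> f g) at_top"
proof -
  define \<gamma> where "\<gamma> \<beta> = (\<lambda>x. \<beta> * Ghat m \<E> D \<beta> g x)" for \<beta>
  define F where "F \<beta> = (\<lambda>x. g x - \<gamma> \<beta> x)" for \<beta>
  define N where "N h = sqrt (E1 m \<E> h h)" for h
  \<comment> \<open>Of the constant, \<open>form_bound + 1\<close> comes from \<open>E_bound\<close>
    for \<E>(g, \<gamma>), and 1 more from the inner product in \<open>E1\<close>.\<close>
  define M where "M = (form_bound + 2) * N g"
  have N: "(N h)\<^sup>2 = E1 m \<E> h h" "0 \<le> N h" if "h \<in> D" for h using E1_nonneg[OF that] by (auto simp: N_def)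
  have ip_N: "\<bar>ip m h k\<bar> \<le> N h * N k" if "h \<in> D" "k \<in> D" for h k
    unfolding N_def using that E_nonneg L.nonneg[OF DL]
    by (intro order_trans[OF L.cauchy_schwarz[OF DL DL]] mult_mono) (auto simp: E1_def)
  have facts: "\<gamma> \<beta> \<in> D" "F \<beta> \<in> D" "\<And>w. w \<in> D \<Longrightarrow> \<E> w (\<gamma> \<beta>) = \<beta> * ip m (F \<beta>) w"
    "N (\<gamma> \<beta>) \<le> M" "\<beta> * ip m (F \<beta>) (F \<beta>) \<le> (form_bound + 1) * (N g * M)" if \<beta>: "1 \<le> \<beta>" for \<beta>
  proof -
    have GD: "Ghat m \<E> D \<beta> g \<in> D" by (rule Ghat(1)[OF \<beta> DL[OF g]])
    then show \<gamma>D: "\<gamma> \<beta> \<in> D" unfolding \<gamma>_def by (rule D_scale)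
    show FD: "F \<beta> \<in> D" unfolding F_def by (rule E.V_diff[OF g \<gamma>D])
    show eq: "\<E> w (\<gamma> \<beta>) = \<beta> * ip m (F \<beta>) w" if w: "w \<in> D" for w
    proof -
      have 1: "\<E> w (\<gamma> \<beta>) = \<beta> * \<E> w (Ghat m \<E> D \<beta> g)" unfolding \<gamma>_def by (rule E_scale2[OF GD w])
      have 2: "ip m w (\<gamma> \<beta>) = \<beta> * ip m w (Ghat m \<E> D \<beta> g)" unfolding \<gamma>_def by (rule L.scale_right[OF DL[OF GD] DL[OF w]])
      have "\<E> w (Ghat m \<E> D \<beta> g) + \<beta> * ip m w (Ghat m \<E> D \<beta> g) = ip m g w" by (rule Ghat(2)[OF \<beta> DL[OF g] w])
      then have "\<beta> * (\<E> w (Ghat m \<E> D \<beta> g) + \<beta> * ip m w (Ghat m \<E> D \<beta> g)) = \<beta> * ip m g w" by simp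
      then have "\<E> w (\<gamma> \<beta>) = \<beta> * (ip m g w - ip m w (\<gamma> \<beta>))" unfolding 1 2 by (simp add: algebra_simps)
      then show ?thesis unfolding F_def using L.diff_left[OF DL[OF g] DL[OF \<gamma>D] DL[OF w]] L.sym[OF DL[OF w] DL[OF \<gamma>D]] by simp
    qed
    have E\<gamma>: "\<E> (\<gamma> \<beta>) (\<gamma> \<beta>) = \<E> g (\<gamma> \<beta>) - \<beta> * ip m (F \<beta>) (F \<beta>)"
    proof -
      have "\<E> g (\<gamma> \<beta>) - \<E> (\<gamma> \<beta>) (\<gamma> \<beta>) = \<E> (F \<beta>) (\<gamma> \<beta>)" unfolding F_def by (rule E.diff_left[OF g \<gamma>D \<gamma>D, symmetric])
      then show ?thesis using eq[OF FD] by simp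
    qed
    have "0 \<le> \<beta> * ip m (F \<beta>) (\<gamma> \<beta>)" using E_nonneg[OF \<gamma>D] eq[OF \<gamma>D] by simp
    then have "0 \<le> ip m (F \<beta>) (\<gamma> \<beta>)" using \<beta> by (simp add: zero_le_mult_iff)
    then have ip\<gamma>: "ip m (\<gamma> \<beta>) (\<gamma> \<beta>) \<le> N g * N (\<gamma> \<beta>)"
      unfolding F_def using L.diff_left[OF DL[OF g] DL[OF \<gamma>D] DL[OF \<gamma>D]] ip_N[OF g \<gamma>D] by (simp add: abs_le_iff)
    have Eg: "\<E> g (\<gamma> \<beta>) \<le> (form_bound + 1) * (N g * N (\<gamma> \<beta>))"
      using E_bound[OF g \<gamma>D] by (simp add: N_def abs_le_iff)
    have FF: "0 \<le> \<beta> * ip m (F \<beta>) (F \<beta>)" using \<beta> L.nonneg[OF DL[OF FD]] by simp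
    have "(N (\<gamma> \<beta>))\<^sup>2 \<le> M * N (\<gamma> \<beta>)"
      using E\<gamma> FF Eg ip\<gamma> N(1)[OF \<gamma>D] by (simp add: E1_def M_def algebra_simps)
    then show NM: "N (\<gamma> \<beta>) \<le> M"
    proof (cases "N (\<gamma> \<beta>) = 0")
      case True then show ?thesis using form_bound(1) N(2)[OF g] by (simp add: M_def)
    qed (use N(2)[OF \<gamma>D] in \<open>auto simp: power2_eq_square\<close>)
    have "\<beta> * ip m (F \<beta>) (F \<beta>) \<le> (form_bound + 1) * (N g * N (\<gamma> \<beta>))" using E\<gamma> E_nonneg[OF \<gamma>D] Eg by linarith
    also have "\<dots> \<le> (form_bound + 1) * (N g * M)"
      using form_bound(1) NM N(2)[OF g] by (intro mult_left_mono) auto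
    finally show "\<beta> * ip m (F \<beta>) (F \<beta>) \<le> (form_bound + 1) * (N g * M)" .
  qed
  have ev: "\<forall>\<^sub>F \<beta> in at_top. 1 \<le> (\<beta>::real)" by (rule eventually_ge_at_top)
  have "((\<lambda>\<beta>. \<E> f (F \<beta>)) \<longlongrightarrow> 0) at_top"
  proof (rule S.weak_limit_zero[where q = "ip m" and l = "\<E> f" and F = F])
    show "inner_form D (ip m)" by unfold_locales (auto simp: L.form_simps DL E.V_ops L.nonneg L.sym)
    show "ip m h h \<le> sym1 h h" if "h \<in> D" for h using E_nonneg[OF that] by (simp add: E1_def)
    show "sym1 h h = 0" if "h \<in> D" "ip m h h = 0" for h
      using E_AE_zero[OF that(1) ip_zero_AE[OF DL[OF that(1)] that(2)]] that by (simp add: E1_def)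
    show "\<bar>\<E> f h\<bar> \<le> ((form_bound + 1) * sqrt (E1 m \<E> f f)) * sqrt (sym1 h h)" if "h \<in> D" for h
      using E_bound[OF f that] by (simp add: mult.assoc)
    show "\<forall>\<^sub>F \<beta> in at_top. F \<beta> \<in> D \<and> sym1 (F \<beta>) (F \<beta>) \<le> 2 * E1 m \<E> g g + 2 * M\<^sup>2"
      using ev
    proof eventually_elim
      case (elim \<beta>)
      note \<beta> = facts[OF elim]
      have mg: "(\<lambda>x. - 1 * \<gamma> \<beta> x) \<in> D" using \<beta>(1) by (rule D_scale)
      have "sym1 (F \<beta>) (F \<beta>) \<le> 2 * sym1 (\<lambda>x. F \<beta> x - - 1 * \<gamma> \<beta> x) (\<lambda>x. F \<beta> x - - 1 * \<gamma> \<beta> x) + 2 * sym1 (\<lambda>x. - 1 * \<gamma> \<beta> x) (\<lambda>x. - 1 * \<gamma> \<beta> x)"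
        by (rule S.sum_bound[OF \<beta>(2) mg])
      also have "(\<lambda>x. F \<beta> x - - 1 * \<gamma> \<beta> x) = g" by (simp add: F_def)
      also have "sym1 (\<lambda>x. - 1 * \<gamma> \<beta> x) (\<lambda>x. - 1 * \<gamma> \<beta> x) = E1 m \<E> (\<gamma> \<beta>) (\<gamma> \<beta>)"
        using S.scale_left[OF \<beta>(1) mg, of "-1"] S.scale_right[OF \<beta>(1) \<beta>(1), of "-1"] by simp
      also have "E1 m \<E> (\<gamma> \<beta>) (\<gamma> \<beta>) \<le> M\<^sup>2" using N[OF \<beta>(1)] \<beta>(4) power_mono by metis
      finally show ?case using \<beta>(2) by simp
    qed
    show "((\<lambda>\<beta>. ip m (F \<beta>) (F \<beta>)) \<longlongrightarrow> 0) at_top"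
    proof (rule Lim_null_comparison)
      show "((\<lambda>\<beta>. ((form_bound + 1) * (N g * M)) / \<beta>) \<longlongrightarrow> 0) at_top"
        by (rule tendsto_divide_0[OF tendsto_const]) (rule filterlim_at_top_imp_at_infinity[OF filterlim_ident])
      show "\<forall>\<^sub>F \<beta> in at_top. norm (ip m (F \<beta>) (F \<beta>)) \<le> ((form_bound + 1) * (N g * M)) / \<beta>"
        using ev
      proof eventually_elim
        case (elim \<beta>)
        then show ?case using facts(5)[OF elim] L.nonneg[OF DL[OF facts(2)[OF elim]]] by (simp add: field_simps)
      qed
    qed
  qed (use f in \<open>auto simp: E.form_simps\<close>)
  then have "((\<lambda>\<beta>. \<E> f g - \<E> f (F \<beta>)) \<longlongrightarrow> \<E> f g - 0) at_top" by (intro tendsto_intros)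
  then have lim: "((\<lambda>\<beta>. \<E> f g - \<E> f (F \<beta>)) \<longlongrightarrow> \<E> f g) at_top" by simp
  show ?thesis
  proof (rule Lim_transform_eventually[OF lim])
    show "\<forall>\<^sub>F \<beta> in at_top. \<E> f g - \<E> f (F \<beta>) = \<beta> * (ip m f g - ip m (\<lambda>x. \<beta> * Ghat m \<E> D \<beta> g x) f)"
      using ev
    proof eventually_elim
      case (elim \<beta>)
      note \<beta> = facts[OF elim]
      have "\<E> f (F \<beta>) = \<E> f g - \<E> f (\<gamma> \<beta>)" unfolding F_def by (rule E.diff_right[OF g \<beta>(1) f])
      moreover have "ip m (F \<beta>) f = ip m g f - ip m (\<gamma> \<beta>) f"
        unfolding F_def by (rule L.diff_left[OF DL[OF g] DL[OF \<beta>(1)] DL[OF f]])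
      ultimately show ?case using \<beta>(3)[OF f] L.sym[OF DL[OF f] DL[OF g]] by (simp add: \<gamma>_def)
    qed
  qed
qed

text \<open>Regularity gives g in \<open>C0 \<inter> D\<close> within 1 of three times a cutoff c.
  Subtracting the unit contraction of g and contracting again uses only operations available in D:
  where c = 0, g lies in (-1,1) and the result is 0; where c = 1, g > 2 and the result is 1.\<close>

lemma cutoff_algebra_C0_D: "cutoff_algebra (C0 \<inter> D)"
proof -
  interpret C: cutoff_algebra "C0 :: ('a \<Rightarrow> real) set" by (rule cutoff_algebra_C0[OF loc_comp])
  show ?thesis
  proof
    fix K U :: "'a set" assume KU: "compact K" "open U" "K \<subseteq> U"
    obtain c V where c: "c \<in> C0" "fsupp c \<subseteq> U" "\<And>x. 0 \<le> c x" "\<And>x. c x \<le> 1" "open V" "K \<subseteq> V" "\<And>x. x \<in> V \<Longrightarrow> c x = 1"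
      using C.A_cutoffE[OF KU] by metis
    have "(\<lambda>x. 3 * c x) \<in> C0" using c(1) by (rule C.A_scale)
    then obtain g where g: "g \<in> C0 \<inter> D" "\<And>x. \<bar>3 * c x - g x\<bar> < 1"
      using regular[unfolded regular_semi_dirichlet_def, THEN conjunct2, THEN conjunct2, rule_format, of "\<lambda>x. 3 * c x" 1] by auto
    define h where "h = (\<lambda>x. g x - min (max (g x) 0) 1)"
    define a where "a = (\<lambda>x. min (max (h x) 0) 1)"
    have gD: "g \<in> D" "continuous_on UNIV g" using g by (auto simp: C0_def)
    have "h \<in> D" unfolding h_def by (rule E.V_diff[OF gD(1) clip(1)[OF gD(1)]])
    then have aD: "a \<in> D" unfolding a_def by (rule clip(1))
    have a0: "a x = 0" if "c x = 0" for x using g(2)[of x] that by (auto simp: a_def h_def min_def max_def)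
    have "continuous_on UNIV a" unfolding a_def h_def by (intro continuous_intros gD)
    then have aC: "a \<in> C0" using Cc_of_one[OF c(1)[unfolded C0_eq_Cc] _ a0] by (simp add: C0_eq_Cc)
    have "a x = 1" if "x \<in> V" for x
      using g(2)[of x] c(7)[OF that] by (auto simp: a_def h_def min_def max_def)
    moreover have "fsupp a \<subseteq> U" using fsupp_mono[of c a] a0 c(2) by auto
    ultimately show "\<exists>a\<in>C0 \<inter> D. fsupp a \<subseteq> U \<and> (\<forall>x. 0 \<le> a x \<and> a x \<le> 1) \<and> (\<exists>V. open V \<and> K \<subseteq> V \<and> (\<forall>x\<in>V. a x = 1))"
      using aC aD c(5,6) by (intro bexI[of _ a]) (auto simp: a_def)
  qed (use loc_comp algebra in \<open>auto intro: C.A_add C.A_scale D_add D_scale\<close>)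
qed

sublocale A: cutoff_algebra "C0 \<inter> D" by (rule cutoff_algebra_C0_D)

end

section \<open>The jumping and killing measures\<close>

lemma open_Compl_diag: "open (- diag :: ('a::t2_space \<times> 'a) set)"
proof -
  have "closed {p :: 'a \<times> 'a. fst p = snd p}" by (intro closed_Collect_eq continuous_intros)
  then show ?thesis by (simp add: diag_def open_Compl)
qed

lemma Times_subset_Compl_diag: "U \<times> V \<subseteq> - diag \<longleftrightarrow> U \<inter> V = {}"
  by (auto simp: diag_def)

lemma continuous_swap: "continuous_on UNIV (prod.swap :: 'a::topological_space \<times> 'b::topological_space \<Rightarrow> 'b \<times> 'a)"
  unfolding prod.swap_def by (intro continuous_intros)

lemma swap_measurable:
  "(prod.swap :: 'a::topological_space \<times> 'b::topological_space \<Rightarrow> 'b \<times> 'a) \<in> borel_measurable borel"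
  by (rule borel_measurable_continuous_onI[OF continuous_swap])

context semi_dirichlet_space
begin

text \<open>Reflecting \<open>\<sigma>-hat\<^sub>\<beta>\<close> gives \<open>m(dx) \<beta>G\<^sub>\<beta>(x, dy)\<close>, whose argument order agrees with that of \<open>\<E>\<close> and \<open>J\<close>.\<close>
definition sig :: "real \<Rightarrow> ('a \<times> 'a) measure" where
  "sig \<beta> = distr (sigma_hat m \<E> D \<beta>) borel prod.swap"

lemma sets_sigma_hat: "1 \<le> \<beta> \<Longrightarrow> sets (sigma_hat m \<E> D \<beta>) = sets borel"
  using sigma_hat(1) by (simp add: radon_def)

lemma swap_measurable_sigma_hat: "1 \<le> \<beta> \<Longrightarrow> prod.swap \<in> measurable (sigma_hat m \<E> D \<beta>) borel"
  using swap_measurable measurable_cong_sets[OF sets_sigma_hat refl] by blast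

lemma integral_sig:
  fixes f :: "'a \<times> 'a \<Rightarrow> real"
  assumes "1 \<le> \<beta>" "f \<in> borel_measurable borel"
  shows "(\<integral>p. f p \<partial>sig \<beta>) = (\<integral>p. f (prod.swap p) \<partial>sigma_hat m \<E> D \<beta>)"
  unfolding sig_def by (rule integral_distr[OF swap_measurable_sigma_hat[OF assms(1)] assms(2)])

lemma radon_sig:
  assumes "1 \<le> \<beta>" shows "radon (sig \<beta>)"
  unfolding radon_def
proof (intro conjI allI impI)
  show "sets (sig \<beta>) = sets borel" by (simp add: sig_def)
  fix C :: "('a \<times> 'a) set" assume C: "compact C"
  have sp: "space (sigma_hat m \<E> D \<beta>) = UNIV"
    using sets_eq_imp_space_eq[OF sets_sigma_hat[OF assms]] by simp
  have "emeasure (sig \<beta>) C = emeasure (sigma_hat m \<E> D \<beta>) (prod.swap -` C \<inter> UNIV)"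
    unfolding sig_def using C by (subst emeasure_distr[OF swap_measurable_sigma_hat[OF assms]]) (auto simp: sp borel_compact)
  also have "prod.swap -` C \<inter> UNIV = prod.swap ` C" by (auto intro: image_eqI[of _ _ "prod.swap _"])
  also have "compact (prod.swap ` C)"
    by (intro compact_continuous_image continuous_on_subset[OF continuous_swap] C) auto
  then have "emeasure (sigma_hat m \<E> D \<beta>) (prod.swap ` C) < \<infinity>" using sigma_hat(1)[OF assms] by (simp add: radon_def)
  finally show "emeasure (sig \<beta>) C < \<infinity>" .
qed

lemma tensor_measurable: "u \<in> C0 \<Longrightarrow> v \<in> C0 \<Longrightarrow> tensor u v \<in> borel_measurable borel"
  by (rule borel_measurable_continuous_onI[OF continuous_tensor]) (auto simp: C0_def)

section \<open>Convergence of the approximating measures and the jumping measure\<close>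

lemma sig_limit:
  assumes f: "f \<in> C0 \<inter> D" and g: "g \<in> C0 \<inter> D"
  shows "((\<lambda>\<beta>. \<beta> * (ip m f g - (\<integral>p. tensor f g p \<partial>sig \<beta>))) \<longlongrightarrow> \<E> f g) at_top"
proof (rule Lim_transform_eventually)
  show "((\<lambda>\<beta>. \<beta> * (ip m f g - ip m (\<lambda>x. \<beta> * Ghat m \<E> D \<beta> g x) f)) \<longlongrightarrow> \<E> f g) at_top"
    using f g by (intro Ghat_weak_limit) auto
  show "\<forall>\<^sub>F \<beta> in at_top. \<beta> * (ip m f g - ip m (\<lambda>x. \<beta> * Ghat m \<E> D \<beta> g x) f) = \<beta> * (ip m f g - (\<integral>p. tensor f g p \<partial>sig \<beta>))"
    using eventually_ge_at_top[of 1]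
  proof eventually_elim
    case (elim \<beta>)
    have "(\<integral>p. tensor f g p \<partial>sig \<beta>) = (\<integral>p. tensor g f p \<partial>sigma_hat m \<E> D \<beta>)"
      using f g by (subst integral_sig[OF elim tensor_measurable]) (auto simp: tensor_def[abs_def] mult.commute)
    then show ?case using f g sigma_hat(2)[OF elim, of g f] by simp
  qed
qed

lemma ip_disjoint: "fsupp f \<inter> fsupp g = {} \<Longrightarrow> ip m f g = 0"
proof -
  assume "fsupp f \<inter> fsupp g = {}"
  then have "f x * g x = 0" for x using in_fsupp[of f x] in_fsupp[of g x] by auto
  then have "(\<lambda>x. f x * g x) = (\<lambda>x. 0)" by (rule ext)
  then show ?thesis by (simp only: ip_def) simp
qed

text \<open>For disjoint supports the characterisation of J and K leaves \<E>(u,v) = -2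
  \<integral>u(x)v(y) J(dxdy), which forces this value.\<close>

abbreviation "jump_span \<equiv> tensor_span (supported_pairs (C0 \<inter> D) (- diag)) (\<lambda>u v. - \<E> u v / 2)"

lemma jump_span_limit:
  assumes "(\<phi>, c) \<in> jump_span"
  shows "((\<lambda>\<beta>. \<beta> * (\<integral>p. \<phi> p \<partial>sig \<beta>)) \<longlongrightarrow> 2 * c) at_top"
  using assms
proof induction
  case (tensor_span_base u v)
  then have uv: "u \<in> C0 \<inter> D" "v \<in> C0 \<inter> D" "fsupp u \<inter> fsupp v = {}"
    by (auto simp: supported_pairs_def Times_subset_Compl_diag)
  show ?case using tendsto_minus[OF sig_limit[OF uv(1,2)]] by (simp add: ip_disjoint[OF uv(3)])
next
  case (tensor_span_add f c g d)
  have fg: "f \<in> Cc UNIV" "g \<in> Cc UNIV"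
    using tensor_span_add.hyps A.tensor_span_Cc Cc_mono by blast+
  have L: "((\<lambda>\<beta>. \<beta> * (\<integral>p. f p \<partial>sig \<beta>) + \<beta> * (\<integral>p. g p \<partial>sig \<beta>)) \<longlongrightarrow> 2 * (c + d)) at_top"
    using tendsto_add[OF tensor_span_add.IH] by (simp add: distrib_left)
  show ?case
  proof (rule Lim_transform_eventually[OF L])
    show "\<forall>\<^sub>F \<beta> in at_top. \<beta> * (\<integral>p. f p \<partial>sig \<beta>) + \<beta> * (\<integral>p. g p \<partial>sig \<beta>) = \<beta> * (\<integral>p. f p + g p \<partial>sig \<beta>)"
      using eventually_ge_at_top[of 1]
    proof eventually_elim
      case (elim \<beta>)
      then have R: "radon_on UNIV (sig \<beta>)" using radon_sig by (simp add: radon_on_UNIV)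
      show ?case using Cc_integrable[OF R fg(1)] Cc_integrable[OF R fg(2)] by (simp add: distrib_left)
    qed
  qed
qed

lemma jump_exists:
  "\<exists>J. radon_on (- diag) J \<and> (\<forall>u\<in>C0 \<inter> D. \<forall>v\<in>C0 \<inter> D. fsupp u \<inter> fsupp v = {} \<longrightarrow> (\<integral>p. tensor u v p \<partial>J) = - \<E> u v / 2)"
proof -
  obtain J where J: "radon_on (- diag) J" "\<And>f c. (f, c) \<in> jump_span \<Longrightarrow> (\<integral>p. f p \<partial>J) = c"
  proof (rule dense_functional_representation[OF locally_compact_space_prod_euclidean[OF loc_comp] open_Compl_diag, of jump_span])
    show "dense_in_Cc (- diag) (fst ` jump_span)" by (rule A.tensor_span_dense[OF open_Compl_diag])
    show "(\<lambda>x. r * f x, r * c) \<in> jump_span" if "(f, c) \<in> jump_span" for f c r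
      by (rule A.tensor_span_scale[OF _ that]) (auto simp: supported_pairs_def E_scale1)
    show "0 \<le> c" if "(f, c) \<in> jump_span" "\<And>x. 0 \<le> f x" for f c
    proof -
      have "0 \<le> 2 * c"
      proof (rule tendsto_lowerbound[OF jump_span_limit[OF that(1)]])
        show "\<forall>\<^sub>F \<beta> in at_top. 0 \<le> \<beta> * (\<integral>p. f p \<partial>sig \<beta>)"
          using eventually_ge_at_top[of 0] by eventually_elim (use that(2) in \<open>auto intro!: mult_nonneg_nonneg integral_nonneg_AE\<close>)
      qed simp
      then show ?thesis by simp
    qed
  qed (auto intro: tensor_span_add)
  have "(\<integral>p. tensor u v p \<partial>J) = - \<E> u v / 2" if "u \<in> C0 \<inter> D" "v \<in> C0 \<inter> D" "fsupp u \<inter> fsupp v = {}" for u v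
    using that by (intro J(2) tensor_span_base) (auto simp: supported_pairs_def Times_subset_Compl_diag)
  with J(1) show ?thesis by blast
qed

text \<open>\<open>Jm\<close> is defined by \<open>THE\<close> jointly with K, so a candidate for J
  is fixed here, K is built relative to it, and \<open>Jm_eq_jump\<close> identifies the two
  afterwards.\<close>

definition jump :: "('a \<times> 'a) measure" where
  "jump = (SOME J. radon_on (- diag) J \<and> (\<forall>u\<in>C0 \<inter> D. \<forall>v\<in>C0 \<inter> D. fsupp u \<inter> fsupp v = {} \<longrightarrow> (\<integral>p. tensor u v p \<partial>J) = - \<E> u v / 2))"

lemma radon_jump: "radon_on (- diag) jump"
  and integral_jump: "u \<in> C0 \<inter> D \<Longrightarrow> v \<in> C0 \<inter> D \<Longrightarrow> fsupp u \<inter> fsupp v = {} \<Longrightarrow> (\<integral>p. tensor u v p \<partial>jump) = - \<E> u v / 2"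
  using someI_ex[OF jump_exists, folded jump_def] by auto

lemma sets_jump: "sets jump = sets borel"
  using radon_jump by (simp add: radon_on_def)

lemma jump_vague_limit:
  assumes \<phi>: "\<phi> \<in> Cc (- diag)"
  shows "((\<lambda>\<beta>. \<beta> * (\<integral>p. \<phi> p \<partial>sig \<beta>)) \<longlongrightarrow> 2 * (\<integral>p. \<phi> p \<partial>jump)) at_top"
proof (rule vague_limit[OF A.tensor_span_dense[OF open_Compl_diag] _ radon_jump _ _ \<phi>, of 1])
  fix s assume "s \<in> fst ` jump_span"
  then obtain c where c: "(s, c) \<in> jump_span" by auto
  have "(\<integral>p. s p \<partial>jump) = c"
  proof (rule tensor_span_integral[OF radon_jump _ c, THEN conjunct2])
    fix u v assume "(u, v) \<in> supported_pairs (C0 \<inter> D) (- diag)"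
    then have uv: "u \<in> C0 \<inter> D" "v \<in> C0 \<inter> D" "fsupp u \<times> fsupp v \<subseteq> - diag" by (auto simp: supported_pairs_def)
    then show "tensor u v \<in> Cc (- diag) \<and> (\<integral>p. tensor u v p \<partial>jump) = - \<E> u v / 2"
      using tensor_Cc[of u v "- diag"] integral_jump[OF uv(1,2)] by (simp add: Times_subset_Compl_diag)
  qed
  then show "((\<lambda>\<beta>. \<beta> * (\<integral>p. s p \<partial>sig \<beta>)) \<longlongrightarrow> 2 * (\<integral>p. s p \<partial>jump)) at_top" using jump_span_limit[OF c] by simp
qed (use radon_sig in auto)

text \<open>The unit contraction of \<open>\<kappa> + v\<close> is \<open>\<kappa>\<close>.\<close>
lemma E_cutoff_nonneg:
  assumes "\<kappa> \<in> D" "\<And>x. 0 \<le> \<kappa> x" "\<And>x. \<kappa> x \<le> 1" "v \<in> D" "\<And>x. 0 \<le> v x" "\<And>x. v x \<noteq> 0 \<Longrightarrow> \<kappa> x = 1"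
  shows "0 \<le> \<E> \<kappa> v"
proof -
  have D: "(\<lambda>x. \<kappa> x + v x) \<in> D" using assms by (intro D_add)
  have eq: "min (max (\<kappa> x + v x) 0) 1 = \<kappa> x" for x
  proof (cases "v x = 0")
    case True then show ?thesis using assms(2,3)[of x] by simp
  next
    case False then show ?thesis using assms(5)[of x] assms(6)[OF False] by simp
  qed
  show ?thesis using clip(2)[OF D] unfolding eq by simp
qed

section \<open>The killing measure\<close>

definition is_cutoff :: "('a \<Rightarrow> real) \<Rightarrow> ('a \<Rightarrow> real) \<Rightarrow> bool" where
  "is_cutoff \<kappa> v \<longleftrightarrow> \<kappa> \<in> C0 \<inter> D \<and> (\<forall>x. 0 \<le> \<kappa> x \<and> \<kappa> x \<le> 1) \<and> (\<exists>U. open U \<and> fsupp v \<subseteq> U \<and> (\<forall>x\<in>U. \<kappa> x = 1))"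

lemma is_cutoff_exists:
  assumes "compact K" obtains \<kappa> where "\<kappa> \<in> C0 \<inter> D" "\<And>v. fsupp v \<subseteq> K \<Longrightarrow> is_cutoff \<kappa> v"
proof -
  obtain a V where a: "a \<in> C0 \<inter> D" "\<And>x. 0 \<le> a x" "\<And>x. a x \<le> 1" "open V" "K \<subseteq> V" "\<And>x. x \<in> V \<Longrightarrow> a x = 1"
    using A.A_cutoffE[OF assms open_UNIV subset_UNIV] by metis
  have "is_cutoff a v" if "fsupp v \<subseteq> K" for v
    unfolding is_cutoff_def using a that by (intro conjI allI exI[of _ V]) auto
  with a(1) show thesis by (rule that)
qed

lemma is_cutoff_eq_1: "is_cutoff \<kappa> v \<Longrightarrow> v x \<noteq> 0 \<Longrightarrow> \<kappa> x = 1"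
  using in_fsupp[of v x] by (auto simp: is_cutoff_def)

text \<open>The unit contraction also truncates at 1; scaling by a bound of v makes that truncation
  ineffective.\<close>

lemma A_pos_part:
  assumes "v \<in> C0 \<inter> D" shows "(\<lambda>x. max (v x) 0) \<in> C0 \<inter> D"
proof -
  have vC: "v \<in> Cc UNIV" using assms by (simp add: C0_eq_Cc)
  obtain B where B: "0 < B" "\<And>x. \<bar>v x\<bar> \<le> B" using Cc_bounded[OF vC] by metis
  have "(\<lambda>x. B * min (max (1 / B * v x) 0) 1) \<in> D"
    using assms by (intro D_scale clip(1)) auto
  moreover have "B * min (max (1 / B * v x) 0) 1 = max (v x) 0" for x
    using B(1) B(2)[of x] by (auto simp: min_def max_def field_simps abs_le_iff)
  moreover have "(\<lambda>x. max (v x) 0) \<in> C0"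
    unfolding C0_eq_Cc by (rule Cc_of_one[OF vC]) (auto intro!: continuous_intros Cc_cont[OF vC])
  ultimately show ?thesis by simp
qed

text \<open>This is (\<kappa>(y) - \<kappa>(x))v(y), since \<kappa> = 1 wherever v does not vanish.
  It vanishes for x near the support of v, and its integrability is derived here from the
  contraction property.\<close>

definition jump_integrand :: "('a \<Rightarrow> real) \<Rightarrow> ('a \<Rightarrow> real) \<Rightarrow> 'a \<times> 'a \<Rightarrow> real" where
  "jump_integrand \<kappa> v p = (1 - \<kappa> (fst p)) * v (snd p)"

lemma jump_integrand_measurable:
  assumes "\<kappa> \<in> C0" "v \<in> C0" shows "jump_integrand \<kappa> v \<in> borel_measurable jump"
proof -
  have "continuous_on UNIV (\<lambda>x. 1 - \<kappa> x)" "continuous_on UNIV v"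
    using assms by (auto simp: C0_def intro!: continuous_intros)
  from borel_measurable_continuous_onI[OF continuous_tensor[OF this]]
  have "jump_integrand \<kappa> v \<in> borel_measurable borel" by (simp add: tensor_def[abs_def] jump_integrand_def[abs_def])
  then show ?thesis using measurable_cong_sets[OF sets_jump refl] by blast
qed

text \<open>Enlarge \<kappa> to \<kappa> + u_n with u_n = (1 - \<kappa>)a_n and a_n increasing to
  cover the space. The sum is again at most 1 and equals 1 where v is nonzero, so 0 \<le>
  \<E>(\<kappa> + u_n, v) = \<E>(\<kappa>, v) - 2 \<integral>u_n(x)v(y) dJ. Fatou's lemma gives the
  bound.\<close>

lemma jump_integrand_nn_integral:
  assumes \<kappa>: "is_cutoff \<kappa> v" and v: "v \<in> C0 \<inter> D" "\<And>x. 0 \<le> v x"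
  shows "(\<integral>\<^sup>+p. ennreal (jump_integrand \<kappa> v p) \<partial>jump) \<le> ennreal (\<E> \<kappa> v / 2)"
proof -
  have \<kappa>A: "\<kappa> \<in> C0 \<inter> D" "\<And>x. 0 \<le> \<kappa> x" "\<And>x. \<kappa> x \<le> 1" using \<kappa> by (auto simp: is_cutoff_def)
  obtain U where U: "open U" "fsupp v \<subseteq> U" "\<And>x. x \<in> U \<Longrightarrow> \<kappa> x = 1" using \<kappa> by (auto simp: is_cutoff_def)
  obtain V :: "nat \<Rightarrow> 'a set" where V: "\<And>n. compact (closure (V n))" "\<And>n. V n \<subseteq> V (Suc n)" "(\<Union>n. V n) = UNIV"
    using open_exhaustion[OF loc_comp open_UNIV] by metis
  have "\<exists>a. a \<in> C0 \<inter> D \<and> (\<forall>x. 0 \<le> a x \<and> a x \<le> 1) \<and> (\<forall>x\<in>V n. a x = 1)" for n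
    using A.A_cutoffE[OF V(1)[of n] open_UNIV subset_UNIV] closure_subset[of "V n"] by (metis subset_iff)
  then obtain a where a: "\<And>n. a n \<in> C0 \<inter> D" "\<And>n x. 0 \<le> a n x \<and> a n x \<le> 1" "\<And>n x. x \<in> V n \<Longrightarrow> a n x = 1"
    by metis
  define u where "u n = (\<lambda>x. a n x - \<kappa> x * a n x)" for n
  have uA: "u n \<in> C0 \<inter> D" for n unfolding u_def by (intro A.A_diff A.A_mult a \<kappa>A)
  have u_eq: "u n x = (1 - \<kappa> x) * a n x" for n x by (simp add: u_def algebra_simps)
  have bound: "(\<integral>\<^sup>+p. ennreal (tensor (u n) v p) \<partial>jump) \<le> ennreal (\<E> \<kappa> v / 2)" for n
  proof -
    have "fsupp (u n) \<inter> U = {}" by (rule fsupp_disjoint_open[OF U(1)]) (simp add: u_eq U(3))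
    then have dis: "fsupp (u n) \<inter> fsupp v = {}" using U(2) by auto
    have "0 \<le> \<E> (\<lambda>x. \<kappa> x + u n x) v"
    proof (rule E_cutoff_nonneg)
      show "(\<lambda>x. \<kappa> x + u n x) \<in> D" using A.A_add[OF \<kappa>A(1) uA] by auto
      show "0 \<le> \<kappa> x + u n x" for x using \<kappa>A(2,3)[of x] a(2)[of n x] by (simp add: u_eq)
      show "\<kappa> x + u n x \<le> 1" for x
        using \<kappa>A(3)[of x] a(2)[of n x] mult_left_mono[of "a n x" 1 "1 - \<kappa> x"] by (simp add: u_eq)
      show "\<kappa> x + u n x = 1" if "v x \<noteq> 0" for x using is_cutoff_eq_1[OF \<kappa> that] by (simp add: u_eq)
    qed (use v in auto)
    also have "\<E> (\<lambda>x. \<kappa> x + u n x) v = \<E> \<kappa> v + \<E> (u n) v"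
      using \<kappa>A(1) uA[of n] v(1) by (intro E_add1) auto
    finally have "(\<integral>p. tensor (u n) v p \<partial>jump) \<le> \<E> \<kappa> v / 2" using integral_jump[OF uA v(1) dis] by simp
    moreover have "tensor (u n) v \<in> Cc (- diag)"
      using uA[of n] v(1) dis by (intro tensor_Cc) (auto simp: Times_subset_Compl_diag)
    then have "integrable jump (tensor (u n) v)" by (rule Cc_integrable[OF radon_jump])
    moreover have "0 \<le> tensor (u n) v p" for p
      using \<kappa>A(3)[of "fst p"] a(2)[of n "fst p"] v(2)[of "snd p"] by (auto simp: tensor_def u_eq)
    ultimately show ?thesis by (subst nn_integral_eq_integral) (auto intro: ennreal_leI)
  qed
  have lim: "liminf (\<lambda>n. ennreal (tensor (u n) v p)) = ennreal (jump_integrand \<kappa> v p)" for p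
  proof (rule lim_imp_Liminf)
    obtain k where k: "fst p \<in> V k" using V(3) by auto
    have "fst p \<in> V n" if "n \<ge> k" for n using that k V(2) by (induction rule: dec_induct) auto
    then have "\<forall>\<^sub>F n in sequentially. ennreal (tensor (u n) v p) = ennreal (jump_integrand \<kappa> v p)"
      using a(3) by (auto simp: eventually_sequentially tensor_def u_eq jump_integrand_def intro!: exI[of _ k])
    then show "(\<lambda>n. ennreal (tensor (u n) v p)) \<longlonglongrightarrow> ennreal (jump_integrand \<kappa> v p)" by (rule tendsto_eventually)
  qed simp
  have meas: "(\<lambda>p. ennreal (tensor (u n) v p)) \<in> borel_measurable jump" for n
  proof -
    have "tensor (u n) v \<in> borel_measurable jump"
      using tensor_measurable[of "u n" v] uA[of n] v(1) measurable_cong_sets[OF sets_jump refl] by blast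
    then show ?thesis by simp
  qed
  have "(\<integral>\<^sup>+p. ennreal (jump_integrand \<kappa> v p) \<partial>jump) = (\<integral>\<^sup>+p. liminf (\<lambda>n. ennreal (tensor (u n) v p)) \<partial>jump)"
    by (simp add: lim)
  also have "\<dots> \<le> liminf (\<lambda>n. \<integral>\<^sup>+p. ennreal (tensor (u n) v p) \<partial>jump)" by (rule nn_integral_liminf[OF meas])
  also have "\<dots> \<le> liminf (\<lambda>n. ennreal (\<E> \<kappa> v / 2))" by (intro Liminf_mono always_eventually allI bound)
  also have "\<dots> = ennreal (\<E> \<kappa> v / 2)" by (simp add: Liminf_const)
  finally show ?thesis .
qed

lemma jump_integrand_integrable_nonneg:
  assumes \<kappa>: "is_cutoff \<kappa> v" and v: "v \<in> C0 \<inter> D" "\<And>x. 0 \<le> v x"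
  shows "integrable jump (jump_integrand \<kappa> v)" "2 * (\<integral>p. jump_integrand \<kappa> v p \<partial>jump) \<le> \<E> \<kappa> v"
proof -
  have \<kappa>A: "\<kappa> \<in> C0 \<inter> D" "\<And>x. 0 \<le> \<kappa> x" "\<And>x. \<kappa> x \<le> 1" using \<kappa> by (auto simp: is_cutoff_def)
  have nonneg: "0 \<le> jump_integrand \<kappa> v p" for p using \<kappa>A(3)[of "fst p"] v(2) by (simp add: jump_integrand_def)
  have meas: "jump_integrand \<kappa> v \<in> borel_measurable jump" using \<kappa>A v by (intro jump_integrand_measurable) auto
  note le = jump_integrand_nn_integral[OF assms]
  show int: "integrable jump (jump_integrand \<kappa> v)"
    by (rule integrableI_nonneg[OF meas]) (use nonneg le in \<open>auto intro: le_less_trans\<close>)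
  have E0: "0 \<le> \<E> \<kappa> v" using \<kappa>A v is_cutoff_eq_1[OF \<kappa>] by (intro E_cutoff_nonneg) auto
  have "ennreal (\<integral>p. jump_integrand \<kappa> v p \<partial>jump) \<le> ennreal (\<E> \<kappa> v / 2)"
    using le nn_integral_eq_integral[OF int] nonneg by simp
  then show "2 * (\<integral>p. jump_integrand \<kappa> v p \<partial>jump) \<le> \<E> \<kappa> v" using E0 by simp
qed

lemma is_cutoff_mono: "is_cutoff \<kappa> v \<Longrightarrow> (\<And>x. v x = 0 \<Longrightarrow> w x = 0) \<Longrightarrow> is_cutoff \<kappa> w"
  using fsupp_mono[of v w] by (fastforce simp: is_cutoff_def)

lemma jump_integrand_integrable:
  assumes \<kappa>: "is_cutoff \<kappa> v" and v: "v \<in> C0 \<inter> D"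
  shows "integrable jump (jump_integrand \<kappa> v)"
proof -
  define p q where "p x = max (v x) 0" and "q x = max (- v x) 0" for x
  have pA: "p \<in> C0 \<inter> D" unfolding p_def by (rule A_pos_part[OF v])
  have qA: "q \<in> C0 \<inter> D" unfolding q_def using A_pos_part[OF A.A_scale[OF v, of "-1"]] by simp
  have "integrable jump (jump_integrand \<kappa> p)" "integrable jump (jump_integrand \<kappa> q)"
    by (intro jump_integrand_integrable_nonneg is_cutoff_mono[OF \<kappa>] pA qA; simp add: p_def q_def)+
  then have "integrable jump (\<lambda>x. jump_integrand \<kappa> p x - jump_integrand \<kappa> q x)" by simp
  moreover have "(\<lambda>x. jump_integrand \<kappa> p x - jump_integrand \<kappa> q x) = jump_integrand \<kappa> v"
    by (rule ext) (auto simp: jump_integrand_def p_def q_def max_def algebra_simps)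
  ultimately show ?thesis by simp
qed

text \<open>The value of \<open>\<integral>v dK\<close> forced by the characterisation of \<open>J\<close> and \<open>K\<close>.\<close>
definition kill :: "('a \<Rightarrow> real) \<Rightarrow> ('a \<Rightarrow> real) \<Rightarrow> real" where
  "kill \<kappa> v = \<E> \<kappa> v - 2 * (\<integral>p. jump_integrand \<kappa> v p \<partial>jump)"

text \<open>The difference of two cutoffs vanishes near the support of v, so \<E> sees it only
  through J, and the jump integrals compensate exactly.\<close>

lemma kill_independent:
  assumes \<kappa>: "is_cutoff \<kappa> v" "is_cutoff \<kappa>' v" and v: "v \<in> C0 \<inter> D"
  shows "kill \<kappa> v = kill \<kappa>' v"
proof -
  have \<kappa>A: "\<kappa> \<in> C0 \<inter> D" "\<kappa>' \<in> C0 \<inter> D" using \<kappa> by (auto simp: is_cutoff_def)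
  obtain U U' where U: "open U" "fsupp v \<subseteq> U" "\<And>x. x \<in> U \<Longrightarrow> \<kappa> x = 1"
    "open U'" "fsupp v \<subseteq> U'" "\<And>x. x \<in> U' \<Longrightarrow> \<kappa>' x = 1" using \<kappa> unfolding is_cutoff_def by metis
  define w where "w = (\<lambda>x. \<kappa> x - \<kappa>' x)"
  have wA: "w \<in> C0 \<inter> D" unfolding w_def by (rule A.A_diff[OF \<kappa>A])
  have "fsupp w \<inter> (U \<inter> U') = {}" by (rule fsupp_disjoint_open) (use U in \<open>auto simp: w_def\<close>)
  then have dis: "fsupp w \<inter> fsupp v = {}" using U by auto
  have "(\<integral>p. jump_integrand \<kappa>' v p \<partial>jump) - (\<integral>p. jump_integrand \<kappa> v p \<partial>jump)
      = (\<integral>p. jump_integrand \<kappa>' v p - jump_integrand \<kappa> v p \<partial>jump)"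
    using jump_integrand_integrable[OF \<kappa>(1) v] jump_integrand_integrable[OF \<kappa>(2) v] by simp
  also have "(\<lambda>p. jump_integrand \<kappa>' v p - jump_integrand \<kappa> v p) = tensor w v"
    by (rule ext) (simp add: jump_integrand_def tensor_def w_def algebra_simps)
  also have "(\<integral>p. tensor w v p \<partial>jump) = - \<E> w v / 2" by (rule integral_jump[OF wA v dis])
  also have "\<E> w v = \<E> \<kappa> v - \<E> \<kappa>' v" unfolding w_def using \<kappa>A v by (intro E.diff_left) auto
  finally show ?thesis by (simp add: kill_def)
qed

lemma kill_add:
  assumes "is_cutoff \<kappa> v" "v \<in> C0 \<inter> D" "is_cutoff \<kappa> w" "w \<in> C0 \<inter> D"
  shows "kill \<kappa> (\<lambda>x. v x + w x) = kill \<kappa> v + kill \<kappa> w"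
proof -
  have "jump_integrand \<kappa> (\<lambda>x. v x + w x) = (\<lambda>p. jump_integrand \<kappa> v p + jump_integrand \<kappa> w p)"
    by (rule ext) (simp add: jump_integrand_def algebra_simps)
  moreover have "\<E> \<kappa> (\<lambda>x. v x + w x) = \<E> \<kappa> v + \<E> \<kappa> w" using assms by (intro E_add2) (auto simp: is_cutoff_def)
  ultimately show ?thesis unfolding kill_def
    using jump_integrand_integrable[OF assms(1,2)] jump_integrand_integrable[OF assms(3,4)] by simp
qed

lemma kill_scale:
  assumes "is_cutoff \<kappa> v" "v \<in> C0 \<inter> D"
  shows "kill \<kappa> (\<lambda>x. r * v x) = r * kill \<kappa> v"
proof -
  have "jump_integrand \<kappa> (\<lambda>x. r * v x) = (\<lambda>p. r * jump_integrand \<kappa> v p)"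
    by (rule ext) (simp add: jump_integrand_def algebra_simps)
  moreover have "\<E> \<kappa> (\<lambda>x. r * v x) = r * \<E> \<kappa> v" using assms by (intro E_scale2) (auto simp: is_cutoff_def)
  ultimately show ?thesis unfolding kill_def by (simp add: algebra_simps)
qed

text \<open>Regularity gives a uniform error e; multiplying the approximant by a cutoff s of the
  support of f turns it into the error \<open>e * s\<close>.\<close>

lemma dense_C0_D: "dense_in_Cc UNIV (C0 \<inter> D)"
  unfolding dense_in_Cc_def
proof (intro conjI ballI)
  show "C0 \<inter> D \<subseteq> Cc UNIV" by (auto simp: C0_eq_Cc)
  fix f :: "'a \<Rightarrow> real" assume f: "f \<in> Cc UNIV"
  obtain s V where s: "s \<in> C0 \<inter> D" "\<And>x. 0 \<le> s x" "fsupp f \<subseteq> V" "\<And>x. x \<in> V \<Longrightarrow> s x = 1"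
    using A.A_cutoffE[OF Cc_compact[OF f] open_UNIV subset_UNIV] by metis
  have "\<exists>g\<in>C0 \<inter> D. \<forall>x. \<bar>f x - g x\<bar> \<le> e * s x" if e: "0 < e" for e
  proof -
    obtain g where g: "g \<in> C0 \<inter> D" "\<And>x. \<bar>f x - g x\<bar> < e"
      using regular[unfolded regular_semi_dirichlet_def, THEN conjunct2, THEN conjunct2, rule_format, of f e] f e
      by (auto simp: C0_eq_Cc)
    have "\<bar>f x - g x * s x\<bar> \<le> e * s x" for x
    proof -
      have "f x = f x * s x" using s(3,4) in_fsupp[of f x] by (cases "f x = 0") auto
      then have "\<bar>f x - g x * s x\<bar> = \<bar>f x - g x\<bar> * s x" using s(2)[of x] by (metis abs_mult abs_of_nonneg left_diff_distrib)
      also have "\<dots> \<le> e * s x" using g(2)[of x] s(2)[of x] by (intro mult_right_mono) auto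
      finally show ?thesis .
    qed
    then show ?thesis using A.A_mult[OF g(1) s(1)] by (intro bexI[of _ "\<lambda>x. g x * s x"]) auto
  qed
  then show "\<exists>s\<in>C0 \<inter> D. (\<forall>x. 0 \<le> s x) \<and> (\<forall>e>0. \<exists>g\<in>C0 \<inter> D. \<forall>x. \<bar>f x - g x\<bar> \<le> e * s x)"
    using s(1,2) by (intro bexI[of _ s]) auto
qed

text \<open>Each v comes with its own cutoffs, so the graph records a value common to all of them;
  for sums a cutoff of both supports is used. Positivity of the functional is the inequality in
  \<open>jump_integrand_integrable_nonneg\<close>.\<close>

lemma killing_exists:
  "\<exists>K. radon K \<and> (\<forall>v\<in>C0 \<inter> D. \<forall>\<kappa>. is_cutoff \<kappa> v \<longrightarrow> (\<integral>x. v x \<partial>K) = kill \<kappa> v)"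
proof -
  define S where "S = {(v, c). v \<in> C0 \<inter> D \<and> (\<forall>\<kappa>. is_cutoff \<kappa> v \<longrightarrow> kill \<kappa> v = c)}"
  have compact: "compact (fsupp v)" if "v \<in> C0 \<inter> D" for v using that by (auto simp: C0_def)
  have S_mem: "(v, kill \<kappa> v) \<in> S" if "v \<in> C0 \<inter> D" "is_cutoff \<kappa> v" for v \<kappa>
    unfolding S_def using kill_independent[OF _ that(2,1)] that(1) by simp
  have fstS: "fst ` S = C0 \<inter> D"
  proof
    show "C0 \<inter> D \<subseteq> fst ` S"
    proof
      fix v assume v: "v \<in> C0 \<inter> D"
      obtain \<kappa> where "is_cutoff \<kappa> v" using is_cutoff_exists[OF compact[OF v]] by blast
      then show "v \<in> fst ` S" using imageI[OF S_mem[OF v], of \<kappa> fst] by simp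
    qed
  qed (auto simp: S_def)
  obtain K where K: "radon_on UNIV K" "\<And>f c. (f, c) \<in> S \<Longrightarrow> (\<integral>x. f x \<partial>K) = c"
  proof (rule dense_functional_representation[OF loc_comp open_UNIV, of S])
    show "dense_in_Cc UNIV (fst ` S)" unfolding fstS by (rule dense_C0_D)
  next
    fix f c g d assume f: "(f, c) \<in> S" and g: "(g, d) \<in> S"
    then have A: "f \<in> C0 \<inter> D" "g \<in> C0 \<inter> D" by (auto simp: S_def)
    obtain \<kappa> where \<kappa>: "\<And>v. fsupp v \<subseteq> fsupp f \<union> fsupp g \<Longrightarrow> is_cutoff \<kappa> v"
      using is_cutoff_exists[OF compact_Un[OF compact[OF A(1)] compact[OF A(2)]]] by metis
    have gf: "is_cutoff \<kappa> f" "is_cutoff \<kappa> g" by (auto intro: \<kappa>)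
    have "fsupp (\<lambda>x. f x + g x) \<subseteq> fsupp f \<union> fsupp g" 
      by (rule fsupp_subset) (auto simp: not_in_fsupp)
    from S_mem[OF A.A_add[OF A] \<kappa>[OF this]] show "(\<lambda>x. f x + g x, c + d) \<in> S"
      using kill_add[OF gf(1) A(1) gf(2) A(2)] f g gf by (simp add: S_def)
  next
    fix f c and r :: real assume f: "(f, c) \<in> S"
    then have A: "f \<in> C0 \<inter> D" by (auto simp: S_def)
    obtain \<kappa> where \<kappa>: "is_cutoff \<kappa> f" using is_cutoff_exists[OF compact[OF A]] by blast
    have "is_cutoff \<kappa> (\<lambda>x. r * f x)" by (rule is_cutoff_mono[OF \<kappa>]) auto
    from S_mem[OF A.A_scale[OF A] this] show "(\<lambda>x. r * f x, r * c) \<in> S"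
      using kill_scale[OF \<kappa> A] f \<kappa> by (simp add: S_def)
  next
    fix f c assume f: "(f, c) \<in> S" "\<And>x. 0 \<le> f x"
    then have A: "f \<in> C0 \<inter> D" by (auto simp: S_def)
    obtain \<kappa> where \<kappa>: "is_cutoff \<kappa> f" using is_cutoff_exists[OF compact[OF A]] by blast
    have "0 \<le> kill \<kappa> f" using jump_integrand_integrable_nonneg(2)[OF \<kappa> A f(2)] by (simp add: kill_def)
    then show "0 \<le> c" using f(1) \<kappa> by (simp add: S_def)
  qed (rule that)
  show ?thesis using K S_mem by (metis radon_on_UNIV)
qed

text \<open>Decompose u = c\<kappa> + w, where \<kappa> is a cutoff of v and w vanishes near the
  support of v. The first term is governed by \<open>kill\<close>, the second by J alone, and the
  two jump integrands add up to that of u.\<close>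

lemma JK_char_exists:
  obtains K where "JK_char m \<E> D jump K"
proof -
  obtain K where K: "radon K" "\<And>v \<kappa>. v \<in> C0 \<inter> D \<Longrightarrow> is_cutoff \<kappa> v \<Longrightarrow> (\<integral>x. v x \<partial>K) = kill \<kappa> v"
    using killing_exists by metis
  have "\<E> u v = (\<integral>p. 2 * (u (snd p) - u (fst p)) * v (snd p) \<partial>jump) + (\<integral>x. u x * v x \<partial>K)"
    if u: "u \<in> C0 \<inter> D" and v: "v \<in> C0 \<inter> D" and U: "open U" "fsupp v \<subseteq> U" "\<And>x. x \<in> U \<Longrightarrow> u x = c" for u v U c
  proof -
    obtain \<kappa> where \<kappa>: "is_cutoff \<kappa> v" using is_cutoff_exists[of "fsupp v"] v by (auto simp: C0_def)
    then obtain V where V: "open V" "fsupp v \<subseteq> V" "\<And>x. x \<in> V \<Longrightarrow> \<kappa> x = 1" by (auto simp: is_cutoff_def)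
    have \<kappa>A: "\<kappa> \<in> C0 \<inter> D" using \<kappa> by (simp add: is_cutoff_def)
    define w where "w = (\<lambda>x. u x - c * \<kappa> x)"
    have wA: "w \<in> C0 \<inter> D" unfolding w_def by (intro A.A_diff A.A_scale u \<kappa>A)
    have "fsupp w \<inter> (U \<inter> V) = {}" by (rule fsupp_disjoint_open) (use U V in \<open>auto simp: w_def\<close>)
    then have dis: "fsupp w \<inter> fsupp v = {}" using U V by auto
    have uv: "u y * v y = c * v y" for y using U in_fsupp[of v y] by (cases "v y = 0") auto
    have int_w: "integrable jump (tensor w v)"
      by (rule Cc_integrable[OF radon_jump tensor_Cc]) (use wA v dis in \<open>auto simp: Times_subset_Compl_diag\<close>)
    have "u = (\<lambda>x. c * \<kappa> x + w x)" by (simp add: w_def)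
    then have "\<E> u v = \<E> (\<lambda>x. c * \<kappa> x + w x) v" by simp
    also have "\<dots> = c * \<E> \<kappa> v + \<E> w v" using \<kappa>A wA v D_scale[of \<kappa> c] by (simp add: E_add1 E_scale1)
    also have "\<E> w v = - 2 * (\<integral>p. tensor w v p \<partial>jump)" using integral_jump[OF wA v dis] by simp
    also have "\<E> \<kappa> v = (\<integral>x. v x \<partial>K) + 2 * (\<integral>p. jump_integrand \<kappa> v p \<partial>jump)" using K(2)[OF v \<kappa>] by (simp add: kill_def)
    finally have "\<E> u v = c * (\<integral>x. v x \<partial>K) + (\<integral>p. 2 * c * jump_integrand \<kappa> v p - 2 * tensor w v p \<partial>jump)"
      using int_w jump_integrand_integrable[OF \<kappa> v] by (simp add: algebra_simps)
    also have "(\<lambda>p. 2 * c * jump_integrand \<kappa> v p - 2 * tensor w v p) = (\<lambda>p. 2 * (u (snd p) - u (fst p)) * v (snd p))"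
    proof
      fix p
      show "2 * c * jump_integrand \<kappa> v p - 2 * tensor w v p = 2 * (u (snd p) - u (fst p)) * v (snd p)"
        using uv[of "snd p"] by (cases "v (snd p) = 0") (auto simp: jump_integrand_def tensor_def w_def algebra_simps)
    qed
    also have "c * (\<integral>x. v x \<partial>K) = (\<integral>x. u x * v x \<partial>K)" by (simp add: uv)
    finally show ?thesis by simp
  qed
  then have "JK_char m \<E> D jump K"
    using radon_jump K(1) unfolding JK_char_def radon_on_def by (auto simp: disjoint_eq_subset_Compl)
  then show thesis by (rule that)
qed

text \<open>Pairs with disjoint supports determine J, because the killing integral vanishes. Then u
  = \<kappa>, a cutoff of v, determines the integral of v against K.\<close>

lemma JK_char_unique:
  assumes "JK_char m \<E> D J K" "JK_char m \<E> D J' K'"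
  shows "J = J'" "K = K'"
proof -
  have R: "radon_on (- diag) J" "radon_on UNIV K" if "JK_char m \<E> D J K" for J K
    using that by (auto simp: JK_char_def radon_on_def radon_def disjoint_eq_subset_Compl)
  have tens: "(\<integral>p. tensor u v p \<partial>J) = - \<E> u v / 2"
    if JK: "JK_char m \<E> D J K" and uv: "u \<in> C0 \<inter> D" "v \<in> C0 \<inter> D" "fsupp u \<times> fsupp v \<subseteq> - diag" for J K u v
  proof -
    have dis: "fsupp u \<inter> fsupp v = {}" using uv(3) by (simp add: Times_subset_Compl_diag)
    then have "\<exists>U c. open U \<and> fsupp v \<subseteq> U \<and> (\<forall>x\<in>U. u x = c)"
      using not_in_fsupp[of _ u] by (intro exI[of _ "- fsupp u"] exI[of _ 0]) auto
    then have E: "\<E> u v = (\<integral>p. 2 * (u (snd p) - u (fst p)) * v (snd p) \<partial>J) + (\<integral>x. u x * v x \<partial>K)"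
      using JK uv(1,2) unfolding JK_char_def by blast
    have uv0: "u x * v x = 0" for x using dis in_fsupp[of u x] in_fsupp[of v x] by auto
    have "(\<lambda>p. 2 * (u (snd p) - u (fst p)) * v (snd p)) = (\<lambda>p. - 2 * tensor u v p)"
      using uv0 by (auto simp: tensor_def fun_eq_iff algebra_simps)
    then show ?thesis using E uv0 by simp
  qed
  show J: "J = J'"
    by (rule radon_tensor_unique[OF A.cutoff_algebra_axioms open_Compl_diag R(1)[OF assms(1)] R(1)[OF assms(2)]])
       (use tens[OF assms(1)] tens[OF assms(2)] in simp)
  have "(\<integral>x. v x \<partial>K) = (\<integral>x. v x \<partial>K')" if v: "v \<in> C0 \<inter> D" for v
  proof -
    obtain \<kappa> where \<kappa>: "is_cutoff \<kappa> v" using is_cutoff_exists[of "fsupp v"] v by (auto simp: C0_def)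
    then have \<kappa>A: "\<kappa> \<in> C0 \<inter> D" and ex: "\<exists>U c. open U \<and> fsupp v \<subseteq> U \<and> (\<forall>x\<in>U. \<kappa> x = c)" by (auto simp: is_cutoff_def)
    have eq: "\<E> \<kappa> v = (\<integral>p. 2 * (\<kappa> (snd p) - \<kappa> (fst p)) * v (snd p) \<partial>J) + (\<integral>x. \<kappa> x * v x \<partial>K)"
      if "JK_char m \<E> D J K" for J K
      using that \<kappa>A v ex unfolding JK_char_def by blast
    have \<kappa>v: "(\<lambda>x. \<kappa> x * v x) = v"
    proof
      show "\<kappa> x * v x = v x" for x using is_cutoff_eq_1[OF \<kappa>, of x] by (cases "v x = 0") auto
    qed
    show ?thesis using eq[OF assms(1)] eq[OF assms(2)] unfolding \<kappa>v J by linarith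
  qed
  then show "K = K'" by (rule radon_on_eq_if_dense[OF loc_comp open_UNIV R(2)[OF assms(1)] R(2)[OF assms(2)] dense_C0_D])
qed

lemma Jm_eq_jump: "Jm m \<E> D = jump"
  and JK_char_Jm_Km: "JK_char m \<E> D (Jm m \<E> D) (Km m \<E> D)"
proof -
  obtain K where K: "JK_char m \<E> D jump K" by (rule JK_char_exists)
  have "jumpK m \<E> D = (jump, K)" unfolding jumpK_def
  proof (rule the_equality)
    show "JK_char m \<E> D (fst (jump, K)) (snd (jump, K))" using K by simp
    show "p = (jump, K)" if "JK_char m \<E> D (fst p) (snd p)" for p
      using JK_char_unique[OF that K] by (simp add: prod_eq_iff)
  qed
  then show "Jm m \<E> D = jump" "JK_char m \<E> D (Jm m \<E> D) (Km m \<E> D)" using K by (auto simp: Jm_def Km_def)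
qed

end

section \<open>The energy measures and the diffusion part\<close>

locale standing_setting = semi_dirichlet_space +
  assumes standing: "standing_assumption m \<E> D"
begin

section \<open>Bilinearity of the diffusion part and of the energy functional\<close>

definition jump_int :: "('a \<Rightarrow> real) \<Rightarrow> ('a \<Rightarrow> real) \<Rightarrow> real" where
  "jump_int u v = (\<integral>p. (u (snd p) - u (fst p)) * v (snd p) \<partial>jump)"

lemma jump_integrable:
  "u \<in> C0 \<inter> D \<Longrightarrow> v \<in> C0 \<inter> D \<Longrightarrow> integrable jump (\<lambda>p. (u (snd p) - u (fst p)) * v (snd p))"
  using standing by (simp add: standing_assumption_def Jm_eq_jump)

lemma radon_Km: "radon_on UNIV (Km m \<E> D)"
  using JK_char_Jm_Km by (simp add: JK_char_def radon_on_UNIV)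

lemma Km_integrable: "u \<in> C0 \<inter> D \<Longrightarrow> v \<in> C0 \<inter> D \<Longrightarrow> integrable (Km m \<E> D) (\<lambda>x. u x * v x)"
  using A.A_mult by (intro Cc_integrable[OF radon_Km]) (auto simp: C0_eq_Cc)

lemma Ec_eq: "Ec m \<E> D u v = \<E> u v - 2 * jump_int u v - (\<integral>x. u x * v x \<partial>Km m \<E> D)"
  by (simp only: Ec_def Jm_eq_jump jump_int_def mult.assoc integral_mult_right_zero)

context
  fixes u v w assumes uvw: "u \<in> C0 \<inter> D" "v \<in> C0 \<inter> D" "w \<in> C0 \<inter> D"
begin

lemma Ec_add_left: "Ec m \<E> D (\<lambda>x. u x + v x) w = Ec m \<E> D u w + Ec m \<E> D v w"
proof -
  have "jump_int (\<lambda>x. u x + v x) w = (\<integral>p. (u (snd p) - u (fst p)) * w (snd p) + (v (snd p) - v (fst p)) * w (snd p) \<partial>jump)"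
    unfolding jump_int_def by (rule Bochner_Integration.integral_cong) (auto simp: algebra_simps)
  also have "\<dots> = jump_int u w + jump_int v w"
    unfolding jump_int_def using uvw by (intro Bochner_Integration.integral_add jump_integrable)
  finally show ?thesis
    using Km_integrable[OF uvw(1,3)] Km_integrable[OF uvw(2,3)] uvw by (simp add: Ec_eq E_add1 distrib_right)
qed

lemma Ec_add_right: "Ec m \<E> D w (\<lambda>x. u x + v x) = Ec m \<E> D w u + Ec m \<E> D w v"
proof -
  have "jump_int w (\<lambda>x. u x + v x) = (\<integral>p. (w (snd p) - w (fst p)) * u (snd p) + (w (snd p) - w (fst p)) * v (snd p) \<partial>jump)"
    unfolding jump_int_def by (rule Bochner_Integration.integral_cong) (auto simp: algebra_simps)
  also have "\<dots> = jump_int w u + jump_int w v"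
    unfolding jump_int_def using uvw by (intro Bochner_Integration.integral_add jump_integrable)
  finally show ?thesis
    using Km_integrable[OF uvw(3,1)] Km_integrable[OF uvw(3,2)] uvw by (simp add: Ec_eq E_add2 distrib_left)
qed

lemma Ec_scale_left: "Ec m \<E> D (\<lambda>x. c * u x) w = c * Ec m \<E> D u w"
proof -
  have "jump_int (\<lambda>x. c * u x) w = (\<integral>p. c * ((u (snd p) - u (fst p)) * w (snd p)) \<partial>jump)"
    unfolding jump_int_def by (rule Bochner_Integration.integral_cong) (auto simp: algebra_simps)
  then have "jump_int (\<lambda>x. c * u x) w = c * jump_int u w" by (simp add: jump_int_def)
  then show ?thesis using uvw by (simp add: Ec_eq E_scale1 mult.assoc algebra_simps)
qed

lemma Ec_scale_right: "Ec m \<E> D w (\<lambda>x. c * u x) = c * Ec m \<E> D w u"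
proof -
  have "jump_int w (\<lambda>x. c * u x) = (\<integral>p. c * ((w (snd p) - w (fst p)) * u (snd p)) \<partial>jump)"
    unfolding jump_int_def by (rule Bochner_Integration.integral_cong) (auto simp: algebra_simps)
  then have "jump_int w (\<lambda>x. c * u x) = c * jump_int w u" by (simp add: jump_int_def)
  moreover have "(\<integral>x. w x * (c * u x) \<partial>Km m \<E> D) = c * (\<integral>x. w x * u x \<partial>Km m \<E> D)"
    by (simp add: mult.left_commute)
  ultimately show ?thesis using uvw by (simp add: Ec_eq E_scale2 algebra_simps)
qed

end

definition energy :: "('a \<Rightarrow> real) \<Rightarrow> ('a \<Rightarrow> real) \<Rightarrow> ('a \<Rightarrow> real) \<Rightarrow> real" where
  "energy u v f = Ec m \<E> D u (\<lambda>x. v x * f x) + Ec m \<E> D v (\<lambda>x. u x * f x) - Ec m \<E> D (\<lambda>x. u x * v x) f"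

lemma energy_commute: "energy u v f = energy v u f"
  by (simp add: energy_def mult.commute add.commute)

lemma energy_add_left:
  assumes "u \<in> C0 \<inter> D" "u' \<in> C0 \<inter> D" "v \<in> C0 \<inter> D" "f \<in> C0 \<inter> D"
  shows "energy (\<lambda>x. u x + u' x) v f = energy u v f + energy u' v f"
proof -
  note Am = A.A_mult
  show ?thesis unfolding energy_def distrib_right
    using Ec_add_left[OF assms(1,2) Am[OF assms(3,4)]] Ec_add_right[OF Am[OF assms(1,4)] Am[OF assms(2,4)] assms(3)]
      Ec_add_left[OF Am[OF assms(1,3)] Am[OF assms(2,3)] assms(4)] by simp
qed

lemma energy_scale_left:
  assumes "u \<in> C0 \<inter> D" "v \<in> C0 \<inter> D" "f \<in> C0 \<inter> D"
  shows "energy (\<lambda>x. c * u x) v f = c * energy u v f"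
proof -
  note Am = A.A_mult
  show ?thesis unfolding energy_def mult.assoc
    using Ec_scale_left[OF assms(1,1) Am[OF assms(2,3)], of c] Ec_scale_right[OF Am[OF assms(1,3)] Am[OF assms(1,3)] assms(2), of c]
      Ec_scale_left[OF Am[OF assms(1,2)] Am[OF assms(1,2)] assms(3), of c]
    by (simp add: algebra_simps)
qed

lemma energy_add_test:
  assumes "u \<in> C0 \<inter> D" "v \<in> C0 \<inter> D" "f \<in> C0 \<inter> D" "g \<in> C0 \<inter> D"
  shows "energy u v (\<lambda>x. f x + g x) = energy u v f + energy u v g"
proof -
  note Am = A.A_mult
  show ?thesis unfolding energy_def distrib_left
    using Ec_add_right[OF Am[OF assms(2,3)] Am[OF assms(2,4)] assms(1)] Ec_add_right[OF Am[OF assms(1,3)] Am[OF assms(1,4)] assms(2)]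
      Ec_add_right[OF assms(3,4) Am[OF assms(1,2)]] by simp
qed

lemma energy_scale_test:
  assumes "u \<in> C0 \<inter> D" "v \<in> C0 \<inter> D" "f \<in> C0 \<inter> D"
  shows "energy u v (\<lambda>x. c * f x) = c * energy u v f"
proof -
  note Am = A.A_mult
  show ?thesis unfolding energy_def mult.left_commute[of _ c]
    using Ec_scale_right[OF Am[OF assms(2,3)] Am[OF assms(2,3)] assms(1), of c] Ec_scale_right[OF Am[OF assms(1,3)] Am[OF assms(1,3)] assms(2), of c]
      Ec_scale_right[OF assms(3,3) Am[OF assms(1,2)], of c] by (simp add: algebra_simps)
qed

section \<open>Nonnegativity of the energy and existence of the energy measures\<close>

lemma off_diagonal_cutoff:
  obtains \<eta> :: "nat \<Rightarrow> 'a \<times> 'a \<Rightarrow> real" where "\<And>n p. 0 \<le> \<eta> n p" "\<And>n p. \<eta> n p \<le> 1"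
    "\<And>n f. f \<in> Cc UNIV \<Longrightarrow> (\<lambda>p. f p * \<eta> n p) \<in> Cc (- diag)"
    "\<And>p. p \<notin> diag \<Longrightarrow> (\<lambda>n. \<eta> n p) \<longlonglongrightarrow> 1"
proof
  define \<eta> :: "nat \<Rightarrow> 'a \<times> 'a \<Rightarrow> real" where "\<eta> n p = min 1 (max 0 (real n * dist (fst p) (snd p) - 1))" for n p
  show "0 \<le> \<eta> n p" "\<eta> n p \<le> 1" for n p by (auto simp: \<eta>_def)
  have cont: "continuous_on UNIV (\<eta> n)" for n unfolding \<eta>_def[abs_def] by (intro continuous_intros)
  show "(\<lambda>p. f p * \<eta> n p) \<in> Cc (- diag)" if f: "f \<in> Cc UNIV" for n f
  proof (rule CcI)
    show "continuous_on UNIV (\<lambda>p. f p * \<eta> n p)" by (intro continuous_intros Cc_cont[OF f] cont)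
    have "closed {p :: 'a \<times> 'a. 1 \<le> real n * dist (fst p) (snd p)}" by (intro closed_Collect_le continuous_intros)
    then show "compact (fsupp f \<inter> {p. 1 \<le> real n * dist (fst p) (snd p)})"
      by (intro compact_Int_closed Cc_compact[OF f])
    show "fsupp f \<inter> {p. 1 \<le> real n * dist (fst p) (snd p)} \<subseteq> - diag" by (auto simp: diag_def)
    show "f p * \<eta> n p = 0" if "p \<notin> fsupp f \<inter> {p. 1 \<le> real n * dist (fst p) (snd p)}" for p
      using that not_in_fsupp[of p f] by (auto simp: \<eta>_def)
  qed
  show "(\<lambda>n. \<eta> n p) \<longlonglongrightarrow> 1" if "p \<notin> diag" for p
  proof -
    have d: "0 < dist (fst p) (snd p)" using that by (simp add: diag_def)
    obtain N :: nat where N: "2 / dist (fst p) (snd p) < N" using reals_Archimedean2 by blast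
    have "\<eta> n p = 1" if "n \<ge> N" for n
    proof -
      have "2 \<le> real N * dist (fst p) (snd p)" using N d by (simp add: field_simps)
      also have "\<dots> \<le> real n * dist (fst p) (snd p)" using that d by (intro mult_right_mono) auto
      finally show ?thesis by (simp add: \<eta>_def)
    qed
    then show ?thesis by (intro tendsto_eventually) (auto simp: eventually_sequentially)
  qed
qed

lemma AE_jump_off_diagonal: "AE p in jump. p \<notin> diag"
proof (rule AE_not_in)
  have "(diag :: ('a \<times> 'a) set) \<in> sets borel" using open_Compl_diag by (intro borel_closed) (simp add: closed_def)
  then show "diag \<in> null_sets jump" using radon_jump by (auto simp: null_sets_def radon_on_def)
qed

text \<open>Truncate \<theta> away from the diagonal, where vague convergence to 2J holds, and then
  remove the truncation by dominated convergence. Only an inequality can be expected: mass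
  concentrating on the diagonal in the limit is lost.\<close>

lemma jump_integral_bound:
  assumes \<theta>: "\<theta> \<in> Cc UNIV" "\<And>p. 0 \<le> \<theta> p" "integrable jump \<theta>"
    and lim: "((\<lambda>\<beta>. \<beta> * (\<integral>p. \<theta> p \<partial>sig \<beta>)) \<longlongrightarrow> L) at_top"
  shows "2 * (\<integral>p. \<theta> p \<partial>jump) \<le> L"
proof -
  obtain \<eta> :: "nat \<Rightarrow> 'a \<times> 'a \<Rightarrow> real" where \<eta>: "\<And>n p. 0 \<le> \<eta> n p" "\<And>n p. \<eta> n p \<le> 1"
    "\<And>n f. f \<in> Cc UNIV \<Longrightarrow> (\<lambda>p. f p * \<eta> n p) \<in> Cc (- diag)"
    "\<And>p. p \<notin> diag \<Longrightarrow> (\<lambda>n. \<eta> n p) \<longlonglongrightarrow> 1"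
    using off_diagonal_cutoff by blast
  have le: "\<theta> p * \<eta> n p \<le> \<theta> p" for n p using mult_left_mono[OF \<eta>(2) \<theta>(2)] by simp
  have bound: "2 * (\<integral>p. \<theta> p * \<eta> n p \<partial>jump) \<le> L" for n
  proof (rule tendsto_le[OF _ lim jump_vague_limit[OF \<eta>(3)[OF \<theta>(1)]]])
    show "\<forall>\<^sub>F \<beta> in at_top. \<beta> * (\<integral>p. \<theta> p * \<eta> n p \<partial>sig \<beta>) \<le> \<beta> * (\<integral>p. \<theta> p \<partial>sig \<beta>)"
      using eventually_ge_at_top[of 1]
    proof eventually_elim
      case (elim \<beta>)
      then have R: "radon_on UNIV (sig \<beta>)" using radon_sig by (simp add: radon_on_UNIV)
      have "(\<integral>p. \<theta> p * \<eta> n p \<partial>sig \<beta>) \<le> (\<integral>p. \<theta> p \<partial>sig \<beta>)"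
        by (rule integral_mono[OF Cc_integrable[OF R Cc_mono[OF \<eta>(3)[OF \<theta>(1)]]] Cc_integrable[OF R \<theta>(1)] le]) auto
      then show ?case using elim by (intro mult_left_mono) auto
    qed
  qed simp
  have "(\<lambda>n. \<integral>p. \<theta> p * \<eta> n p \<partial>jump) \<longlonglongrightarrow> (\<integral>p. \<theta> p \<partial>jump)"
  proof (rule integral_dominated_convergence[where w = \<theta>])
    show "(\<lambda>p. \<theta> p * \<eta> n p) \<in> borel_measurable jump" for n by (rule Cc_measurable[OF sets_jump \<eta>(3)[OF \<theta>(1)]])
    show "AE p in jump. (\<lambda>n. \<theta> p * \<eta> n p) \<longlonglongrightarrow> \<theta> p"
      using AE_jump_off_diagonal
    proof eventually_elim
      case (elim p)
      show ?case using tendsto_mult_left[OF \<eta>(4)[OF elim], of "\<theta> p"] by simp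
    qed
    show "AE p in jump. norm (\<theta> p * \<eta> n p) \<le> \<theta> p" for n using \<theta>(2) \<eta>(1) le by simp
  qed (use \<theta>(3) in auto)
  then have "(\<lambda>n. 2 * (\<integral>p. \<theta> p * \<eta> n p \<partial>jump)) \<longlonglongrightarrow> 2 * (\<integral>p. \<theta> p \<partial>jump)" by (intro tendsto_intros)
  then show ?thesis by (rule LIMSEQ_le_const2) (use bound in auto)
qed

lemma tensor_C0: "u \<in> C0 \<Longrightarrow> v \<in> C0 \<Longrightarrow> tensor u v \<in> Cc UNIV" for u v :: "'a \<Rightarrow> real"
  by (rule tensor_Cc) auto

text \<open>With \<open>\<theta>(x,y) = f(y) (w(x)\<^sup>2 - 2 w(x) w(y) + \<kappa>(x) w(y)\<^sup>2)\<close>, a nonnegative function of compact support,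
  \<open>\<beta> \<integral>\<theta> d\<sigma>\<^sub>\<beta>\<close> converges to \<open>2 \<E>(w, wf) - \<E>(w\<^sup>2, f) - \<E>(\<kappa>, w\<^sup>2 f)\<close>; bounding the limit from below by
  the off-diagonal mass leaves exactly the energy.\<close>
lemma energy_nonneg:
  assumes w: "w \<in> C0 \<inter> D" and f: "f \<in> C0 \<inter> D" "\<And>x. 0 \<le> f x"
  shows "0 \<le> energy w w f"
proof -
  define wf ww wwf where "wf = (\<lambda>x. w x * f x)" and "ww = (\<lambda>x. w x * w x)" and "wwf = (\<lambda>x. w x * w x * f x)"
  have A: "wf \<in> C0 \<inter> D" "ww \<in> C0 \<inter> D" "wwf \<in> C0 \<inter> D"
    unfolding wf_def ww_def wwf_def by (intro A.A_mult w f)+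
  have "compact (fsupp w)" using w by (auto simp: C0_def)
  then obtain \<kappa> where \<kappa>: "\<kappa> \<in> C0 \<inter> D" "\<And>v. fsupp v \<subseteq> fsupp w \<Longrightarrow> is_cutoff \<kappa> v" by (rule is_cutoff_exists) (rule that)
  have \<kappa>w: "is_cutoff \<kappa> w" "is_cutoff \<kappa> wwf" by (auto intro!: \<kappa>(2) fsupp_mono simp: wwf_def)
  have \<kappa>1: "w x \<noteq> 0 \<Longrightarrow> \<kappa> x = 1" for x by (rule is_cutoff_eq_1[OF \<kappa>w(1)])
  define \<theta> where "\<theta> p = tensor ww f p - 2 * tensor w wf p + tensor \<kappa> wwf p" for p
  have \<theta>_eq: "\<theta> (x, y) = f y * (w x * w x - 2 * w x * w y + \<kappa> x * (w y * w y))" for x y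
    by (simp add: \<theta>_def tensor_def wf_def ww_def wwf_def algebra_simps)
  have tC: "tensor ww f \<in> Cc UNIV" "tensor w wf \<in> Cc UNIV" "tensor \<kappa> wwf \<in> Cc UNIV"
    using A w f \<kappa>(1) by (auto intro!: tensor_C0)
  have \<theta>C: "\<theta> \<in> Cc UNIV" unfolding \<theta>_def[abs_def] by (intro Cc_add Cc_diff Cc_scale tC)
  have \<theta>0: "0 \<le> \<theta> p" for p
  proof (cases p)
    case (Pair x y)
    \<comment> \<open>If w(x) = 0, only the nonnegative third term is left; otherwise \<kappa>(x) =
      1 and the expression is a square.\<close>
    have "0 \<le> w x * w x - 2 * w x * w y + \<kappa> x * (w y * w y)"
    proof (cases "w x = 0")
      case True then show ?thesis using \<kappa>w(1) by (simp add: is_cutoff_def)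
    next
      case False
      have "0 \<le> (w x - w y) * (w x - w y)" by simp
      then show ?thesis using \<kappa>1[OF False] by (simp add: algebra_simps)
    qed
    then show ?thesis using Pair f(2) \<theta>_eq by simp
  qed
  have lim: "((\<lambda>\<beta>. \<beta> * (\<integral>p. \<theta> p \<partial>sig \<beta>)) \<longlongrightarrow> 2 * \<E> w wf - \<E> ww f - \<E> \<kappa> wwf) at_top"
  proof (rule Lim_transform_eventually)
    show "((\<lambda>\<beta>. 2 * (\<beta> * (ip m w wf - (\<integral>p. tensor w wf p \<partial>sig \<beta>))) - \<beta> * (ip m ww f - (\<integral>p. tensor ww f p \<partial>sig \<beta>))
       - \<beta> * (ip m \<kappa> wwf - (\<integral>p. tensor \<kappa> wwf p \<partial>sig \<beta>))) \<longlongrightarrow> 2 * \<E> w wf - \<E> ww f - \<E> \<kappa> wwf) at_top"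
      by (intro tendsto_intros sig_limit A w f \<kappa>)
    have "(\<lambda>x. \<kappa> x * wwf x) = wwf" 
    proof
      show "\<kappa> x * wwf x = wwf x" for x using \<kappa>1[of x] by (cases "w x = 0") (auto simp: wwf_def)
    qed
    \<comment> \<open>The three inner products coincide, so they cancel with coefficients 2 - 1 - 1
      and only the integrals against \<open>sig\<close> survive.\<close>
    then have ips: "ip m w wf = integral\<^sup>L m wwf" "ip m ww f = integral\<^sup>L m wwf" "ip m \<kappa> wwf = integral\<^sup>L m wwf"
      by (simp_all add: ip_def wf_def ww_def wwf_def mult.assoc)
    show "\<forall>\<^sub>F \<beta> in at_top. 2 * (\<beta> * (ip m w wf - (\<integral>p. tensor w wf p \<partial>sig \<beta>))) - \<beta> * (ip m ww f - (\<integral>p. tensor ww f p \<partial>sig \<beta>))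
       - \<beta> * (ip m \<kappa> wwf - (\<integral>p. tensor \<kappa> wwf p \<partial>sig \<beta>)) = \<beta> * (\<integral>p. \<theta> p \<partial>sig \<beta>)"
      using eventually_ge_at_top[of 1]
    proof eventually_elim
      case (elim \<beta>)
      then have R: "radon_on UNIV (sig \<beta>)" using radon_sig by (simp add: radon_on_UNIV)
      have eq: "(\<integral>p. \<theta> p \<partial>sig \<beta>) = (\<integral>p. tensor ww f p \<partial>sig \<beta>) - 2 * (\<integral>p. tensor w wf p \<partial>sig \<beta>) + (\<integral>p. tensor \<kappa> wwf p \<partial>sig \<beta>)"
        unfolding \<theta>_def using tC[THEN Cc_integrable[OF R]] by simp
      show ?case unfolding ips eq by (simp add: algebra_simps)
    qed
  qed
  have \<theta>_jump: "\<theta> = (\<lambda>p. 2 * ((w (snd p) - w (fst p)) * wf (snd p)) - (ww (snd p) - ww (fst p)) * f (snd p) - jump_integrand \<kappa> wwf p)"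
  proof
    fix p show "\<theta> p = 2 * ((w (snd p) - w (fst p)) * wf (snd p)) - (ww (snd p) - ww (fst p)) * f (snd p) - jump_integrand \<kappa> wwf p"
      by (simp add: \<theta>_def tensor_def jump_integrand_def wf_def ww_def wwf_def algebra_simps)
  qed
  note ints = jump_integrable[OF w A(1)] jump_integrable[OF A(2) f(1)] jump_integrand_integrable[OF \<kappa>w(2) A(3)]
  have \<theta>_int: "integrable jump \<theta>" unfolding \<theta>_jump using ints by simp
  have \<theta>_val: "(\<integral>p. \<theta> p \<partial>jump) = 2 * jump_int w wf - jump_int ww f - (\<integral>p. jump_integrand \<kappa> wwf p \<partial>jump)"
    unfolding \<theta>_jump jump_int_def using ints by simp
  have \<kappa>_kill: "\<E> \<kappa> wwf = 2 * (\<integral>p. jump_integrand \<kappa> wwf p \<partial>jump) + (\<integral>x. wwf x \<partial>Km m \<E> D)"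
  proof -
    have "\<exists>U c. open U \<and> fsupp wwf \<subseteq> U \<and> (\<forall>x\<in>U. \<kappa> x = c)" using \<kappa>w(2) by (auto simp: is_cutoff_def)
    then have "\<E> \<kappa> wwf = (\<integral>p. 2 * (\<kappa> (snd p) - \<kappa> (fst p)) * wwf (snd p) \<partial>jump) + (\<integral>x. \<kappa> x * wwf x \<partial>Km m \<E> D)"
      using JK_char_Jm_Km \<kappa>(1) A(3) unfolding JK_char_def Jm_eq_jump by blast
    moreover have "2 * (\<kappa> (snd p) - \<kappa> (fst p)) * wwf (snd p) = 2 * jump_integrand \<kappa> wwf p" for p
      using \<kappa>1[of "snd p"] by (cases "w (snd p) = 0") (auto simp: jump_integrand_def wwf_def)
    moreover have "\<kappa> x * wwf x = wwf x" for x using \<kappa>1[of x] by (cases "w x = 0") (auto simp: wwf_def)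
    ultimately show ?thesis by (simp only: integral_mult_right_zero)
  qed
  have K: "(\<integral>x. w x * wf x \<partial>Km m \<E> D) = (\<integral>x. wwf x \<partial>Km m \<E> D)" "(\<integral>x. ww x * f x \<partial>Km m \<E> D) = (\<integral>x. wwf x \<partial>Km m \<E> D)"
    by (simp_all add: wf_def ww_def wwf_def mult.assoc)
  have "energy w w f = 2 * Ec m \<E> D w wf - Ec m \<E> D ww f" by (simp add: energy_def wf_def ww_def)
  \<comment> \<open>The two \<open>Ec\<close> terms miss the \<kappa>-part of the jump integral of
    \<theta> and retain one killing integral; by \<open>\<kappa>_kill\<close> these two leftovers
    together are \<E>(\<kappa>, w^2 f).\<close>
  also have "\<dots> = 2 * \<E> w wf - \<E> ww f - \<E> \<kappa> wwf - 2 * (\<integral>p. \<theta> p \<partial>jump)"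
    unfolding Ec_eq \<theta>_val \<kappa>_kill K by simp
  finally show ?thesis using jump_integral_bound[OF \<theta>C \<theta>0 \<theta>_int lim] by linarith
qed

lemma energy_measure_exists:
  assumes w: "w \<in> C0 \<inter> D"
  shows "\<exists>\<mu>. radon \<mu> \<and> (\<forall>f\<in>C0 \<inter> D. (\<integral>x. f x \<partial>\<mu>) = energy w w f)"
proof -
  define S where "S = {(f, energy w w f) | f. f \<in> C0 \<inter> D}"
  have "fst ` S = C0 \<inter> D" by (force simp: S_def)
  obtain \<mu> where "radon_on UNIV \<mu>" "\<And>f c. (f, c) \<in> S \<Longrightarrow> (\<integral>x. f x \<partial>\<mu>) = c"
  proof (rule dense_functional_representation[OF loc_comp open_UNIV, of S])
    show "dense_in_Cc UNIV (fst ` S)" unfolding \<open>fst ` S = C0 \<inter> D\<close> by (rule dense_C0_D)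
    show "(\<lambda>x. f x + g x, c + d) \<in> S" if "(f, c) \<in> S" "(g, d) \<in> S" for f c g d
      using that energy_add_test[OF w w] A.A_add[of f g] by (auto simp: S_def)
    show "(\<lambda>x. r * f x, r * c) \<in> S" if "(f, c) \<in> S" for f c r
      using that energy_scale_test[OF w w] A.A_scale[of f r] by (auto simp: S_def)
    show "0 \<le> c" if "(f, c) \<in> S" "\<And>x. 0 \<le> f x" for f c
      using that energy_nonneg[OF w] by (auto simp: S_def)
  qed (rule that)
  then show ?thesis by (auto simp: S_def radon_on_UNIV)
qed

text \<open>Polarisation with (u + v)/2 and (u - v)/2 writes the energy as a difference of two
  positive functionals, hence of two Radon measures. \<open>mu_c\<close> is defined by
  \<open>SOME\<close>, so existence suffices.\<close>

lemma mu_c: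
  assumes u: "u \<in> C0 \<inter> D" and v: "v \<in> C0 \<inter> D" and f: "f \<in> C0 \<inter> D"
  shows "sint (mu_c m \<E> D u v) f = energy u v f"
proof -
  define a b where "a = (\<lambda>x. 1/2 * u x + 1/2 * v x)" and "b = (\<lambda>x. 1/2 * u x + (-1/2) * v x)"
  have ab: "a \<in> C0 \<inter> D" "b \<in> C0 \<inter> D" unfolding a_def b_def by (intro A.A_add A.A_scale u v)+
  have expand: "energy (\<lambda>x. c * u x + d * v x) (\<lambda>x. c * u x + d * v x) f
      = c * c * energy u u f + 2 * c * d * energy u v f + d * d * energy v v f" if f: "f \<in> C0 \<inter> D" for c d f
  proof -
    note S = A.A_scale
    let ?w = "\<lambda>x. c * u x + d * v x"
    have wA: "?w \<in> C0 \<inter> D" by (intro A.A_add S u v)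
    have left: "energy ?w z f = c * energy u z f + d * energy v z f" if z: "z \<in> C0 \<inter> D" for z
      using energy_add_left[OF S[OF u] S[OF v] z f, of c d] energy_scale_left[OF u z f] energy_scale_left[OF v z f] by simp
    show ?thesis using left[OF wA] left[OF u] left[OF v] energy_commute[of u ?w] energy_commute[of v ?w] energy_commute[of u v]
      by (simp add: algebra_simps)
  qed
  have polar: "energy a a f - energy b b f = energy u v f" if "f \<in> C0 \<inter> D" for f
    unfolding a_def b_def expand[OF that] by simp
  obtain \<mu> \<nu> where \<mu>: "radon \<mu>" "\<And>f. f \<in> C0 \<inter> D \<Longrightarrow> (\<integral>x. f x \<partial>\<mu>) = energy a a f"
    and \<nu>: "radon \<nu>" "\<And>f. f \<in> C0 \<inter> D \<Longrightarrow> (\<integral>x. f x \<partial>\<nu>) = energy b b f"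
    using energy_measure_exists[OF ab(1)] energy_measure_exists[OF ab(2)] by blast
  have "\<exists>\<mu>. radon (fst \<mu>) \<and> radon (snd \<mu>) \<and> (\<forall>f \<in> C0 \<inter> D. sint \<mu> f = energy u v f)"
    using \<mu> \<nu> polar by (intro exI[of _ "(\<mu>, \<nu>)"]) (simp add: sint_def)
  from someI_ex[OF this] show ?thesis
    using f unfolding mu_c_def energy_def by blast
qed

text \<open>In the reflected coordinates of \<open>sig\<close> the integrand on
  \<open>Lambda\<close> is (u(x) - u(y))v(x). For large l it equals \<psi>(x,y) = (\<kappa>(y)u(x) -
  u(y))v(x) there, and \<psi> is a difference of two tensor products of functions in the domain. So
  the integral over \<open>Lambda\<close> is a global one, whose limit is known from
  \<open>sig_limit\<close>, minus one over \<Gamma>, away from the diagonal.\<close>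

lemma Ehat_c_eq:
  assumes u: "u \<in> C0 \<inter> D" and v: "v \<in> C0 \<inter> D" and \<kappa>: "\<kappa> \<in> C0 \<inter> D"
    and U: "open U" "fsupp u \<union> fsupp v \<subseteq> U" "\<And>x. x \<in> U \<Longrightarrow> \<kappa> x = 1"
    and ex: "exhaustion_ok m \<E> D \<Omega> \<zeta>"
  shows "Ehat_c m \<E> D \<Omega> \<zeta> u v = Ec m \<E> D v u - Ec m \<E> D (\<lambda>x. u x * v x) \<kappa>"
proof -
  define uv where "uv = (\<lambda>x. u x * v x)"
  have uvA: "uv \<in> C0 \<inter> D" unfolding uv_def by (rule A.A_mult[OF u v])
  define \<psi> where "\<psi> p = tensor uv \<kappa> p - tensor v u p" for p
  have \<psi>_eq: "\<psi> p = (\<kappa> (snd p) * u (fst p) - u (snd p)) * v (fst p)" for p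
    by (simp add: \<psi>_def tensor_def uv_def algebra_simps)
  have tC: "tensor uv \<kappa> \<in> Cc UNIV" "tensor v u \<in> Cc UNIV" using uvA u v \<kappa> by (auto intro!: tensor_C0)
  have \<psi>C: "\<psi> \<in> Cc UNIV" unfolding \<psi>_def[abs_def] by (intro Cc_diff tC)
  have \<kappa>uv: "uv x * \<kappa> x = uv x" for x using U in_fsupp[of u x] by (cases "u x = 0") (auto simp: uv_def)
  define L where "L = \<E> v u - \<E> uv \<kappa>"
  have lim\<psi>: "((\<lambda>\<beta>. \<beta> * (\<integral>p. \<psi> p \<partial>sig \<beta>)) \<longlongrightarrow> L) at_top"
  proof (rule Lim_transform_eventually)
    show "((\<lambda>\<beta>. \<beta> * (ip m v u - (\<integral>p. tensor v u p \<partial>sig \<beta>)) - \<beta> * (ip m uv \<kappa> - (\<integral>p. tensor uv \<kappa> p \<partial>sig \<beta>))) \<longlongrightarrow> L) at_top"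
      unfolding L_def by (intro tendsto_diff sig_limit u v uvA \<kappa>)
    have ips: "ip m uv \<kappa> = ip m v u" by (simp add: ip_def \<kappa>uv) (simp add: uv_def mult.commute)
    show "\<forall>\<^sub>F \<beta> in at_top. \<beta> * (ip m v u - (\<integral>p. tensor v u p \<partial>sig \<beta>)) - \<beta> * (ip m uv \<kappa> - (\<integral>p. tensor uv \<kappa> p \<partial>sig \<beta>))
        = \<beta> * (\<integral>p. \<psi> p \<partial>sig \<beta>)"
      using eventually_ge_at_top[of 1]
    proof eventually_elim
      case (elim \<beta>)
      then have R: "radon_on UNIV (sig \<beta>)" using radon_sig by (simp add: radon_on_UNIV)
      have eq: "(\<integral>p. \<psi> p \<partial>sig \<beta>) = (\<integral>p. tensor uv \<kappa> p \<partial>sig \<beta>) - (\<integral>p. tensor v u p \<partial>sig \<beta>)"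
        unfolding \<psi>_def using tC[THEN Cc_integrable[OF R]] by simp
      show ?case unfolding ips eq by (simp add: algebra_simps)
    qed
  qed
  have \<Omega>: "open (\<Omega> l)" "compact (closure (\<Omega> l))" "\<Omega> l \<subseteq> \<Omega> (Suc l)" "(\<Union>l. \<Omega> l) = UNIV"
    and \<zeta>: "0 < \<zeta> l" "\<zeta> \<longlonglongrightarrow> 0"
    and fr: "emeasure jump (frontier {p. fst p \<in> \<Omega> l \<and> snd p \<in> \<Omega> l \<and> \<zeta> l \<le> dist (fst p) (snd p)}) = 0" for l
    using ex by (auto simp: exhaustion_ok_def Jm_eq_jump)
  have \<Omega>_mono: "\<Omega> k \<subseteq> \<Omega> l" if "k \<le> l" for k l
    using that \<Omega>(3) by (induction rule: dec_induct) auto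
  define \<Gamma> where "\<Gamma> l = {p. fst p \<in> \<Omega> l \<and> snd p \<in> \<Omega> l \<and> \<zeta> l \<le> dist (fst p) (snd p)}" for l
  have \<Gamma>_borel: "\<Gamma> l \<in> sets borel" for l
  proof -
    have "\<Gamma> l = (\<Omega> l \<times> \<Omega> l) \<inter> {p. \<zeta> l \<le> dist (fst p) (snd p)}" by (auto simp: \<Gamma>_def)
    moreover have "closed {p :: 'a \<times> 'a. \<zeta> l \<le> dist (fst p) (snd p)}" by (intro closed_Collect_le continuous_intros)
    ultimately show ?thesis using \<Omega>(1)[of l] by (simp only: sets.Int borel_open borel_closed open_Times)
  qed
  have cl\<Gamma>: "closure (\<Gamma> l) \<subseteq> (closure (\<Omega> l) \<times> closure (\<Omega> l)) \<inter> {p. \<zeta> l \<le> dist (fst p) (snd p)}" for l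
  proof (rule closure_minimal)
    show "\<Gamma> l \<subseteq> (closure (\<Omega> l) \<times> closure (\<Omega> l)) \<inter> {p. \<zeta> l \<le> dist (fst p) (snd p)}"
      using closure_subset[of "\<Omega> l"] by (auto simp: \<Gamma>_def)
    show "closed ((closure (\<Omega> l) \<times> closure (\<Omega> l)) \<inter> {p. \<zeta> l \<le> dist (fst p) (snd p)})"
      by (intro closed_Int closed_Times closed_closure closed_Collect_le continuous_intros)
  qed
  have "compact (closure (\<Gamma> l))" for l
    using compact_Int_closed[OF compact_Times[OF \<Omega>(2)[of l] \<Omega>(2)[of l]] closed_closure[of "\<Gamma> l"]] cl\<Gamma>[of l]
    by (simp add: Int_absorb1 le_inf_iff)
  moreover have "closure (\<Gamma> l) \<subseteq> - diag" for l using cl\<Gamma>[of l] \<zeta>(1)[of l] by (fastforce simp: diag_def)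
  \<comment> \<open>The continuity-set hypothesis of \<open>exhaustion_ok\<close> enters here. Vague
    convergence applies because the closure of \<open>\<Gamma> l\<close> is compact and keeps
    distance at least \<open>\<zeta> l\<close> from the diagonal.\<close>
  ultimately have lim\<Gamma>: "((\<lambda>\<beta>. \<beta> * (\<integral>p. indicator (\<Gamma> l) p * \<psi> p \<partial>sig \<beta>)) \<longlongrightarrow> 2 * (\<integral>p. indicator (\<Gamma> l) p * \<psi> p \<partial>jump)) at_top" for l
    by (intro vague_limit_continuity_set[OF locally_compact_space_prod_euclidean[OF loc_comp] open_Compl_diag
          _ radon_jump jump_vague_limit _ \<Gamma>_borel, of 1])
       (use radon_sig fr[of l] Cc_cont[OF \<psi>C] in \<open>auto simp: \<Gamma>_def\<close>)
  have supp: "compact (fsupp u \<union> fsupp v \<union> fsupp \<kappa>)" using u v \<kappa> by (auto simp: C0_def intro!: compact_Un)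
  obtain F where F: "finite F" "fsupp u \<union> fsupp v \<union> fsupp \<kappa> \<subseteq> (\<Union>l\<in>F. \<Omega> l)"
    using compactE_image[OF supp, of UNIV \<Omega>] \<Omega>(1,4) by auto
  define N1 where "N1 = Max (insert 0 F)"
  have in\<Omega>: "fsupp u \<union> fsupp v \<union> fsupp \<kappa> \<subseteq> \<Omega> l" if "N1 \<le> l" for l
  proof -
    have "\<Omega> k \<subseteq> \<Omega> l" if "k \<in> F" for k
      using that F(1) \<open>N1 \<le> l\<close> by (intro \<Omega>_mono) (auto simp: N1_def)
    then show ?thesis using F(2) by blast
  qed
  have "compact (fsupp v)" "fsupp v \<subseteq> U" using v U by (auto simp: C0_def)
  \<comment> \<open>Once \<open>\<zeta> l\<close> is below this \<delta>, a point of
    \<open>Lambda\<close> with x in the support of v has y in U, where \<kappa>(y) = 1.\<close>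
  then obtain \<delta> where \<delta>: "0 < \<delta>" "(\<Union>x\<in>fsupp v. ball x \<delta>) \<subseteq> U"
    using compact_subset_open_imp_ball_epsilon_subset[OF _ U(1)] by metis
  obtain N2 where N2: "\<And>l. N2 \<le> l \<Longrightarrow> \<zeta> l < \<delta>"
    using order_tendstoD(2)[OF \<zeta>(2) \<delta>(1)] by (auto simp: eventually_sequentially)
  \<comment> \<open>With v(x) nonzero there are three cases: y outside \<open>\<Omega> l\<close>,
    where u(y) and \<kappa>(y) vanish and hence \<psi> = 0; y near x, where \<kappa>(y) = 1; and
    otherwise a point of \<Gamma>, where both sides are 0.\<close>
  have decomp: "indicator (Lambda \<Omega> \<zeta> l) p * ((u (fst p) - u (snd p)) * v (fst p)) = \<psi> p - indicator (\<Gamma> l) p * \<psi> p"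
    if l: "max N1 N2 \<le> l" for l p
  proof (cases "v (fst p) = 0")
    case False
    have x: "fst p \<in> fsupp v" using in_fsupp[of v, OF False] .
    have x\<Omega>: "fst p \<in> \<Omega> l" using x in\<Omega>[of l] l by auto
    show ?thesis
    proof (cases "snd p \<in> \<Omega> l")
      case out: False
      then have "snd p \<notin> fsupp u" "snd p \<notin> fsupp \<kappa>" using in\<Omega>[of l] l by auto
      then show ?thesis using out by (simp add: \<psi>_eq not_in_fsupp Lambda_def \<Gamma>_def)
    next
      case y: True
      show ?thesis
      proof (cases "dist (fst p) (snd p) < \<zeta> l")
        case near: True
        have "dist (fst p) (snd p) < \<delta>" using near N2[of l] l by simp
        then have "snd p \<in> U" using \<delta>(2) x by (auto simp: subset_iff)
        then show ?thesis using near x\<Omega> y U(3) by (simp add: \<psi>_eq Lambda_def \<Gamma>_def)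
      next
        case False
        then show ?thesis using x\<Omega> y by (simp add: Lambda_def \<Gamma>_def)
      qed
    qed
  qed (simp add: \<psi>_eq)
  define a where "a l = L - 2 * (\<integral>p. indicator (\<Gamma> l) p * \<psi> p \<partial>jump)" for l
  have inner: "Lim at_top (\<lambda>\<beta>::real. \<beta> * (\<integral>p. indicator (Lambda \<Omega> \<zeta> l) p * ((u (snd p) - u (fst p)) * v (snd p)) \<partial>sigma_hat m \<E> D \<beta>)) = a l"
    if l: "max N1 N2 \<le> l" for l
  proof (rule tendsto_Lim)
    show "((\<lambda>\<beta>. \<beta> * (\<integral>p. indicator (Lambda \<Omega> \<zeta> l) p * ((u (snd p) - u (fst p)) * v (snd p)) \<partial>sigma_hat m \<E> D \<beta>)) \<longlongrightarrow> a l) at_top"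
    proof (rule Lim_transform_eventually)
      show "((\<lambda>\<beta>. \<beta> * (\<integral>p. \<psi> p \<partial>sig \<beta>) - \<beta> * (\<integral>p. indicator (\<Gamma> l) p * \<psi> p \<partial>sig \<beta>)) \<longlongrightarrow> a l) at_top"
        unfolding a_def by (intro tendsto_diff lim\<psi> lim\<Gamma>)
      show "\<forall>\<^sub>F \<beta> in at_top. \<beta> * (\<integral>p. \<psi> p \<partial>sig \<beta>) - \<beta> * (\<integral>p. indicator (\<Gamma> l) p * \<psi> p \<partial>sig \<beta>)
          = \<beta> * (\<integral>p. indicator (Lambda \<Omega> \<zeta> l) p * ((u (snd p) - u (fst p)) * v (snd p)) \<partial>sigma_hat m \<E> D \<beta>)"
        using eventually_ge_at_top[of 1]
      proof eventually_elim
        case (elim \<beta>)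
        then have R: "radon_on UNIV (sig \<beta>)" using radon_sig by (simp add: radon_on_UNIV)
        have i\<psi>: "integrable (sig \<beta>) \<psi>" by (rule Cc_integrable[OF R \<psi>C])
        have "\<Gamma> l \<in> sets (sig \<beta>)" using \<Gamma>_borel R by (simp add: radon_on_def)
        from integrable_mult_indicator[OF this i\<psi>]
        have i\<Gamma>: "integrable (sig \<beta>) (\<lambda>p. indicator (\<Gamma> l) p * \<psi> p)" by simp
        have m\<psi>: "\<psi> \<in> borel_measurable borel" using Cc_cont[OF \<psi>C] by (rule borel_measurable_continuous_onI)
        have "(\<integral>p. \<psi> p \<partial>sig \<beta>) - (\<integral>p. indicator (\<Gamma> l) p * \<psi> p \<partial>sig \<beta>) = (\<integral>p. \<psi> p - indicator (\<Gamma> l) p * \<psi> p \<partial>sig \<beta>)"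
          using i\<psi> i\<Gamma> by simp
        also have "\<dots> = (\<integral>p. \<psi> (prod.swap p) - indicator (\<Gamma> l) (prod.swap p) * \<psi> (prod.swap p) \<partial>sigma_hat m \<E> D \<beta>)"
          by (rule integral_sig[OF elim]) (use m\<psi> \<Gamma>_borel[of l] in measurable)
        also have "\<dots> = (\<integral>p. indicator (Lambda \<Omega> \<zeta> l) p * ((u (snd p) - u (fst p)) * v (snd p)) \<partial>sigma_hat m \<E> D \<beta>)"
        proof (rule Bochner_Integration.integral_cong[OF refl])
          fix p
          have "indicator (Lambda \<Omega> \<zeta> l) (prod.swap p) = (indicator (Lambda \<Omega> \<zeta> l) p :: real)"
            by (auto simp: indicator_def Lambda_def dist_commute)
          then show "\<psi> (prod.swap p) - indicator (\<Gamma> l) (prod.swap p) * \<psi> (prod.swap p) = indicator (Lambda \<Omega> \<zeta> l) p * ((u (snd p) - u (fst p)) * v (snd p))"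
            using decomp[OF l, of "prod.swap p"] by simp
        qed
        finally show ?case by (simp flip: right_diff_distrib)
      qed
    qed
  qed simp
  \<comment> \<open>Adding and subtracting u(y)v(y), that is uv(y)\<kappa>(y), writes \<psi> as a
    difference of two integrands covered by the standing assumption. This gives the dominating
    function for the limit in l and the value of the limit.\<close>
  have \<psi>_jump: "\<psi> = (\<lambda>p. (v (snd p) - v (fst p)) * u (snd p) - (uv (snd p) - uv (fst p)) * \<kappa> (snd p))"
  proof
    fix p show "\<psi> p = (v (snd p) - v (fst p)) * u (snd p) - (uv (snd p) - uv (fst p)) * \<kappa> (snd p)"
      using \<kappa>uv[of "snd p"] by (simp add: \<psi>_def tensor_def uv_def algebra_simps)
  qed
  note ints = jump_integrable[OF v u] jump_integrable[OF uvA \<kappa>]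
  have \<psi>_int: "integrable jump \<psi>" unfolding \<psi>_jump using ints by simp
  have \<psi>_val: "(\<integral>p. \<psi> p \<partial>jump) = jump_int v u - jump_int uv \<kappa>" unfolding \<psi>_jump jump_int_def using ints by simp
  have "(\<lambda>l. \<integral>p. indicator (\<Gamma> l) p * \<psi> p \<partial>jump) \<longlonglongrightarrow> (\<integral>p. \<psi> p \<partial>jump)"
  proof (rule integral_dominated_convergence[where w = "\<lambda>p. \<bar>\<psi> p\<bar>"])
    show "(\<lambda>p. indicator (\<Gamma> l) p * \<psi> p) \<in> borel_measurable jump" for l
      using integrable_mult_indicator[OF _ \<psi>_int, of "\<Gamma> l"] \<Gamma>_borel[of l] sets_jump by auto
    show "AE p in jump. (\<lambda>l. indicator (\<Gamma> l) p * \<psi> p) \<longlonglongrightarrow> \<psi> p"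
      using AE_jump_off_diagonal
    proof eventually_elim
      case (elim p)
      then have "0 < dist (fst p) (snd p)" by (simp add: diag_def)
      from order_tendstoD(2)[OF \<zeta>(2) this]
      obtain M where M: "\<And>l. M \<le> l \<Longrightarrow> \<zeta> l < dist (fst p) (snd p)"
        unfolding eventually_sequentially by blast
      obtain i j where ij: "fst p \<in> \<Omega> i" "snd p \<in> \<Omega> j" using \<Omega>(4) by blast
      have "p \<in> \<Gamma> l" if "max M (max i j) \<le> l" for l
        using M[of l] ij \<Omega>_mono[of i l] \<Omega>_mono[of j l] that by (auto simp: \<Gamma>_def)
      then have "\<forall>\<^sub>F l in sequentially. indicator (\<Gamma> l) p * \<psi> p = \<psi> p"
        unfolding eventually_sequentially by (intro exI[of _ "max M (max i j)"]) auto
      then show ?case by (rule tendsto_eventually)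
    qed
    show "AE p in jump. norm (indicator (\<Gamma> l) p * \<psi> p) \<le> \<bar>\<psi> p\<bar>" for l by (auto simp: indicator_def)
  qed (use \<psi>_int in auto)
  then have lim_a: "a \<longlonglongrightarrow> L - 2 * (\<integral>p. \<psi> p \<partial>jump)" unfolding a_def[abs_def] by (intro tendsto_intros)
  have "Ehat_c m \<E> D \<Omega> \<zeta> u v = L - 2 * (\<integral>p. \<psi> p \<partial>jump)"
    unfolding Ehat_c_def
  proof (rule limI, rule Lim_transform_eventually[OF lim_a])
    show "\<forall>\<^sub>F l in sequentially. a l = Lim at_top (\<lambda>\<beta>::real. \<beta> * (\<integral>p. indicator (Lambda \<Omega> \<zeta> l) p * ((u (snd p) - u (fst p)) * v (snd p)) \<partial>sigma_hat m \<E> D \<beta>))"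
      using eventually_ge_at_top[of "max N1 N2"] by eventually_elim (rule inner[symmetric])
  qed
  moreover have "(\<integral>x. v x * u x \<partial>Km m \<E> D) = (\<integral>x. uv x * \<kappa> x \<partial>Km m \<E> D)"
    by (simp add: \<kappa>uv) (simp add: uv_def mult.commute)
  ultimately show ?thesis unfolding Ec_eq \<psi>_val L_def uv_def[symmetric] by simp
qed

end

theorem theorem3p2:
  fixes m :: "'a::{metric_space, second_countable_topology} measure"
    and \<E> :: "('a \<Rightarrow> real) \<Rightarrow> ('a \<Rightarrow> real) \<Rightarrow> real"
    and D :: "('a \<Rightarrow> real) set"
    and \<Omega> :: "nat \<Rightarrow> 'a set" and \<zeta> :: "nat \<Rightarrow> real"
    and u v chi :: "'a \<Rightarrow> real"
  assumes "locally_compact_space (euclidean :: 'a topology)"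
    and "radon m" and "full_support m"
    and "regular_semi_dirichlet m \<E> D"
    and "standing_assumption m \<E> D"
    and "exhaustion_ok m \<E> D \<Omega> \<zeta>"
    and "u \<in> C0 \<inter> D" and "v \<in> C0 \<inter> D" and "chi \<in> C0 \<inter> D"
    and "\<exists>U. open U \<and> fsupp u \<union> fsupp v \<subseteq> U \<and> (\<forall>x \<in> U. chi x = 1)"
  shows "Ec m \<E> D u v = 1/2 * sint (mu_c m \<E> D u v) chi + Lfun m \<E> D \<Omega> \<zeta> u v chi"
proof -
  interpret standing_setting m \<E> D
    using assms(1,2,4,5) by unfold_locales (auto simp: standing_assumption_def)
  obtain U where U: "open U" "fsupp u \<union> fsupp v \<subseteq> U" "\<And>x. x \<in> U \<Longrightarrow> chi x = 1" using assms(10) by blast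
  have chi: "(\<lambda>x. u x * chi x) = u" "(\<lambda>x. v x * chi x) = v"
  proof -
    have "u x * chi x = u x" for x using U in_fsupp[of u x] by (cases "u x = 0") auto
    then show "(\<lambda>x. u x * chi x) = u" by (rule ext)
    have "v x * chi x = v x" for x using U in_fsupp[of v x] by (cases "v x = 0") auto
    then show "(\<lambda>x. v x * chi x) = v" by (rule ext)
  qed
  have "sint (mu_c m \<E> D u v) chi = Ec m \<E> D u v + Ec m \<E> D v u - Ec m \<E> D (\<lambda>x. u x * v x) chi"
    unfolding mu_c[OF assms(7-9)] energy_def chi ..
  moreover have "Lfun m \<E> D \<Omega> \<zeta> u v chi = 1/2 * (Ec m \<E> D u v - (Ec m \<E> D v u - Ec m \<E> D (\<lambda>x. u x * v x) chi))"
    using Ehat_c_eq[OF assms(7-9) U assms(6)] by (simp only: Lfun_def chi)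
  ultimately show ?thesis by (simp add: field_simps)
qed

end
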